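(* For $1\le k\le n$, the polynomial $\mathrm{Imm}_{\chi^{k1^{n-k}}}(x)$ is totally nonnegative. In particular, if $A$ is the path matrix of a nonnegative weighted planar network $F$ of order $n$, then \[ \mathrm{Imm}_{\chi^{k1^{n-k}}}(A)=\sum_U \mathrm{wgt}(U), \] where the sum is over all standard $F$-tableaux $U$ of shape $k1^{n-k}$.
   Context: For a function $\theta:\mathfrak S_n\to\mathbb R$ and $n\times n$ matrix $x=(x_{i,j})$, $\mathrm{Imm}_\theta(x)=\sum_{w\in\mathfrak S_n}\theta(w)x_{1,w(1)}\cdots x_{n,w(n)}$; $\chi^\lambda$ is the irreducible $\mathfrak S_n$-character indexed by $\lambda$; $k1^{n-k}=(k,1,\dots,1)$ with $n-k$ ones. A polynomial in the $x_{i,j}$ is totally nonnegative if its value at every totally nonnegative real matrix (all minors $\ge0$) is $\ge 0$. A nonnegative weighted planar network of order $n$ is a directed acyclic planar graph embedded in a disc, with $2n$ distinguished boundary vertices labeled clockwise $s_1,\dots,s_n,t_n,\dots,t_1$ (sources $s_i$ of indegree 0, sinks $t_j$ of outdegree 0), and a nonnegative real weight on each edge. The weight of a path is the product of its edge weights; the path matrix $A=(a_{i,j})$ has $a_{i,j}$ equal to the sum of the weights of all paths from $s_i$ to $t_j$. For a multiset $K$ of edges, $\Pi_e(K)$ is the set of path families $\pi=(\pi_1,\dots,\pi_n)$, $\pi_i$ a path from $s_i$ to $t_i$, whose multiset union of edges is $K$; $K$ is a bijective skeleton if $\Pi_e(K)\ne\emptyset$; $\mathrm{wgt}(K)$ is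 the product of the weights of the edges of $K$ with multiplicity. For $\pi\in\Pi_e(K)$ let $P(\pi)$ be the poset on $\{\pi_1,\dots,\pi_n\}$ with $\pi_i<\pi_j$ iff $i<j$ and $\pi_i$ and $\pi_j$ do not intersect. An $F$-tableau is a $P(\pi)$-tableau for some $\pi\in\Pi_e(K)$ with $K$ a bijective skeleton (tableaux for different $\pi$ are distinct), and its weight is $\mathrm{wgt}(U)=\mathrm{wgt}(K)$. For a poset $P$, a $P$-tableau of shape $\lambda$ is a filling of the Young diagram of $\lambda$ with the elements of $P$, one per box; with $U_{i,j}$ the $j$-th entry of row $i$ (rows numbered from the bottom, row 1 longest), $U$ is standard if $U_{i,j}\not>_P U_{i,j+1}$ for all adjacent entries in a row and $U_{i,j}<_P U_{i+1,j}$ for all vertically adjacent entries. An $F$-tableau is standard if it is a standard $P(\pi)$-tableau. *)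

theory Defs
  imports
    "HOL-Analysis.Analysis"
    "HOL-Combinatorics.Permutations"
    "HOL-Library.FuncSet"
    "HOL-Library.Function_Algebras"
    "HOL-Library.Multiset"
    "Jordan_Normal_Form.Determinant"
    "Jordan_Normal_Form.DL_Submatrix"
    "Graph_Theory.Digraph"
    "Graph_Theory.Arc_Walk"
begin

text \<open>Rows, columns, letters, sources and sinks are all numbered from 0, so the symmetric
  group of degree \<open>n\<close> consists of the \<open>w\<close> with \<open>w permutes {..<n}\<close>.\<close>

section \<open>Immanants and total nonnegativity\<close>

definition immanant :: "nat \<Rightarrow> ((nat \<Rightarrow> nat) \<Rightarrow> real) \<Rightarrow> real mat \<Rightarrow> real" where
  "immanant n \<theta> A = (\<Sum>w | w permutes {..<n}. \<theta> w * (\<Prod>i<n. A $$ (i, w i)))"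

definition totally_nonnegative_mat :: "nat \<Rightarrow> real mat \<Rightarrow> bool" where
  "totally_nonnegative_mat n A \<longleftrightarrow> A \<in> carrier_mat n n \<and>
     (\<forall>I J. I \<subseteq> {..<n} \<and> J \<subseteq> {..<n} \<and> card I = card J \<longrightarrow>
        Determinant.det (submatrix A I J) \<ge> 0)"

text \<open>A real polynomial in the entries \<open>x\<^sub>i\<^sub>j\<close> is represented by its evaluation map.\<close>

definition totally_nonnegative_poly :: "nat \<Rightarrow> (real mat \<Rightarrow> real) \<Rightarrow> bool" where
  "totally_nonnegative_poly n p \<longleftrightarrow> (\<forall>A. totally_nonnegative_mat n A \<longrightarrow> p A \<ge> 0)"


section \<open>Young diagrams\<close>

text \<open>A partition is the weakly decreasing list of its parts. The box \<open>(i, j)\<close> is the box in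
  row \<open>i\<close> and column \<open>j\<close>; row 0 is the longest row.\<close>

definition young_diagram :: "nat list \<Rightarrow> (nat \<times> nat) set" where
  "young_diagram \<mu> = {(i, j). i < length \<mu> \<and> j < \<mu> ! i}"

definition hook :: "nat \<Rightarrow> nat \<Rightarrow> nat list" where
  "hook n k = k # replicate (n - k) 1"


section \<open>Irreducible characters of the symmetric group\<close>

text \<open>The irreducible representation indexed by \<open>\<mu>\<close> is the Specht module, in the convention
  where \<open>[n]\<close> gives the trivial and \<open>[1, \<dots>, 1]\<close> the sign representation. It is taken
  over the reals, which does not affect its character.\<close>

definition fun_scale :: "real \<Rightarrow> ('a \<Rightarrow> real) \<Rightarrow> 'a \<Rightarrow> real" where
  "fun_scale c f = (\<lambda>x. c * f x)"

global_interpretation fun_vs: vector_space "fun_scale :: real \<Rightarrow> ('a \<Rightarrow> real) \<Rightarrow> 'a \<Rightarrow> real"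
  by unfold_locales (auto simp: fun_scale_def fun_eq_iff algebra_simps)

text \<open>The trace of an operator \<open>T\<close> on a finite-dimensional \<open>T\<close>-invariant subspace \<open>W\<close>; it does
  not depend on the basis chosen.\<close>

definition trace_on :: "('a \<Rightarrow> real) set \<Rightarrow> (('a \<Rightarrow> real) \<Rightarrow> ('a \<Rightarrow> real)) \<Rightarrow> real" where
  "trace_on W T =
     (let B = (SOME B. B \<subseteq> W \<and> fun_vs.independent B \<and> fun_vs.span B = W)
      in \<Sum>b\<in>B. fun_vs.representation B (T b) b)"

definition bijective_tableaux :: "nat list \<Rightarrow> (nat \<times> nat \<Rightarrow> nat) set" where
  "bijective_tableaux \<mu> = {t. bij_betw t (young_diagram \<mu>) {..<sum_list \<mu>}}"

text \<open>The tabloid of \<open>t\<close> (its class under row permutations), given as the list of the sets of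
  entries of its rows.\<close>

definition tabloid :: "nat list \<Rightarrow> (nat \<times> nat \<Rightarrow> nat) \<Rightarrow> nat set list" where
  "tabloid \<mu> t = map (\<lambda>i. (\<lambda>j. t (i, j)) ` {..<\<mu> ! i}) [0..<length \<mu>]"

definition column_stabilizer :: "nat list \<Rightarrow> (nat \<times> nat \<Rightarrow> nat) \<Rightarrow> (nat \<Rightarrow> nat) set" where
  "column_stabilizer \<mu> t = {\<sigma>. \<sigma> permutes {..<sum_list \<mu>} \<and>
     (\<forall>(i, j) \<in> young_diagram \<mu>. \<exists>i'. (i', j) \<in> young_diagram \<mu> \<and> \<sigma> (t (i, j)) = t (i', j))}"

text \<open>The permutation module on tabloids is realized by real functions on tabloids, a tabloid
  being identified with its indicator function.\<close>

definition polytabloid :: "nat list \<Rightarrow> (nat \<times> nat \<Rightarrow> nat) \<Rightarrow> nat set list \<Rightarrow> real" where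
  "polytabloid \<mu> t = (\<lambda>T. \<Sum>\<sigma> \<in> column_stabilizer \<mu> t.
     real_of_int (sign \<sigma>) * of_bool (T = tabloid \<mu> (\<sigma> \<circ> t)))"

definition specht_module :: "nat list \<Rightarrow> (nat set list \<Rightarrow> real) set" where
  "specht_module \<mu> = fun_vs.span (polytabloid \<mu> ` bijective_tableaux \<mu>)"

text \<open>The action carrying the indicator function of \<open>T\<close> to that of \<open>map (image w) T\<close>.\<close>

definition perm_action ::
    "(nat \<Rightarrow> nat) \<Rightarrow> (nat set list \<Rightarrow> real) \<Rightarrow> nat set list \<Rightarrow> real" where
  "perm_action w f = (\<lambda>T. f (map (image (inv_into UNIV w)) T))"

definition irreducible_character :: "nat list \<Rightarrow> (nat \<Rightarrow> nat) \<Rightarrow> real" where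
  "irreducible_character \<mu> w = trace_on (specht_module \<mu>) (perm_action w)"


section \<open>Planar networks\<close>

text \<open>The disc is the closed unit disc; edges are drawn as injective curves meeting each other
  only in vertices and meeting the vertex set only in their endpoints.\<close>

definition disc_embedding ::
    "('v, 'e) pre_digraph \<Rightarrow> ('v \<Rightarrow> complex) \<Rightarrow> ('e \<Rightarrow> real \<Rightarrow> complex) \<Rightarrow> bool" where
  "disc_embedding G pos \<gamma> \<longleftrightarrow>
     inj_on pos (verts G) \<and> pos ` verts G \<subseteq> cball 0 1 \<and>
     (\<forall>e \<in> arcs G.
        arc (\<gamma> e) \<and> path_image (\<gamma> e) \<subseteq> cball 0 1 \<and>
        pathstart (\<gamma> e) = pos (tail G e) \<and> pathfinish (\<gamma> e) = pos (head G e) \<and>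
        path_image (\<gamma> e) \<inter> pos ` verts G = {pos (tail G e), pos (head G e)}) \<and>
     (\<forall>e \<in> arcs G. \<forall>f \<in> arcs G. e \<noteq> f \<longrightarrow>
        path_image (\<gamma> e) \<inter> path_image (\<gamma> f) \<subseteq> pos ` verts G)"

text \<open>The points \<open>ps\<close> lie on the unit circle and are met in this order in less than one
  clockwise turn, that is, at strictly decreasing angles.\<close>

definition clockwise_on_circle :: "complex list \<Rightarrow> bool" where
  "clockwise_on_circle ps \<longleftrightarrow> (\<exists>\<phi> :: nat \<Rightarrow> real.
     (\<forall>m < length ps. ps ! m = cis (\<phi> m)) \<and>
     (\<forall>l m. l < m \<and> m < length ps \<longrightarrow> \<phi> m < \<phi> l \<and> \<phi> l < \<phi> m + 2 * pi))"

record ('v, 'e) network =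
  graph :: "('v, 'e) pre_digraph"
  source :: "nat \<Rightarrow> 'v"
  sink :: "nat \<Rightarrow> 'v"
  weight :: "'e \<Rightarrow> real"

definition nonneg_planar_network :: "nat \<Rightarrow> ('v, 'e) network \<Rightarrow> bool" where
  "nonneg_planar_network n F \<longleftrightarrow>
     fin_digraph (graph F) \<and> (\<nexists>c. pre_digraph.cycle (graph F) c) \<and>
     (\<forall>i<n. source F i \<in> verts (graph F) \<and> in_degree (graph F) (source F i) = 0) \<and>
     (\<forall>i<n. sink F i \<in> verts (graph F) \<and> out_degree (graph F) (sink F i) = 0) \<and>
     (\<forall>e \<in> arcs (graph F). weight F e \<ge> 0) \<and>
     (\<exists>pos \<gamma>. disc_embedding (graph F) pos \<gamma> \<and>
        clockwise_on_circle
          (map pos (map (source F) [0..<n] @ map (sink F) (rev [0..<n]))))"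

definition network_paths :: "('v, 'e) network \<Rightarrow> nat \<Rightarrow> nat \<Rightarrow> 'e list set" where
  "network_paths F i j = {p. pre_digraph.apath (graph F) (source F i) p (sink F j)}"

definition path_matrix :: "nat \<Rightarrow> ('v, 'e) network \<Rightarrow> real mat" where
  "path_matrix n F = Matrix.mat n n
     (\<lambda>(i, j). \<Sum>p \<in> network_paths F i j. prod_list (map (weight F) p))"


section \<open>Path families and tableaux\<close>

definition path_families :: "nat \<Rightarrow> ('v, 'e) network \<Rightarrow> 'e multiset \<Rightarrow> 'e list list set" where
  "path_families n F K = {\<pi>. length \<pi> = n \<and> (\<forall>i<n. \<pi> ! i \<in> network_paths F i i) \<and>
     (\<Sum>i<n. mset (\<pi> ! i)) = K}"

definition bijective_skeleton :: "nat \<Rightarrow> ('v, 'e) network \<Rightarrow> 'e multiset \<Rightarrow> bool" where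
  "bijective_skeleton n F K \<longleftrightarrow> path_families n F K \<noteq> {}"

definition skeleton_weight :: "('v, 'e) network \<Rightarrow> 'e multiset \<Rightarrow> real" where
  "skeleton_weight F K = (\<Prod>e \<in># K. weight F e)"

text \<open>The strict order of the poset \<open>P(\<pi>)\<close>, whose elements are the paths in \<open>\<pi>\<close>.
  Two paths intersect if they share a vertex.\<close>

definition path_less :: "('v, 'e) network \<Rightarrow> 'e list list \<Rightarrow> 'e list \<Rightarrow> 'e list \<Rightarrow> bool" where
  "path_less F \<pi> p q \<longleftrightarrow> (\<exists>i j. i < j \<and> j < length \<pi> \<and> p = \<pi> ! i \<and> q = \<pi> ! j \<and>
     set (pre_digraph.awalk_verts (graph F) (source F i) p) \<inter>
     set (pre_digraph.awalk_verts (graph F) (source F j) q) = {})"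

text \<open>Fillings are extensional so that they are determined by their entries on the diagram.\<close>

definition poset_tableaux :: "'p set \<Rightarrow> nat list \<Rightarrow> (nat \<times> nat \<Rightarrow> 'p) set" where
  "poset_tableaux P \<mu> = {U. U \<in> extensional (young_diagram \<mu>) \<and> bij_betw U (young_diagram \<mu>) P}"

definition standard_tableau ::
    "('p \<Rightarrow> 'p \<Rightarrow> bool) \<Rightarrow> nat list \<Rightarrow> (nat \<times> nat \<Rightarrow> 'p) \<Rightarrow> bool" where
  "standard_tableau lt \<mu> U \<longleftrightarrow>
     (\<forall>i j. (i, j) \<in> young_diagram \<mu> \<and> (i, Suc j) \<in> young_diagram \<mu> \<longrightarrow>
        \<not> lt (U (i, Suc j)) (U (i, j))) \<and>
     (\<forall>i j. (i, j) \<in> young_diagram \<mu> \<and> (Suc i, j) \<in> young_diagram \<mu> \<longrightarrow>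
        lt (U (i, j)) (U (Suc i, j)))"

text \<open>A tableau of a network is recorded together with the skeleton \<open>K\<close> and the path family \<open>\<pi>\<close>
  that it comes from.\<close>

definition standard_F_tableaux ::
    "nat \<Rightarrow> ('v, 'e) network \<Rightarrow> nat list \<Rightarrow>
     ('e multiset \<times> 'e list list \<times> (nat \<times> nat \<Rightarrow> 'e list)) set" where
  "standard_F_tableaux n F \<mu> = {(K, \<pi>, U). bijective_skeleton n F K \<and>
     \<pi> \<in> path_families n F K \<and> U \<in> poset_tableaux (set \<pi>) \<mu> \<and>
     standard_tableau (path_less F \<pi>) \<mu> U}"

definition tableau_weight ::
    "('v, 'e) network \<Rightarrow> 'e multiset \<times> 'e list list \<times> (nat \<times> nat \<Rightarrow> 'e list) \<Rightarrow> real" where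
  "tableau_weight F = (\<lambda>(K, \<pi>, U). skeleton_weight F K)"

end

theory Submission
  imports Defs "HOL-Combinatorics.Multiset_Permutations"
begin

text \<open>
  The hook characters are the traces on the images of the boundary maps of a simplex; evaluating
  boundaries of simplices through the vertex \<open>0\<close> gives \<open>\<chi>\<close> as a sum of minors of a permutation matrix
  with one row replaced by ones. Comparing coefficients in \<open>det (1 + q P)\<close> then yields
  \<open>\<chi>\<^sub>m + \<chi>\<^sub>m\<^sub>-\<^sub>1 = e\<^sub>m\<close>, where \<open>\<chi>\<^sub>m\<close> belongs to the hook with \<open>m\<close> boxes below its first row and the immanant of
  \<open>e\<^sub>m\<close> is the sum over \<open>|I| = m\<close> of \<open>det A\<^sub>I\<close> times the permanent of the complementary block.

  A standard tableau of hook shape is a path family together with a word in its paths whose descents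
  are exactly at the first \<open>m\<close> positions. Dropping the condition at one position turns the sum over such
  tableaux into the same recursion: the descending initial segment is a chain, counted by \<open>det A\<^sub>I\<close> by
  the Lindstroem-Gessel-Viennot lemma, and the descent-free remainder is counted by a permanent.
  Planarity enters only through the fact that paths with crossing endpoints meet, which follows from
  the Fashoda meet theorem.

  For a totally nonnegative matrix, Neville elimination writes it as a product of nonnegative
  matrices whose nonzero entries do not cross, that is, as the path matrix of a layered network in
  which paths with crossing endpoints meet as well.
\<close>

section \<open>Determinants and permanents over finite index sets\<close>

text \<open>The two conclusions do not share their geometry: the network of a totally nonnegative
  matrix is never embedded in a disc. Both routes therefore end in the locale
  \<open>path_network\<close>, in which all work on words and tableaux is done. The trace on the
  Specht module refers to an unspecified basis. It is computed from a spanning family with dual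
  evaluation points: since the boundary of a boundary vanishes, a boundary is determined by its
  values at tuples avoiding the vertex 0, and at such tuples the boundaries of simplices through 0
  are signed indicators. Words are not matched with permutations to obtain the permanent. The
  weighted counts of descent-free words and the permanents satisfy the same alternating relation
  with the principal minors, and that relation determines either of them by recursion on the index
  set. In the elimination the obstacle is vanishing entries, which break arguments with quotients of
  minors. Ratios are therefore compared in cross-multiplied form, and zero rows and columns are
  split off by rectangular factors.\<close>

definition det_on :: "'a set \<Rightarrow> ('a \<Rightarrow> 'a \<Rightarrow> real) \<Rightarrow> real" where
  "det_on J f = (\<Sum>\<sigma> | \<sigma> permutes J. real_of_int (sign \<sigma>) * (\<Prod>i\<in>J. f i (\<sigma> i)))"

definition per_on :: "'a set \<Rightarrow> ('a \<Rightarrow> 'a \<Rightarrow> real) \<Rightarrow> real" where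
  "per_on J f = (\<Sum>\<sigma> | \<sigma> permutes J. \<Prod>i\<in>J. f i (\<sigma> i))"

lemma det_on_cong:
  assumes "\<And>i j. i \<in> J \<Longrightarrow> j \<in> J \<Longrightarrow> f i j = g i j"
  shows "det_on J f = det_on J g"
  unfolding det_on_def using assms
  by (intro sum.cong refl arg_cong2[where f=times] prod.cong) (auto simp: permutes_in_image)

lemma det_on_empty [simp]: "det_on {} f = 1"
  by (simp add: det_on_def)

lemma per_on_empty [simp]: "per_on {} f = 1"
  by (simp add: per_on_def)

lemma sum_involution_zero:
  fixes g :: "'a \<Rightarrow> real"
  assumes "\<And>x. x \<in> S \<Longrightarrow> h x \<in> S" "\<And>x. x \<in> S \<Longrightarrow> h (h x) = x" "\<And>x. x \<in> S \<Longrightarrow> g (h x) = - g x"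
  shows "sum g S = 0"
proof -
  have "sum g S = (\<Sum>x\<in>S. g (h x))"
    by (rule sum.reindex_bij_witness[of _ h h]) (use assms in auto)
  also have "\<dots> = - sum g S"
    using assms(3) by (simp add: sum_negf)
  finally show ?thesis by simp
qed

lemma prod_of_bool:
  assumes "finite S"
  shows "(\<Prod>i\<in>S. of_bool (P i)) = (of_bool (\<forall>i\<in>S. P i) :: real)"
  using assms by (induction S rule: finite_induct) auto

lemma det_on_reindex:
  assumes h: "bij_betw h I J" and fin: "finite I"
  shows "det_on J f = det_on I (\<lambda>i j. f (h i) (h j))"
proof -
  let ?k = "inv_into I h"
  have k: "bij_betw ?k J I" using h by (rule bij_betw_inv_into)
  have hk: "h (?k y) = y" if "y \<in> J" for y using h that by (rule bij_betw_inv_into_right)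
  have kh: "?k (h x) = x" if "x \<in> I" for x using h that by (rule bij_betw_inv_into_left)
  have injh: "inj_on h I" and imh: "h ` I = J" using h by (auto simp: bij_betw_def)
  have "det_on I (\<lambda>i j. f (h i) (h j)) =
      (\<Sum>\<sigma> | \<sigma> permutes J. real_of_int (sign \<sigma>) * (\<Prod>i\<in>J. f i (\<sigma> i)))"
    unfolding det_on_def
  proof (rule sum.reindex_bij_witness[of _ "map_permutation J ?k" "map_permutation I h"])
    fix \<sigma> assume s: "\<sigma> \<in> {\<sigma>. \<sigma> permutes I}"
    then have s': "\<sigma> permutes I" by simp
    show "map_permutation J ?k (map_permutation I h \<sigma>) = \<sigma>"
      using h s' kh by (rule map_permutation_compose_inv)
    show "map_permutation I h \<sigma> \<in> {\<sigma>. \<sigma> permutes J}"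
      using map_permutation_permutes[OF h s'] by simp
    have "sign (map_permutation I h \<sigma>) = sign \<sigma>"
      using sign_map_permutation[OF injh s'] fin by simp
    moreover have "(\<Prod>i\<in>J. f i (map_permutation I h \<sigma> i)) = (\<Prod>i\<in>I. f (h i) (h (\<sigma> i)))"
      unfolding prod.reindex_bij_betw[OF h, symmetric]
      using map_permutation_apply[OF injh] by (intro prod.cong) auto
    ultimately show "real_of_int (sign (map_permutation I h \<sigma>)) *
        (\<Prod>i\<in>J. f i (map_permutation I h \<sigma> i)) =
        real_of_int (sign \<sigma>) * (\<Prod>i\<in>I. f (h i) (h (\<sigma> i)))" by simp
  next
    fix \<sigma> assume "\<sigma> \<in> {\<sigma>. \<sigma> permutes J}"
    then have s': "\<sigma> permutes J" by simp
    show "map_permutation I h (map_permutation J ?k \<sigma>) = \<sigma>"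
      using k s' hk by (rule map_permutation_compose_inv)
    show "map_permutation J ?k \<sigma> \<in> {\<sigma>. \<sigma> permutes I}"
      using map_permutation_permutes[OF k s'] by simp
  qed
  then show ?thesis by (simp add: det_on_def)
qed

lemma det_on_transpose:
  assumes fin: "finite J"
  shows "det_on J (\<lambda>i j. f j i) = det_on J f"
  unfolding det_on_def
proof (rule sum.reindex_bij_witness[of _ "inv_into UNIV" "inv_into UNIV"])
  fix \<sigma> assume "\<sigma> \<in> {\<sigma>. \<sigma> permutes J}"
  then have s: "\<sigma> permutes J" by simp
  show "inv_into UNIV (inv_into UNIV \<sigma>) = \<sigma>" using s by (simp add: permutes_inv_inv)
  then show "inv_into UNIV (inv_into UNIV \<sigma>) = \<sigma>" .
  show "inv_into UNIV \<sigma> \<in> {\<sigma>. \<sigma> permutes J}" using s by (simp add: permutes_inv)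
  then show "inv_into UNIV \<sigma> \<in> {\<sigma>. \<sigma> permutes J}" .
  have "sign (inv_into UNIV \<sigma>) = sign \<sigma>"
    using s fin by (intro sign_inverse) (auto simp: permutation_permutes)
  moreover have "(\<Prod>i\<in>J. f i (inv_into UNIV \<sigma> i)) = (\<Prod>i\<in>J. f (\<sigma> i) i)"
    by (rule prod.reindex_bij_witness[of _ \<sigma> "inv_into UNIV \<sigma>"])
      (use s in \<open>auto simp: permutes_inverses permutes_in_image permutes_inv\<close>)
  ultimately show "real_of_int (sign (inv_into UNIV \<sigma>)) * (\<Prod>i\<in>J. f i (inv_into UNIV \<sigma> i)) =
      real_of_int (sign \<sigma>) * (\<Prod>i\<in>J. f (\<sigma> i) i)" by simp
qed

lemma det_on_permute_rows:
  assumes fin: "finite J" and r: "\<rho> permutes J"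
  shows "det_on J (\<lambda>i j. f (\<rho> i) j) = real_of_int (sign \<rho>) * det_on J f"
proof -
  have "det_on J f = (\<Sum>\<sigma> | \<sigma> permutes J. real_of_int (sign \<rho> * sign \<sigma>) * (\<Prod>i\<in>J. f (\<rho> i) (\<sigma> i)))"
    unfolding det_on_def
  proof (rule sum.reindex_bij_witness[of _ "\<lambda>\<sigma>. \<sigma> \<circ> inv_into UNIV \<rho>" "\<lambda>\<sigma>. \<sigma> \<circ> \<rho>"])
    fix \<sigma> assume "\<sigma> \<in> {\<sigma>. \<sigma> permutes J}"
    then have s: "\<sigma> permutes J" by simp
    show "\<sigma> \<circ> \<rho> \<circ> inv_into UNIV \<rho> = \<sigma>" using r by (simp add: comp_assoc permutes_inv_o)
    show "\<sigma> \<circ> inv_into UNIV \<rho> \<circ> \<rho> = \<sigma>" using r by (simp add: comp_assoc permutes_inv_o)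
    show "\<sigma> \<circ> \<rho> \<in> {\<sigma>. \<sigma> permutes J}" using s r by (simp add: permutes_compose)
    show "\<sigma> \<circ> inv_into UNIV \<rho> \<in> {\<sigma>. \<sigma> permutes J}" using s r by (simp add: permutes_compose permutes_inv)
    have "sign (\<sigma> \<circ> \<rho>) = sign \<sigma> * sign \<rho>"
      using s r fin by (intro sign_compose) (auto simp: permutation_permutes)
    moreover have "(\<Prod>i\<in>J. f (\<rho> i) ((\<sigma> \<circ> \<rho>) i)) = (\<Prod>i\<in>J. f i (\<sigma> i))"
      by (rule prod.reindex_bij_witness[of _ "inv_into UNIV \<rho>" \<rho>])
        (use r in \<open>auto simp: permutes_inverses permutes_in_image permutes_inv\<close>)
    ultimately show "real_of_int (sign \<rho> * sign (\<sigma> \<circ> \<rho>)) * (\<Prod>i\<in>J. f (\<rho> i) ((\<sigma> \<circ> \<rho>) i)) =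
        real_of_int (sign \<sigma>) * (\<Prod>i\<in>J. f i (\<sigma> i))"
      by (simp add: mult.left_commute flip: of_int_mult)
  qed
  then show ?thesis
    unfolding det_on_def by (simp add: sum_distrib_left mult.assoc[symmetric] flip: of_int_mult)
qed

lemma det_on_eq_rows:
  assumes fin: "finite J" and ab: "a \<in> J" "b \<in> J" "a \<noteq> b"
    and eq: "\<And>j. j \<in> J \<Longrightarrow> f a j = f b j"
  shows "det_on J f = 0"
proof -
  let ?t = "Transposition.transpose a b"
  have t: "?t permutes J" using ab by (intro Permutations.permutes_swap_id)
  have "det_on J f = det_on J (\<lambda>i j. f (?t i) j)"
    using eq ab by (intro det_on_cong) (auto simp: Transposition.transpose_def)
  also have "\<dots> = - det_on J f"
    using det_on_permute_rows[OF fin t, of f] ab by (simp add: sign_swap_id)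
  finally show ?thesis by simp
qed

lemma det_on_add_row:
  assumes fin: "finite J" and x: "x \<in> J"
  shows "det_on J (\<lambda>i j. if i = x then g j + c * h j else f i j) =
    det_on J (\<lambda>i j. if i = x then g j else f i j) + c * det_on J (\<lambda>i j. if i = x then h j else f i j)"
  unfolding det_on_def sum_distrib_left sum.distrib[symmetric]
proof (rule sum.cong[OF refl])
  fix \<sigma>
  have *: "(\<Prod>i\<in>J. if i = x then k (\<sigma> i) else f i (\<sigma> i)) = k (\<sigma> x) * (\<Prod>i\<in>J-{x}. f i (\<sigma> i))" for k
    using fin x by (subst prod.remove[OF fin x]) (auto intro!: prod.cong)
  show "real_of_int (sign \<sigma>) * (\<Prod>i\<in>J. if i = x then g (\<sigma> i) + c * h (\<sigma> i) else f i (\<sigma> i)) =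
      real_of_int (sign \<sigma>) * (\<Prod>i\<in>J. if i = x then g (\<sigma> i) else f i (\<sigma> i)) +
      c * (real_of_int (sign \<sigma>) * (\<Prod>i\<in>J. if i = x then h (\<sigma> i) else f i (\<sigma> i)))"
    unfolding *[of "\<lambda>j. g j + c * h j"] *[of g] *[of h] by (simp add: algebra_simps)
qed

lemma det_on_zero_row:
  assumes "finite J" "x \<in> J" "\<And>j. j \<in> J \<Longrightarrow> f x j = 0"
  shows "det_on J f = 0"
  unfolding det_on_def
  using assms by (intro sum.neutral) (auto intro!: bexI[of _ x] simp: permutes_in_image)

lemma det_on_zero_col:
  assumes "finite J" "x \<in> J" "\<And>i. i \<in> J \<Longrightarrow> f i x = 0"
  shows "det_on J f = 0"
  using det_on_zero_row[of J x "\<lambda>i j. f j i"] assms det_on_transpose[of J f] by simp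

lemma det_on_scale_row:
  assumes "finite J" "x \<in> J"
  shows "det_on J (\<lambda>i j. if i = x then c * h j else f i j) =
    c * det_on J (\<lambda>i j. if i = x then h j else f i j)"
  using det_on_add_row[OF assms, of "\<lambda>_. 0" c h f]
    det_on_zero_row[OF assms, of "\<lambda>i j. if i = x then 0 else f i j"] by (simp cong: if_cong)

lemma det_on_sum_row:
  assumes fin: "finite J" and x: "x \<in> J" and R: "finite R"
  shows "det_on J (\<lambda>i j. if i = x then \<Sum>r\<in>R. g r j else f i j) =
    (\<Sum>r\<in>R. det_on J (\<lambda>i j. if i = x then g r j else f i j))"
  using R
proof (induction R rule: finite_induct)
  case empty
  show ?case using det_on_zero_row[OF fin x, of "\<lambda>i j. if i = x then 0 else f i j"] by (simp cong: if_cong)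
next
  case (insert r R)
  then show ?case
    using det_on_add_row[OF fin x, of "\<lambda>j. g r j" 1 "\<lambda>j. \<Sum>r\<in>R. g r j" f] by (simp cong: if_cong)
qed

text \<open>Adding another row to row \<open>x\<close> contributes a determinant with two equal
  rows, so only the summand \<open>r = x\<close> survives.\<close>

lemma det_on_row_total:
  assumes fin: "finite J" and x: "x \<in> J"
  shows "det_on J (\<lambda>i j. if i = x then \<Sum>r\<in>J. f r j else f i j) = det_on J f"
proof -
  have "det_on J (\<lambda>i j. if i = x then f r j else f i j) = 0" if "r \<in> J - {x}" for r
    using that x fin by (intro det_on_eq_rows[of J r x]) auto
  moreover have "det_on J (\<lambda>i j. if i = x then f x j else f i j) = det_on J f"
    by (rule det_on_cong) auto
  ultimately show ?thesis
    by (subst det_on_sum_row[OF fin x fin]) (simp add: sum.remove[OF fin x])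
qed

lemma permutes_fix_Diff:
  assumes "S \<subseteq> J"
  shows "\<sigma> permutes J \<and> (\<forall>i\<in>J - S. \<sigma> i = i) \<longleftrightarrow> \<sigma> permutes S"
  using assms permutes_superset[of \<sigma> J S] permutes_subset[of \<sigma> S J]
  by (auto simp: permutes_not_in)

text \<open>\<open>S\<close> is the set of rows in which the summand \<open>f\<close> is chosen when
  the product is expanded. In all other rows the diagonal summand forces a fixed point, so the
  permutations that remain are those of \<open>S\<close>.\<close>

lemma det_on_add_diag:
  assumes fin: "finite J"
  shows "det_on J (\<lambda>i j. f i j + of_bool (i = j) * d i) = (\<Sum>S\<in>Pow J. det_on S f * (\<Prod>i\<in>J-S. d i))"
proof -
  have "det_on J (\<lambda>i j. f i j + of_bool (i = j) * d i) =
      (\<Sum>\<sigma> | \<sigma> permutes J. \<Sum>S\<in>Pow J. real_of_int (sign \<sigma>) *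
        ((\<Prod>i\<in>S. f i (\<sigma> i)) * (\<Prod>i\<in>J-S. of_bool (i = \<sigma> i) * d i)))"
    unfolding det_on_def using fin by (simp add: prod_add sum_distrib_left)
  also have "\<dots> = (\<Sum>S\<in>Pow J. \<Sum>\<sigma> | \<sigma> permutes J. real_of_int (sign \<sigma>) *
        ((\<Prod>i\<in>S. f i (\<sigma> i)) * (\<Prod>i\<in>J-S. of_bool (i = \<sigma> i) * d i)))"
    by (rule sum.swap)
  also have "\<dots> = (\<Sum>S\<in>Pow J. det_on S f * (\<Prod>i\<in>J-S. d i))"
  proof (rule sum.cong[OF refl])
    fix S assume "S \<in> Pow J"
    then have S: "S \<subseteq> J" by simp
    have "(\<Sum>\<sigma> | \<sigma> permutes J. real_of_int (sign \<sigma>) *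
        ((\<Prod>i\<in>S. f i (\<sigma> i)) * (\<Prod>i\<in>J-S. of_bool (i = \<sigma> i) * d i))) =
        (\<Sum>\<sigma> | \<sigma> permutes S. real_of_int (sign \<sigma>) * (\<Prod>i\<in>S. f i (\<sigma> i)) * (\<Prod>i\<in>J-S. d i))"
    proof (rule sum.mono_neutral_cong_right)
      show "finite {\<sigma>. \<sigma> permutes J}" using fin by (rule finite_permutations)
      show "{\<sigma>. \<sigma> permutes S} \<subseteq> {\<sigma>. \<sigma> permutes J}" using S permutes_subset by blast
      show "\<forall>\<sigma>\<in>{\<sigma>. \<sigma> permutes J} - {\<sigma>. \<sigma> permutes S}. real_of_int (sign \<sigma>) *
        ((\<Prod>i\<in>S. f i (\<sigma> i)) * (\<Prod>i\<in>J-S. of_bool (i = \<sigma> i) * d i)) = 0"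
      proof
        fix \<sigma> assume "\<sigma> \<in> {\<sigma>. \<sigma> permutes J} - {\<sigma>. \<sigma> permutes S}"
        then obtain i where "i \<in> J - S" "\<sigma> i \<noteq> i"
          using permutes_fix_Diff[OF S, of \<sigma>] by auto
        then have "(\<Prod>i\<in>J-S. of_bool (i = \<sigma> i) * d i) = 0"
          using fin by (intro prod_zero) (auto intro!: bexI[of _ i])
        then show "real_of_int (sign \<sigma>) *
          ((\<Prod>i\<in>S. f i (\<sigma> i)) * (\<Prod>i\<in>J-S. of_bool (i = \<sigma> i) * d i)) = 0" by simp
      qed
      fix \<sigma> assume "\<sigma> \<in> {\<sigma>. \<sigma> permutes S}"
      then have "(\<Prod>i\<in>J-S. of_bool (i = \<sigma> i) * d i) = (\<Prod>i\<in>J-S. d i)"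
        by (intro prod.cong) (auto simp: permutes_not_in)
      then show "real_of_int (sign \<sigma>) *
          ((\<Prod>i\<in>S. f i (\<sigma> i)) * (\<Prod>i\<in>J-S. of_bool (i = \<sigma> i) * d i)) =
          real_of_int (sign \<sigma>) * (\<Prod>i\<in>S. f i (\<sigma> i)) * (\<Prod>i\<in>J-S. d i)" by simp
    qed
    then show "(\<Sum>\<sigma> | \<sigma> permutes J. real_of_int (sign \<sigma>) *
        ((\<Prod>i\<in>S. f i (\<sigma> i)) * (\<Prod>i\<in>J-S. of_bool (i = \<sigma> i) * d i))) =
        det_on S f * (\<Prod>i\<in>J-S. d i)"
      by (simp add: det_on_def sum_distrib_right)
  qed
  finally show ?thesis .
qed

text \<open>A permutation moving \<open>x\<close> takes the column \<open>x\<close> in some row of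
  \<open>J\<close>, where the entry is 0.\<close>

lemma det_on_insert_zero_col:
  assumes fin: "finite J" and x: "x \<notin> J" and z: "\<And>i. i \<in> J \<Longrightarrow> f i x = 0"
  shows "det_on (insert x J) f = f x x * det_on J f"
proof -
  have "det_on (insert x J) f = (\<Sum>\<sigma> | \<sigma> permutes J. real_of_int (sign \<sigma>) * (\<Prod>i\<in>insert x J. f i (\<sigma> i)))"
    unfolding det_on_def
  proof (rule sum.mono_neutral_right)
    show "finite {\<sigma>. \<sigma> permutes insert x J}" using fin by (intro finite_permutations) simp
    show "{\<sigma>. \<sigma> permutes J} \<subseteq> {\<sigma>. \<sigma> permutes insert x J}"
      using permutes_subset by blast
    show "\<forall>\<sigma>\<in>{\<sigma>. \<sigma> permutes insert x J} - {\<sigma>. \<sigma> permutes J}.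
        real_of_int (sign \<sigma>) * (\<Prod>i\<in>insert x J. f i (\<sigma> i)) = 0"
    proof
      fix \<sigma> assume s: "\<sigma> \<in> {\<sigma>. \<sigma> permutes insert x J} - {\<sigma>. \<sigma> permutes J}"
      then have "\<sigma> x \<noteq> x"
        using permutes_fix_Diff[of J "insert x J" \<sigma>] by auto
      moreover have p: "\<sigma> permutes insert x J" using s by simp
      obtain y where y: "\<sigma> y = x" using p by (metis permutes_def)
      ultimately have "y \<in> J" using p by (metis insertE insertI1 permutes_not_in)
      then have "(\<Prod>i\<in>insert x J. f i (\<sigma> i)) = 0"
        using z y fin by (intro prod_zero) auto
      then show "real_of_int (sign \<sigma>) * (\<Prod>i\<in>insert x J. f i (\<sigma> i)) = 0" by simp
    qed
  qed
  also have "\<dots> = f x x * det_on J f"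
    unfolding det_on_def sum_distrib_left using fin x
    by (intro sum.cong refl) (simp add: permutes_not_in)
  finally show ?thesis .
qed

text \<open>Column \<open>x\<close> is cleared one row at a time by subtracting multiples of row
  \<open>x\<close>; the induction runs over the set \<open>K\<close> of rows already cleared. The
  cleared column then allows the expansion above.\<close>

lemma det_on_schur:
  assumes fin: "finite J" and x: "x \<notin> J" and nz: "f x x \<noteq> 0"
  shows "det_on (insert x J) f = f x x * det_on J (\<lambda>i j. f i j - f i x * f x j / f x x)"
proof -
  let ?g = "\<lambda>K i j. if i \<in> K then f i j - f i x * f x j / f x x else f i j"
  have "det_on (insert x J) (?g K) = det_on (insert x J) f" if "K \<subseteq> J" for K
    using finite_subset[OF that fin] that
  proof (induction K rule: finite_induct)
    case (insert y K)
    have y: "y \<in> insert x J" "y \<noteq> x" and xK: "x \<notin> K" using insert x by auto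
    have "det_on (insert x J) (?g (insert y K)) = det_on (insert x J)
        (\<lambda>i j. if i = y then f y j + (- f y x / f x x) * f x j else ?g K i j)"
      by (rule det_on_cong) (use insert in auto)
    also have "\<dots> = det_on (insert x J) (\<lambda>i j. if i = y then f y j else ?g K i j) +
        (- f y x / f x x) * det_on (insert x J) (\<lambda>i j. if i = y then f x j else ?g K i j)"
      by (rule det_on_add_row) (use fin y in auto)
    also have "det_on (insert x J) (\<lambda>i j. if i = y then f x j else ?g K i j) = 0"
      by (rule det_on_eq_rows[of _ x y]) (use fin y xK in auto)
    also have "det_on (insert x J) (\<lambda>i j. if i = y then f y j else ?g K i j) = det_on (insert x J) (?g K)"
      by (rule det_on_cong) (use insert in auto)
    finally show ?case using insert by simp
  qed simp
  from this[of J] have "det_on (insert x J) f = det_on (insert x J) (?g J)" by simp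
  also have "\<dots> = f x x * det_on J (?g J)"
    using det_on_insert_zero_col[OF fin x, of "?g J"] x nz by simp
  also have "det_on J (?g J) = det_on J (\<lambda>i j. f i j - f i x * f x j / f x x)"
    by (rule det_on_cong) auto
  finally show ?thesis .
qed

lemma det_on_lessThan:
  "det_on {..<n} f = Determinant.det (Matrix.mat n n (\<lambda>(i, j). f i j))"
proof -
  have *: "{..<n} = {0..<n}" by auto
  show ?thesis
    unfolding det_on_def Determinant.det_def *
    by (auto intro!: sum.cong prod.cong simp: permutes_in_image sign_def atLeast0LessThan)
qed

section \<open>Principal minors of permutation matrices\<close>

lemma det_on_scale_rows:
  "det_on S (\<lambda>i j. c i * f i j) = (\<Prod>i\<in>S. c i) * det_on S f"
  unfolding det_on_def by (simp add: prod.distrib sum_distrib_left mult.left_commute)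

text \<open>With \<open>P\<close> the permutation matrix of \<open>w\<close>, adding all rows of \<open>1 + q P\<close> to row \<open>x\<close> makes that row
  constant, since the columns of \<open>P\<close> sum to 1. The left side is \<open>det (1 + q P)\<close>.\<close>

lemma det_on_perm_generating:
  assumes fin: "finite J" and w: "w permutes J" and x: "x \<in> J"
  shows "(\<Sum>S\<in>Pow J. q ^ card S * det_on S (\<lambda>a b. of_bool (a = w b))) =
    (1 + q) * (\<Sum>S | S \<subseteq> J \<and> x \<in> S. q ^ (card S - 1) *
      det_on S (\<lambda>a b. if a = x then 1 else of_bool (a = w b)))"
proof -
  let ?P = "\<lambda>a b. of_bool (a = w b) :: real"
  let ?M = "\<lambda>i j. q * ?P i j + of_bool (i = j) * 1"
  let ?N = "\<lambda>i j. if i = x then 1 else ?M i j"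
  let ?F = "\<lambda>i j. if i = x then 1 else q * ?P i j"
  have "(\<Sum>S\<in>Pow J. q ^ card S * det_on S ?P) = det_on J ?M"
    unfolding det_on_add_diag[OF fin, of "\<lambda>i j. q * ?P i j" "\<lambda>_. 1"]
    by (intro sum.cong refl) (subst det_on_scale_rows, simp)
  also have "\<dots> = det_on J (\<lambda>i j. if i = x then \<Sum>r\<in>J. ?M r j else ?M i j)"
    using det_on_row_total[OF fin x] by simp
  also have "\<dots> = det_on J (\<lambda>i j. if i = x then (1 + q) * 1 else ?M i j)"
  proof (rule det_on_cong)
    fix i j assume "j \<in> J"
    then have "w j \<in> J" using w by (simp add: permutes_in_image)
    moreover have "(\<Sum>r\<in>J. of_bool (r = y)) = (1::real)" if "y \<in> J" for y
      using that fin by (simp add: of_bool_def)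
    ultimately have "(\<Sum>r\<in>J. ?M r j) = 1 + q"
      using \<open>j \<in> J\<close> by (simp add: sum.distrib sum_distrib_left[symmetric] del: sum_of_bool_eq)
    then show "(if i = x then \<Sum>r\<in>J. ?M r j else ?M i j) = (if i = x then (1 + q) * 1 else ?M i j)"
      by simp
  qed
  also have "\<dots> = (1 + q) * det_on J ?N"
    by (rule det_on_scale_row[OF fin x])
  \<comment> \<open>Row \<open>x\<close> of \<open>?N\<close> is written without a diagonal part. In
    the expansion every \<open>S\<close> that misses \<open>x\<close> thus receives the factor 0,
    and only the sets through \<open>x\<close> remain.\<close>
  also have "det_on J ?N = det_on J (\<lambda>i j. ?F i j + of_bool (i = j) * of_bool (i \<noteq> x))"
    by (rule det_on_cong) auto
  also have "\<dots> = (\<Sum>S\<in>Pow J. det_on S ?F * (\<Prod>i\<in>J-S. of_bool (i \<noteq> x)))"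
    by (rule det_on_add_diag[OF fin])
  also have "\<dots> = (\<Sum>S | S \<subseteq> J \<and> x \<in> S. q ^ (card S - 1) * det_on S (\<lambda>a b. if a = x then 1 else ?P a b))"
  proof (rule sum.mono_neutral_cong_right)
    show "finite (Pow J)" using fin by simp
    show "{S. S \<subseteq> J \<and> x \<in> S} \<subseteq> Pow J" by auto
    show "\<forall>S\<in>Pow J - {S. S \<subseteq> J \<and> x \<in> S}. det_on S ?F * (\<Prod>i\<in>J-S. of_bool (i \<noteq> x)) = 0"
      using x fin by (auto intro!: bexI[of _ x])
    fix S assume "S \<in> {S. S \<subseteq> J \<and> x \<in> S}"
    then have S: "S \<subseteq> J" "x \<in> S" by auto
    then have finS: "finite S" using fin finite_subset by blast
    have "det_on S ?F = det_on S (\<lambda>i j. (if i = x then 1 else q) * (if i = x then 1 else ?P i j))"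
      by (rule det_on_cong) auto
    also have "\<dots> = (\<Prod>i\<in>S. if i = x then 1 else q) * det_on S (\<lambda>i j. if i = x then 1 else ?P i j)"
      by (rule det_on_scale_rows)
    also have "(\<Prod>i\<in>S. if i = x then 1 else q) = q ^ (card S - 1)"
    proof -
      have "(\<Prod>i\<in>S-{x}. if i = x then 1 else q) = (\<Prod>i\<in>S-{x}. q)" by (rule prod.cong) auto
      then show ?thesis using S finS by (subst prod.remove[of _ x]) (auto simp: card_Diff_singleton)
    qed
    finally have *: "det_on S ?F = q ^ (card S - 1) * det_on S (\<lambda>i j. if i = x then 1 else ?P i j)" .
    have "(\<Prod>i\<in>J-S. of_bool (i \<noteq> x)) = (1::real)"
      using S by (intro prod.neutral) auto
    with * show "det_on S ?F * (\<Prod>i\<in>J-S. of_bool (i \<noteq> x)) =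
      q ^ (card S - 1) * det_on S (\<lambda>a b. if a = x then 1 else ?P a b)" by simp
  qed
  finally show ?thesis .
qed

lemma sum_Pow_by_card:
  fixes g :: "'a set \<Rightarrow> real"
  assumes "finite J"
  shows "(\<Sum>S\<in>Pow J. h (card S) * g S) = (\<Sum>m\<le>card J. h m * (\<Sum>S | S \<subseteq> J \<and> card S = m. g S))"
proof -
  have "(\<Sum>S\<in>Pow J. h (card S) * g S) = (\<Sum>m\<le>card J. \<Sum>S\<in>{S\<in>Pow J. card S = m}. h (card S) * g S)"
    using assms by (intro sum.group[symmetric]) (auto simp: card_mono)
  also have "\<dots> = (\<Sum>m\<le>card J. h m * (\<Sum>S | S \<subseteq> J \<and> card S = m. g S))"
    by (simp add: sum_distrib_left Pow_def)
  finally show ?thesis .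
qed

text \<open>Coefficients of \<open>q ^ m\<close> in the identity above, whose factor
  \<open>1 + q\<close> produces the two terms of the recursion. The size \<open>Suc m\<close> in
  \<open>T\<close> comes from row \<open>x\<close>, which consists of ones and carries no factor
  \<open>q\<close>.\<close>

lemma det_on_perm_coeffs:
  assumes fin: "finite J" and w: "w permutes J" and x: "x \<in> J"
  defines "E \<equiv> \<lambda>m. \<Sum>S | S \<subseteq> J \<and> card S = m. det_on S (\<lambda>a b. of_bool (a = w b))"
    and "T \<equiv> \<lambda>m. \<Sum>S | S \<subseteq> J \<and> x \<in> S \<and> card S = Suc m.
      det_on S (\<lambda>a b. if a = x then 1 else of_bool (a = w b))"
  shows "T 0 = E 0" and "Suc m < card J \<Longrightarrow> T (Suc m) + T m = E (Suc m)"
proof -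
  let ?P = "\<lambda>a b. of_bool (a = w b) :: real"
  let ?D = "\<lambda>S. det_on S (\<lambda>a b. if a = x then 1 else ?P a b)"
  let ?n = "card J"
  have n: "?n > 0" using fin x by (auto simp: card_gt_0_iff)
  \<comment> \<open>Lets the sums over \<open>m < card J\<close> be extended to
    \<open>m \<le> card J\<close>, so that both polynomials have the same index range when
    coefficients are compared.\<close>
  have TN: "T ?n = 0"
  proof -
    have "{S. S \<subseteq> J \<and> x \<in> S \<and> card S = Suc ?n} = {}"
    proof -
      have "card S \<le> ?n" if "S \<subseteq> J" for S using card_mono[OF fin that] .
      then have "S \<subseteq> J \<Longrightarrow> card S \<noteq> Suc ?n" for S by (simp add: not_less_eq_eq less_Suc_eq_le le_imp_less_Suc nat_neq_iff)
      then show ?thesis by auto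
    qed
    then show ?thesis unfolding T_def by (simp only: sum.empty)
  qed
  have "(\<Sum>m\<le>?n. E m * q ^ m) = (\<Sum>m\<le>?n. (T m + (if m = 0 then 0 else T (m - 1))) * q ^ m)" for q :: real
  proof -
    have "(\<Sum>m\<le>?n. E m * q ^ m) = (\<Sum>S\<in>Pow J. q ^ card S * det_on S ?P)"
      unfolding sum_Pow_by_card[OF fin, of "\<lambda>m. q ^ m"] E_def by (simp add: mult.commute)
    also have "\<dots> = (1 + q) * (\<Sum>S | S \<subseteq> J \<and> x \<in> S. q ^ (card S - 1) * ?D S)"
      by (rule det_on_perm_generating[OF fin w x])
    also have "(\<Sum>S | S \<subseteq> J \<and> x \<in> S. q ^ (card S - 1) * ?D S) =
        (\<Sum>m<?n. \<Sum>S\<in>{S\<in>{S. S \<subseteq> J \<and> x \<in> S}. card S - 1 = m}. q ^ (card S - 1) * ?D S)"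
    proof (intro sum.group[symmetric])
      show "(\<lambda>S. card S - 1) ` {S. S \<subseteq> J \<and> x \<in> S} \<subseteq> {..<?n}"
      proof (rule image_subsetI)
        fix S assume "S \<in> {S. S \<subseteq> J \<and> x \<in> S}"
        then have "S \<subseteq> J" by simp
        then have "card S \<le> ?n" using fin card_mono by blast
        then show "card S - 1 \<in> {..<?n}" using n by simp
      qed
    qed (use fin in auto)
    also have "\<dots> = (\<Sum>m<?n. T m * q ^ m)"
    proof (rule sum.cong[OF refl])
      fix m
      have "{S\<in>{S. S \<subseteq> J \<and> x \<in> S}. card S - 1 = m} = {S. S \<subseteq> J \<and> x \<in> S \<and> card S = Suc m}"
      proof -
        have "card S - 1 = m \<longleftrightarrow> card S = Suc m" if "S \<subseteq> J" "x \<in> S" for S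
        proof -
          have "card S > 0" using that finite_subset[OF that(1) fin] by (auto simp: card_gt_0_iff)
          then show ?thesis by auto
        qed
        then show ?thesis by auto
      qed
      then show "(\<Sum>S\<in>{S\<in>{S. S \<subseteq> J \<and> x \<in> S}. card S - 1 = m}. q ^ (card S - 1) * ?D S) = T m * q ^ m"
        by (simp add: T_def sum_distrib_left mult.commute[of _ "q ^ m"])
    qed
    also have "(1 + q) * (\<Sum>m<?n. T m * q ^ m) = (\<Sum>m<?n. T m * q ^ m) + (\<Sum>m<?n. T m * q ^ Suc m)"
      by (simp add: algebra_simps sum_distrib_left sum.distrib)
    also have "(\<Sum>m<?n. T m * q ^ m) = (\<Sum>m\<le>?n. T m * q ^ m)"
      using TN by (simp add: lessThan_Suc_atMost[symmetric])
    also have "(\<Sum>m<?n. T m * q ^ Suc m) = (\<Sum>m\<le>?n. (if m = 0 then 0 else T (m - 1)) * q ^ m)"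
      using n by (subst sum.atMost_shift) simp
    finally show ?thesis by (simp add: sum.distrib algebra_simps)
  qed
  then have "\<forall>m\<le>?n. E m = T m + (if m = 0 then 0 else T (m - 1))"
    by (intro polyfun_eq_coeffs[THEN iffD1] allI)
  then show "T 0 = E 0" and "Suc m < ?n \<Longrightarrow> T (Suc m) + T m = E (Suc m)" by auto
qed

text \<open>The minor of the permutation matrix of \<open>w\<close> is nonzero only if
  \<open>w\<close> maps \<open>S\<close> onto itself. Such a \<open>w\<close> splits uniquely into a
  permutation of \<open>S\<close>, which carries the sign, and a permutation of
  \<open>J - S\<close>, which is summed without sign.\<close>

lemma sum_perms_det_on:
  assumes fin: "finite J" and S: "S \<subseteq> J"
  shows "(\<Sum>w | w permutes J. det_on S (\<lambda>a b. of_bool (a = w b)) * (\<Prod>i\<in>J. A i (w i))) =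
    det_on S A * per_on (J - S) A"
proof -
  have finS: "finite S" using fin S finite_subset by blast
  have D: "det_on S (\<lambda>a b. of_bool (a = w b)) =
      (\<Sum>\<sigma> | \<sigma> permutes S. real_of_int (sign \<sigma>) * of_bool (\<forall>i\<in>S. w i = \<sigma> i))" for w :: "'a \<Rightarrow> 'a"
  proof -
    have "det_on S (\<lambda>a b. of_bool (a = w b)) = det_on S (\<lambda>a b. of_bool (b = w a))"
      by (subst det_on_transpose[OF finS, symmetric]) simp
    also have "\<dots> = (\<Sum>\<sigma> | \<sigma> permutes S. real_of_int (sign \<sigma>) * of_bool (\<forall>i\<in>S. w i = \<sigma> i))"
      unfolding det_on_def
    proof (intro sum.cong refl arg_cong2[where f=times])
      fix \<sigma>
      show "(\<Prod>i\<in>S. of_bool (\<sigma> i = w i)) = (of_bool (\<forall>i\<in>S. w i = \<sigma> i) :: real)"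
        unfolding prod_of_bool[OF finS] by (simp only: eq_commute)
    qed
    finally show ?thesis .
  qed
  have inner: "(\<Sum>w | w permutes J \<and> (\<forall>i\<in>S. w i = \<sigma> i). \<Prod>i\<in>J. A i (w i)) =
      (\<Prod>i\<in>S. A i (\<sigma> i)) * per_on (J - S) A" if s: "\<sigma> permutes S" for \<sigma>
    unfolding per_on_def sum_distrib_left
  proof (rule sum.reindex_bij_witness[of _ "\<lambda>\<tau>. \<tau> \<circ> \<sigma>" "\<lambda>w. w \<circ> inv_into UNIV \<sigma>"])
    have sJ: "\<sigma> permutes J" using s S by (rule permutes_subset)
    have ss: "\<sigma> x \<in> S \<longleftrightarrow> x \<in> S" for x using s by (simp add: permutes_in_image)
    fix w assume "w \<in> {w. w permutes J \<and> (\<forall>i\<in>S. w i = \<sigma> i)}"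
    then have w: "w permutes J" "\<And>i. i \<in> S \<Longrightarrow> w i = \<sigma> i" by auto
    show "w \<circ> inv_into UNIV \<sigma> \<circ> \<sigma> = w" using s by (simp add: comp_assoc permutes_inv_o)
    have "w (inv_into UNIV \<sigma> i) = i" if "i \<in> S" for i
    proof -
      have "inv_into UNIV \<sigma> i \<in> S" using s that by (simp add: permutes_in_image permutes_inv)
      then show ?thesis using w(2) s by (simp add: permutes_inverses)
    qed
    moreover have "w \<circ> inv_into UNIV \<sigma> permutes J"
      using sJ w(1) by (simp add: permutes_compose permutes_inv)
    ultimately show "w \<circ> inv_into UNIV \<sigma> \<in> {\<tau>. \<tau> permutes J - S}"
      using permutes_fix_Diff[of "J - S" J "w \<circ> inv_into UNIV \<sigma>"] S by (auto simp: double_diff)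
    have "(\<Prod>i\<in>J. A i (w i)) = (\<Prod>i\<in>S. A i (w i)) * (\<Prod>i\<in>J-S. A i (w i))"
      using prod.subset_diff[OF S fin] by (simp add: mult.commute)
    also have "(\<Prod>i\<in>S. A i (w i)) = (\<Prod>i\<in>S. A i (\<sigma> i))" using w(2) by (intro prod.cong) auto
    also have "(\<Prod>i\<in>J-S. A i (w i)) = (\<Prod>i\<in>J-S. A i ((w \<circ> inv_into UNIV \<sigma>) i))"
      using permutes_not_in[OF permutes_inv[OF s]] by (intro prod.cong) auto
    finally show "(\<Prod>i\<in>S. A i (\<sigma> i)) * (\<Prod>i\<in>J-S. A i ((w \<circ> inv_into UNIV \<sigma>) i)) = (\<Prod>i\<in>J. A i (w i))" ..
  next
    have sJ: "\<sigma> permutes J" using s S by (rule permutes_subset)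
    fix \<tau> assume "\<tau> \<in> {\<tau>. \<tau> permutes J - S}"
    then have t: "\<tau> permutes J - S" by simp
    show "\<tau> \<circ> \<sigma> \<circ> inv_into UNIV \<sigma> = \<tau>" using s by (simp add: comp_assoc permutes_inv_o)
    have "\<tau> permutes J" using t by (rule permutes_subset) simp
    moreover have "\<tau> (\<sigma> i) = \<sigma> i" if "i \<in> S" for i
    proof -
      have "\<sigma> i \<in> S" using s that by (simp add: permutes_in_image)
      then show ?thesis using t by (intro permutes_not_in[OF t]) simp
    qed
    ultimately show "\<tau> \<circ> \<sigma> \<in> {w. w permutes J \<and> (\<forall>i\<in>S. w i = \<sigma> i)}"
      using sJ by (simp add: permutes_compose)
  qed
  have "(\<Sum>w | w permutes J. det_on S (\<lambda>a b. of_bool (a = w b)) * (\<Prod>i\<in>J. A i (w i))) =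
      (\<Sum>w | w permutes J. \<Sum>\<sigma> | \<sigma> permutes S.
        real_of_int (sign \<sigma>) * (of_bool (\<forall>i\<in>S. w i = \<sigma> i) * (\<Prod>i\<in>J. A i (w i))))"
    by (simp add: D sum_distrib_right mult.assoc)
  also have "\<dots> = (\<Sum>\<sigma> | \<sigma> permutes S. real_of_int (sign \<sigma>) *
      (\<Sum>w | w permutes J. of_bool (\<forall>i\<in>S. w i = \<sigma> i) * (\<Prod>i\<in>J. A i (w i))))"
    by (subst sum.swap) (simp add: sum_distrib_left)
  also have "\<dots> = (\<Sum>\<sigma> | \<sigma> permutes S. real_of_int (sign \<sigma>) *
      ((\<Prod>i\<in>S. A i (\<sigma> i)) * per_on (J - S) A))"
  proof (intro sum.cong refl arg_cong2[where f=times])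
    fix \<sigma> assume "\<sigma> \<in> {\<sigma>. \<sigma> permutes S}"
    then have s: "\<sigma> permutes S" by simp
    have "(\<Sum>w | w permutes J. of_bool (\<forall>i\<in>S. w i = \<sigma> i) * (\<Prod>i\<in>J. A i (w i))) =
        (\<Sum>w | w permutes J \<and> (\<forall>i\<in>S. w i = \<sigma> i). \<Prod>i\<in>J. A i (w i))"
      using finite_permutations[OF fin] by (intro sum.mono_neutral_cong_right) auto
    then show "(\<Sum>w | w permutes J. of_bool (\<forall>i\<in>S. w i = \<sigma> i) * (\<Prod>i\<in>J. A i (w i))) =
        (\<Prod>i\<in>S. A i (\<sigma> i)) * per_on (J - S) A"
      using inner[OF s] by simp
  qed
  also have "\<dots> = det_on S A * per_on (J - S) A"
    by (simp add: det_on_def sum_distrib_right mult.assoc)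
  finally show ?thesis .
qed

text \<open>Muir's identity: at \<open>q = -1\<close> the factor \<open>1 + q\<close> of the
  generating identity vanishes. The term \<open>S = {}\<close> is the permanent on \<open>J\<close>
  itself, so the identity determines permanents from principal minors recursively.\<close>

lemma alternating_det_per:
  assumes fin: "finite J" and ne: "J \<noteq> {}"
  shows "(\<Sum>S\<in>Pow J. (-1) ^ card S * (det_on S A * per_on (J - S) A)) = 0"
proof -
  obtain x where x: "x \<in> J" using ne by auto
  have "(\<Sum>S\<in>Pow J. (-1) ^ card S * (det_on S A * per_on (J - S) A)) =
      (\<Sum>S\<in>Pow J. \<Sum>w | w permutes J. (-1) ^ card S *
        (det_on S (\<lambda>a b. of_bool (a = w b)) * (\<Prod>i\<in>J. A i (w i))))"
    using sum_perms_det_on[OF fin] by (intro sum.cong) (auto simp: sum_distrib_left[symmetric])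
  also have "\<dots> = (\<Sum>w | w permutes J. (\<Sum>S\<in>Pow J. (-1) ^ card S *
        det_on S (\<lambda>a b. of_bool (a = w b))) * (\<Prod>i\<in>J. A i (w i)))"
    by (subst sum.swap) (simp add: sum_distrib_right mult.assoc)
  also have "\<dots> = 0"
    using det_on_perm_generating[OF fin _ x, of _ "-1"] by (intro sum.neutral) auto
  finally show ?thesis .
qed

section \<open>The hook characters\<close>

lemma sum_fun_apply: "(\<Sum>x\<in>X. f x) t = (\<Sum>x\<in>X. f x t)" for f :: "'b \<Rightarrow> 'a \<Rightarrow> real"
  by (induction X rule: infinite_finite_induct) auto

text \<open>Since \<open>f \<mapsto> (\<Sum>x\<in>X. f (p x) q\<^sub>x)\<close> is the identity on \<open>W\<close>, the trace can be read off from
  the values of \<open>T q\<^sub>x\<close> at \<open>p x\<close>, with no need to know a basis of \<open>W\<close>.\<close>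

lemma trace_on_eq:
  fixes W :: "('a \<Rightarrow> real) set" and T :: "('a \<Rightarrow> real) \<Rightarrow> ('a \<Rightarrow> real)"
  assumes X: "finite X" and q: "\<And>x. x \<in> X \<Longrightarrow> q x \<in> W"
    and repr: "\<And>f. f \<in> W \<Longrightarrow> f = (\<Sum>x\<in>X. fun_scale (f (p x)) (q x))"
    and W: "fun_vs.subspace W"
    and T: "\<And>f. f \<in> W \<Longrightarrow> T f \<in> W"
    and lin: "module_hom fun_scale fun_scale T"
  shows "trace_on W T = (\<Sum>x\<in>X. T (q x) (p x))"
proof -
  interpret T: module_hom fun_scale fun_scale T by (rule lin)
  define B where "B = (SOME B. B \<subseteq> W \<and> fun_vs.independent B \<and> fun_vs.span B = W)"
  have "\<exists>B. B \<subseteq> W \<and> fun_vs.independent B \<and> fun_vs.span B = W"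
  proof -
    obtain B where "B \<subseteq> W" "fun_vs.independent B" "W \<subseteq> fun_vs.span B"
      using fun_vs.maximal_independent_subset by blast
    moreover from this have "fun_vs.span B = W"
      using fun_vs.span_minimal[OF _ W] by blast
    ultimately show ?thesis by blast
  qed
  then have B: "B \<subseteq> W" "fun_vs.independent B" "fun_vs.span B = W"
    unfolding B_def by (metis (mono_tags, lifting) someI_ex)+
  have "W \<subseteq> fun_vs.span (q ` X)"
  proof
    fix f assume "f \<in> W"
    then show "f \<in> fun_vs.span (q ` X)"
      by (subst repr) (auto intro: fun_vs.span_sum fun_vs.span_scale fun_vs.span_base)
  qed
  then have finB: "finite B"
    using fun_vs.independent_span_bound[OF finite_imageI[OF X] B(2)] B(1) by blast
  let ?R = "fun_vs.representation B"
  have R_sum: "?R (\<Sum>x\<in>X. g x) b = (\<Sum>x\<in>X. ?R (g x) b)" if "\<And>x. x \<in> X \<Longrightarrow> g x \<in> W" for g b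
    using fun_vs.representation_sum[OF B(2), of X g] that B(3) by (simp add: sum_fun_apply)
  have R_scale: "?R (fun_scale c g) b = c * ?R g b" if "g \<in> W" for g b c
    using fun_vs.representation_scale[OF B(2), of g c] that B(3) by simp
  have "trace_on W T = (\<Sum>b\<in>B. ?R (T b) b)"
    by (simp add: trace_on_def B_def[symmetric] Let_def)
  also have "\<dots> = (\<Sum>b\<in>B. \<Sum>x\<in>X. b (p x) * ?R (T (q x)) b)"
  proof (rule sum.cong[OF refl])
    fix b assume "b \<in> B"
    then have b: "b \<in> W" using B(1) by auto
    have "T b = T (\<Sum>x\<in>X. fun_scale (b (p x)) (q x))"
      using repr[OF b] by (rule arg_cong)
    also have "\<dots> = (\<Sum>x\<in>X. fun_scale (b (p x)) (T (q x)))"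
      by (simp add: T.sum T.scale)
    finally have "?R (T b) b = ?R (\<Sum>x\<in>X. fun_scale (b (p x)) (T (q x))) b" by simp
    also have "\<dots> = (\<Sum>x\<in>X. ?R (fun_scale (b (p x)) (T (q x))) b)"
      by (rule R_sum) (auto intro: fun_vs.subspace_scale[OF W] T q)
    also have "\<dots> = (\<Sum>x\<in>X. b (p x) * ?R (T (q x)) b)"
      using T q by (intro sum.cong refl R_scale) auto
    finally show "?R (T b) b = (\<Sum>x\<in>X. b (p x) * ?R (T (q x)) b)" .
  qed
  also have "\<dots> = (\<Sum>x\<in>X. (\<Sum>b\<in>B. fun_scale (?R (T (q x)) b) b) (p x))"
    by (subst sum.swap) (simp add: sum_fun_apply fun_scale_def mult.commute)
  also have "\<dots> = (\<Sum>x\<in>X. T (q x) (p x))"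
  proof (rule sum.cong[OF refl])
    fix x assume "x \<in> X"
    then have "T (q x) \<in> fun_vs.span B" using T q B(3) by auto
    then show "(\<Sum>b\<in>B. fun_scale (?R (T (q x)) b) b) (p x) = T (q x) (p x)"
      using fun_vs.sum_representation_eq[OF B(2) _ finB order_refl] by simp
  qed
  finally show ?thesis .
qed

text \<open>The value of the polytabloid with first column \<open>c\<close> at the tabloid whose singleton rows are
  \<open>x 1, \<dots>, x m\<close>; it is the boundary of the oriented simplex \<open>c\<close>, evaluated at \<open>x\<close>.\<close>

definition boundary_det :: "nat \<Rightarrow> (nat \<Rightarrow> nat) \<Rightarrow> (nat \<Rightarrow> nat) \<Rightarrow> real" where
  "boundary_det m x c = det_on {..m} (\<lambda>j i. if j = 0 then 1 else of_bool (x j = c i))"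

lemma boundary_det_cong:
  assumes "\<And>j. 1 \<le> j \<Longrightarrow> j \<le> m \<Longrightarrow> x j = y j" "\<And>i. i \<le> m \<Longrightarrow> c i = d i"
  shows "boundary_det m x c = boundary_det m y d"
  unfolding boundary_det_def using assms by (intro det_on_cong) auto

lemma boundary_det_permute:
  assumes r: "\<rho> permutes {1..m}"
  shows "boundary_det m (x \<circ> \<rho>) c = real_of_int (sign \<rho>) * boundary_det m x c"
proof -
  have r': "\<rho> permutes {..m}" using r by (rule permutes_subset) auto
  have "\<rho> j = 0 \<longleftrightarrow> j = 0" for j
    using permutes_in_image[OF r, of j] permutes_not_in[OF r, of j] by (cases "j \<in> {1..m}") auto
  then have "boundary_det m (x \<circ> \<rho>) c =
      det_on {..m} (\<lambda>j i. (\<lambda>j i. if j = 0 then 1 else of_bool (x j = c i)) (\<rho> j) i)"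
    unfolding boundary_det_def by (intro det_on_cong) simp
  also have "\<dots> = real_of_int (sign \<rho>) * boundary_det m x c"
    unfolding boundary_det_def by (rule det_on_permute_rows[OF _ r']) simp
  finally show ?thesis .
qed

lemma boundary_det_not_inj:
  assumes "1 \<le> a" "a \<le> m" "1 \<le> b" "b \<le> m" "a \<noteq> b" "x a = x b"
  shows "boundary_det m x c = 0"
  unfolding boundary_det_def by (rule det_on_eq_rows[of _ a b]) (use assms in auto)

text \<open>Summed over all values of one vertex, row \<open>j\<close> becomes a second row of ones.
  In simplicial terms, the boundary of a boundary is zero.\<close>

lemma boundary_det_sum:
  assumes j: "1 \<le> j" "j \<le> m" and c: "\<And>i. i \<le> m \<Longrightarrow> c i < n"
  shows "(\<Sum>y<n. boundary_det m (x(j := y)) c) = 0"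
proof -
  let ?f = "\<lambda>j i. if j = 0 then 1 else of_bool (x j = c i)"
  have "(\<Sum>y<n. boundary_det m (x(j := y)) c) =
      (\<Sum>y<n. det_on {..m} (\<lambda>l i. if l = j then of_bool (y = c i) else ?f l i))"
    unfolding boundary_det_def using j by (intro sum.cong refl det_on_cong) auto
  also have "\<dots> = det_on {..m} (\<lambda>l i. if l = j then \<Sum>y<n. of_bool (y = c i) else ?f l i)"
    by (rule det_on_sum_row[symmetric]) (use j in auto)
  also have "\<dots> = det_on {..m} (\<lambda>l i. if l = j then 1 else ?f l i)"
    by (rule det_on_cong) (use c in \<open>auto simp: of_bool_def\<close>)
  also have "\<dots> = 0"
    by (rule det_on_eq_rows[of _ 0 j]) (use j in auto)
  finally show ?thesis .
qed

text \<open>The same relation solved for its term \<open>y = 0\<close>: values at tuples containing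
  the vertex 0 are determined by values at tuples with fewer zeros.\<close>

lemma boundary_det_sum':
  assumes j: "1 \<le> j" "j \<le> m" and c: "\<And>i. i \<le> m \<Longrightarrow> c i < n" and n: "0 < n" and z: "z j = 0"
  shows "boundary_det m z c = - (\<Sum>y\<in>{1..<n}. boundary_det m (z(j := y)) c)"
proof -
  have "(\<Sum>y<n. boundary_det m (z(j := y)) c) =
      boundary_det m (z(j := 0)) c + (\<Sum>y\<in>{1..<n}. boundary_det m (z(j := y)) c)"
    using n by (simp add: lessThan_atLeast0 sum.atLeast_Suc_lessThan)
  moreover have "z(j := 0) = z" using z by auto
  ultimately show ?thesis using boundary_det_sum[where c = c and n = n and x = z, OF j c] by simp
qed

text \<open>The vertices \<open>0, x 1, ..., x m\<close> of the cone with apex 0 over the simplex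
  \<open>x\<close>.\<close>

definition with_zero :: "(nat \<Rightarrow> nat) \<Rightarrow> nat \<Rightarrow> nat" where
  "with_zero x = x(0 := 0)"

text \<open>As \<open>z\<close> avoids 0, the column of the apex has its only nonzero entry in the
  row of ones and can be split off. What remains is a signed indicator of \<open>z\<close> being a
  rearrangement of \<open>x\<close>: on tuples avoiding 0, the boundaries of cones are dual to the
  evaluations up to order and sign.\<close>

lemma boundary_det_with_zero_pos:
  assumes z: "\<And>j. 1 \<le> j \<Longrightarrow> j \<le> m \<Longrightarrow> z j \<noteq> 0"
  shows "boundary_det m z (with_zero x) =
    (\<Sum>\<sigma> | \<sigma> permutes {1..m}. real_of_int (sign \<sigma>) * of_bool (\<forall>j\<in>{1..m}. z j = x (\<sigma> j)))"
proof -
  let ?f = "\<lambda>j i. if j = 0 then 1 else of_bool (z j = with_zero x i) :: real"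
  have "{..m} = insert 0 {1..m}" by auto
  then have "boundary_det m z (with_zero x) = det_on {1..m} ?f"
    unfolding boundary_det_def
    using det_on_insert_zero_col[of "{1..m}" 0 ?f] z by (auto simp: with_zero_def)
  also have "\<dots> = (\<Sum>\<sigma> | \<sigma> permutes {1..m}. real_of_int (sign \<sigma>) * of_bool (\<forall>j\<in>{1..m}. z j = x (\<sigma> j)))"
    unfolding det_on_def
  proof (intro sum.cong refl arg_cong2[where f=times])
    fix \<sigma> assume "\<sigma> \<in> {\<sigma>. \<sigma> permutes {1..m}}"
    then have s: "\<sigma> permutes {1..m}" by simp
    have "(\<Prod>j\<in>{1..m}. ?f j (\<sigma> j)) = (\<Prod>j\<in>{1..m}. of_bool (z j = x (\<sigma> j)))"
    proof (rule prod.cong[OF refl])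
      fix j assume j: "j \<in> {1..m}"
      then have "\<sigma> j \<in> {1..m}" using permutes_in_image[OF s] by blast
      then show "?f j (\<sigma> j) = of_bool (z j = x (\<sigma> j))" using j by (simp add: with_zero_def)
    qed
    also have "\<dots> = of_bool (\<forall>j\<in>{1..m}. z j = x (\<sigma> j))"
      by (rule prod_of_bool) simp
    finally show "(\<Prod>j\<in>{1..m}. ?f j (\<sigma> j)) = of_bool (\<forall>j\<in>{1..m}. z j = x (\<sigma> j))" .
  qed
  finally show ?thesis .
qed

text \<open>Ordered tuples instead of \<open>m\<close>-element sets, so that no ordering of a set
  has to be chosen. Every set is then counted \<open>fact m\<close> times, which is the origin of
  the factors \<open>fact m\<close> below.\<close>

definition pos_tuples :: "nat \<Rightarrow> nat \<Rightarrow> (nat \<Rightarrow> nat) set" where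
  "pos_tuples n m = {x \<in> {1..m} \<rightarrow>\<^sub>E {1..<n}. inj_on x {1..m}}"

lemma finite_pos_tuples: "finite (pos_tuples n m)"
  unfolding pos_tuples_def by (rule finite_subset[OF _ finite_PiE[of "{1..m}" "\<lambda>_. {1..<n}"]]) auto

text \<open>Every boundary is a combination of boundaries of cones with apex 0, its own values at
  zero-free tuples being the coefficients. The induction is on the number of zeros in
  \<open>z\<close>: without zeros this is the duality above, and a zero is removed by
  \<open>boundary_det_sum'\<close>, which both sides satisfy.\<close>

lemma boundary_det_decomp:
  assumes c: "\<And>i. i \<le> m \<Longrightarrow> c i < n" and n: "0 < n"
  shows "\<lbrakk>\<And>j. 1 \<le> j \<Longrightarrow> j \<le> m \<Longrightarrow> z j < n\<rbrakk> \<Longrightarrow>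
    (\<Sum>x\<in>pos_tuples n m. boundary_det m x c * boundary_det m z (with_zero x)) = fact m * boundary_det m z c"
proof (induction "card {j \<in> {1..m}. z j = 0}" arbitrary: z)
  case 0
  have z: "z j \<noteq> 0" if "1 \<le> j" "j \<le> m" for j
    using 0(1) that by auto
  let ?z = "restrict z {1..m}"
  have bz: "boundary_det m ?z c = boundary_det m z c"
    by (rule boundary_det_cong) auto
  show ?case
  proof (cases "inj_on z {1..m}")
    case False
    then obtain a b where ab: "1 \<le> a" "a \<le> m" "1 \<le> b" "b \<le> m" "a \<noteq> b" "z a = z b"
      by (auto simp: inj_on_def)
    show ?thesis using boundary_det_not_inj[OF ab] by simp
  next
    case True
    have "(\<Sum>x\<in>pos_tuples n m. boundary_det m x c * boundary_det m z (with_zero x)) =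
        (\<Sum>\<sigma> | \<sigma> permutes {1..m}. \<Sum>x\<in>pos_tuples n m. real_of_int (sign \<sigma>) *
          (boundary_det m x c * of_bool (\<forall>j\<in>{1..m}. z j = x (\<sigma> j))))"
      using z by (subst sum.swap) (simp add: boundary_det_with_zero_pos sum_distrib_left mult.left_commute)
    \<comment> \<open>For fixed \<open>\<sigma>\<close> exactly one tuple contributes, namely
      \<open>z\<close> rearranged by the inverse of \<open>\<sigma>\<close>. Its sign cancels
      \<open>sign \<sigma>\<close>, so each of the \<open>fact m\<close> permutations gives the same
      value.\<close>
    also have "\<dots> = (\<Sum>\<sigma> | \<sigma> permutes {1..m}. boundary_det m z c)"
    proof (rule sum.cong[OF refl])
      fix \<sigma> assume "\<sigma> \<in> {\<sigma>. \<sigma> permutes {1..m}}"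
      then have s: "\<sigma> permutes {1..m}" by simp
      then have si: "inv_into UNIV \<sigma> permutes {1..m}" by (rule permutes_inv)
      let ?x = "?z \<circ> inv_into UNIV \<sigma>"
      have x_in: "?x \<in> pos_tuples n m"
      proof -
        have "inj_on ?z (inv_into UNIV \<sigma> ` {1..m})"
          using True unfolding permutes_image[OF si] by (rule inj_on_cong[THEN iffD2, rotated]) simp
        then have "inj_on ?x {1..m}"
          by (rule comp_inj_on[OF permutes_inj_on[OF si]])
        moreover have "?x j \<in> {1..<n}" if "j \<in> {1..m}" for j
        proof -
          have "inv_into UNIV \<sigma> j \<in> {1..m}" using that permutes_in_image[OF si] by blast
          then show ?thesis using z[of "inv_into UNIV \<sigma> j"] 0(2)[of "inv_into UNIV \<sigma> j"]
            by (auto simp: Suc_le_eq)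
        qed
        moreover have "?x j = undefined" if "j \<notin> {1..m}" for j
          unfolding o_apply permutes_not_in[OF si that] restrict_def using that by (rule if_not_P)
        ultimately show ?thesis by (auto simp: pos_tuples_def PiE_def extensional_def)
      qed
      have uniq: "(\<forall>j\<in>{1..m}. z j = x (\<sigma> j)) \<longleftrightarrow> x = ?x" if "x \<in> pos_tuples n m" for x
      proof
        assume a: "\<forall>j\<in>{1..m}. z j = x (\<sigma> j)"
        show "x = ?x"
        proof (rule ext)
          fix j show "x j = ?x j"
          proof (cases "j \<in> {1..m}")
            case True
            then have i: "inv_into UNIV \<sigma> j \<in> {1..m}" using permutes_in_image[OF si] by blast
            then have "z (inv_into UNIV \<sigma> j) = x j" using a s by (simp add: permutes_inverses)
            then show ?thesis using i by simp
          next
            case False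
            then have "x j = undefined" using that by (auto simp: pos_tuples_def PiE_def extensional_def)
            moreover have "?x j = undefined"
              unfolding o_apply permutes_not_in[OF si False] restrict_def using False by (rule if_not_P)
            ultimately show ?thesis by simp
          qed
        qed
      next
        assume "x = ?x"
        then show "\<forall>j\<in>{1..m}. z j = x (\<sigma> j)"
          using s by (auto simp: permutes_inverses)
      qed
      have "(\<Sum>x\<in>pos_tuples n m. real_of_int (sign \<sigma>) *
          (boundary_det m x c * of_bool (\<forall>j\<in>{1..m}. z j = x (\<sigma> j)))) =
          (\<Sum>x\<in>pos_tuples n m. if x = ?x then real_of_int (sign \<sigma>) * boundary_det m x c else 0)"
        using uniq by (intro sum.cong) auto
      also have "\<dots> = real_of_int (sign \<sigma>) * boundary_det m ?x c"
        using x_in finite_pos_tuples by simp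
      also have "\<dots> = real_of_int (sign \<sigma> * sign (inv_into UNIV \<sigma>)) * boundary_det m z c"
        using boundary_det_permute[OF si, of ?z c] bz by simp
      also have "sign (inv_into UNIV \<sigma>) = sign \<sigma>"
        using s by (intro sign_inverse) (auto simp: permutation_permutes)
      finally show "(\<Sum>x\<in>pos_tuples n m. real_of_int (sign \<sigma>) *
          (boundary_det m x c * of_bool (\<forall>j\<in>{1..m}. z j = x (\<sigma> j)))) = boundary_det m z c" by simp
    qed
    also have "\<dots> = fact m * boundary_det m z c"
      using card_permutations[of "{1..m}" m] by simp
    finally show ?thesis .
  qed
next
  case (Suc k)
  have "{j \<in> {1..m}. z j = 0} \<noteq> {}" using Suc(2) by (metis card.empty Zero_not_Suc)
  then obtain j where j: "1 \<le> j" "j \<le> m" "z j = 0" by auto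
  let ?L = "\<lambda>z. \<Sum>x\<in>pos_tuples n m. boundary_det m x c * boundary_det m z (with_zero x)"
  have IH: "?L (z(j := y)) = fact m * boundary_det m (z(j := y)) c" if "y \<in> {1..<n}" for y
  proof (rule Suc(1))
    have "{i \<in> {1..m}. (z(j := y)) i = 0} = {i \<in> {1..m}. z i = 0} - {j}"
      using that by auto
    then show "k = card {i \<in> {1..m}. (z(j := y)) i = 0}"
      using Suc(2) j by (simp add: card_Diff_singleton)
    show "(z(j := y)) i < n" if "1 \<le> i" "i \<le> m" for i
      using Suc(3)[OF that] \<open>y \<in> {1..<n}\<close> by auto
  qed
  have wz: "with_zero x i < n" if "x \<in> pos_tuples n m" "i \<le> m" for x i
    using that n by (auto simp: with_zero_def pos_tuples_def PiE_def Pi_def)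
  have "?L z = (\<Sum>x\<in>pos_tuples n m. boundary_det m x c *
      - (\<Sum>y\<in>{1..<n}. boundary_det m (z(j := y)) (with_zero x)))"
    by (intro sum.cong refl arg_cong2[where f=times] boundary_det_sum') (use j n wz in auto)
  also have "\<dots> = - (\<Sum>y\<in>{1..<n}. ?L (z(j := y)))"
    by (subst sum.swap) (simp add: sum_negf sum_distrib_left)
  also have "\<dots> = fact m * - (\<Sum>y\<in>{1..<n}. boundary_det m (z(j := y)) c)"
    using IH by (simp add: sum_distrib_left)
  also have "- (\<Sum>y\<in>{1..<n}. boundary_det m (z(j := y)) c) = boundary_det m z c"
    by (rule boundary_det_sum'[symmetric]) (use j c n in auto)
  finally show ?case .
qed

section \<open>Specht modules of hook shape\<close>

definition hook_tabloid :: "nat \<Rightarrow> nat \<Rightarrow> (nat \<Rightarrow> nat) \<Rightarrow> nat set list" where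
  "hook_tabloid n m x = ({..<n} - x ` {1..m}) # map (\<lambda>j. {x j}) [1..<Suc m]"

lemma hook_tabloid_eq_iff:
  "hook_tabloid n m x = hook_tabloid n m y \<longleftrightarrow> (\<forall>j\<in>{1..m}. x j = y j)"
proof
  assume "hook_tabloid n m x = hook_tabloid n m y"
  then have "map (\<lambda>j. {x j}) [1..<Suc m] = map (\<lambda>j. {y j}) [1..<Suc m]"
    by (simp add: hook_tabloid_def)
  then show "\<forall>j\<in>{1..m}. x j = y j" by (auto simp del: upt_Suc)
next
  assume a: "\<forall>j\<in>{1..m}. x j = y j"
  then have "x ` {1..m} = y ` {1..m}" by (intro image_cong) auto
  with a show "hook_tabloid n m x = hook_tabloid n m y"
    by (auto simp: hook_tabloid_def simp del: upt_Suc)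
qed

lemma map_image_hook_tabloid:
  assumes w: "w permutes {..<n}"
  shows "map (image w) (hook_tabloid n m x) = hook_tabloid n m (w \<circ> x)"
  using permutes_image[OF w] permutes_inj[OF w]
  by (auto simp: hook_tabloid_def image_set_diff image_comp simp del: upt_Suc)

locale hook_shape =
  fixes n k m :: nat
  assumes k: "1 \<le> k" and m: "n = k + m"
begin

abbreviation \<mu> where "\<mu> \<equiv> hook n k"

lemma n_pos: "0 < n" using k m by simp

lemma length_hook: "length \<mu> = Suc m" by (simp add: hook_def m)

lemma hook_nth: "i \<le> m \<Longrightarrow> \<mu> ! i = (if i = 0 then k else 1)"
  by (cases i) (auto simp: hook_def m)

lemma sum_list_hook: "sum_list \<mu> = n"
  by (simp add: hook_def m sum_list_replicate)

lemma in_diagram_hook: "(i, j) \<in> young_diagram \<mu> \<longleftrightarrow> (i = 0 \<and> j < k) \<or> (i \<le> m \<and> j = 0)"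
  using k by (auto simp: young_diagram_def length_hook hook_nth split: if_splits)

lemma tableau_bij: "t \<in> bijective_tableaux \<mu> \<longleftrightarrow> bij_betw t (young_diagram \<mu>) {..<n}"
  by (simp add: bijective_tableaux_def sum_list_hook)

lemma tableau_column:
  assumes "t \<in> bijective_tableaux \<mu>"
  shows "i \<le> m \<Longrightarrow> t (i, 0) < n" and "inj_on (\<lambda>i. t (i, 0)) {..m}"
proof -
  have inj: "inj_on t (young_diagram \<mu>)" and im: "t ` young_diagram \<mu> = {..<n}"
    using assms unfolding tableau_bij bij_betw_def by auto
  show "i \<le> m \<Longrightarrow> t (i, 0) < n"
    using im by (auto simp: in_diagram_hook)
  show "inj_on (\<lambda>i. t (i, 0)) {..m}"
    using inj_onD[OF inj, of "(_, 0)" "(_, 0)"] by (intro inj_onI) (auto simp: in_diagram_hook)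
qed

lemma tabloid_hook:
  assumes t: "t \<in> bijective_tableaux \<mu>"
  shows "tabloid \<mu> t = hook_tabloid n m (\<lambda>i. t (i, 0))"
proof (rule nth_equalityI)
  show "length (tabloid \<mu> t) = length (hook_tabloid n m (\<lambda>i. t (i, 0)))"
    by (simp add: tabloid_def hook_tabloid_def length_hook)
  fix i assume "i < length (tabloid \<mu> t)"
  then have i: "i \<le> m" by (simp add: tabloid_def length_hook)
  have "(\<lambda>j. t (0, j)) ` {..<k} = {..<n} - (\<lambda>i. t (i, 0)) ` {1..m}"
  proof -
    have D: "young_diagram \<mu> = Pair 0 ` {..<k} \<union> (\<lambda>i. (i, 0)) ` {1..m}"
      using k by (force simp: in_diagram_hook image_iff)
    have "t ` Pair 0 ` {..<k} = t ` (young_diagram \<mu> - (\<lambda>i. (i, 0)) ` {1..m})"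
      unfolding D by (rule arg_cong[where f="image t"]) auto
    also have "\<dots> = t ` young_diagram \<mu> - t ` (\<lambda>i. (i, 0)) ` {1..m}"
      using t D unfolding tableau_bij bij_betw_def by (intro inj_on_image_set_diff) auto
    finally show ?thesis
      using t unfolding tableau_bij bij_betw_def by (simp add: image_image)
  qed
  then show "tabloid \<mu> t ! i = hook_tabloid n m (\<lambda>i. t (i, 0)) ! i"
    using i k by (cases i) (auto simp: tabloid_def length_hook hook_nth hook_tabloid_def nth_append
        simp del: upt_Suc)
qed

text \<open>Every column other than the first has a single box, so the column stabilizer is the full
  symmetric group on the entries of the first column.\<close>

lemma column_stabilizer_hook:
  assumes t: "t \<in> bijective_tableaux \<mu>"
  shows "column_stabilizer \<mu> t = {\<sigma>. \<sigma> permutes (\<lambda>i. t (i, 0)) ` {..m}}"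
proof (intro Set.equalityI subsetI)
  let ?C = "(\<lambda>i. t (i, 0)) ` {..m}"
  have C: "?C \<subseteq> {..<n}" using tableau_column(1)[OF t] by auto
  fix \<sigma> assume "\<sigma> \<in> column_stabilizer \<mu> t"
  then have s: "\<sigma> permutes {..<n}"
    and col: "\<And>i j. (i, j) \<in> young_diagram \<mu> \<Longrightarrow> \<exists>i'. (i', j) \<in> young_diagram \<mu> \<and> \<sigma> (t (i, j)) = t (i', j)"
    by (auto simp: column_stabilizer_def sum_list_hook)
  have "\<sigma> y = y" if y: "y \<in> {..<n} - ?C" for y
  proof -
    have "y \<in> t ` young_diagram \<mu>" using t y unfolding tableau_bij bij_betw_def by auto
    then obtain i j where ij: "(i, j) \<in> young_diagram \<mu>" "y = t (i, j)" by auto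
    then have "j \<noteq> 0" using y by (auto simp: in_diagram_hook)
    then show ?thesis using col[OF ij(1)] ij by (auto simp: in_diagram_hook)
  qed
  then show "\<sigma> \<in> {\<sigma>. \<sigma> permutes ?C}" using permutes_fix_Diff[OF C, of \<sigma>] s by auto
next
  let ?C = "(\<lambda>i. t (i, 0)) ` {..m}"
  fix \<sigma> assume "\<sigma> \<in> {\<sigma>. \<sigma> permutes ?C}"
  then have s: "\<sigma> permutes ?C" by simp
  have "\<sigma> permutes {..<n}" by (rule permutes_subset[OF s]) (use tableau_column(1)[OF t] in auto)
  moreover have "\<exists>i'. (i', j) \<in> young_diagram \<mu> \<and> \<sigma> (t (i, j)) = t (i', j)"
    if ij: "(i, j) \<in> young_diagram \<mu>" for i j
  proof (cases "j = 0")
    case True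
    then have "t (i, j) \<in> ?C" using ij k by (auto simp: in_diagram_hook)
    then have "\<sigma> (t (i, j)) \<in> ?C" using permutes_in_image[OF s] by blast
    then show ?thesis using True by (auto simp: in_diagram_hook)
  next
    case False
    have "t (i, j) \<notin> ?C"
    proof
      assume "t (i, j) \<in> ?C"
      then obtain i' where i': "i' \<le> m" "t (i, j) = t (i', 0)" by auto
      then have "(i, j) = (i', 0)"
        using t ij unfolding tableau_bij bij_betw_def
        by (intro inj_onD[of t "young_diagram \<mu>"]) (auto simp: in_diagram_hook)
      then show False using False by simp
    qed
    then have "\<sigma> (t (i, j)) = t (i, j)" using permutes_not_in[OF s] by blast
    then show ?thesis using ij by blast
  qed
  ultimately show "\<sigma> \<in> column_stabilizer \<mu> t"
    by (auto simp: column_stabilizer_def sum_list_hook)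
qed

lemma comp_tableau:
  assumes t: "t \<in> bijective_tableaux \<mu>" and s: "\<sigma> permutes {..<n}"
  shows "\<sigma> \<circ> t \<in> bijective_tableaux \<mu>"
  using t bij_betw_trans[OF _ permutes_imp_bij[OF s]] unfolding tableau_bij by blast

definition is_tab :: "nat set list \<Rightarrow> bool" where
  "is_tab T \<longleftrightarrow> (\<exists>z. (\<forall>j. 1 \<le> j \<and> j \<le> m \<longrightarrow> z j < n) \<and> T = hook_tabloid n m z)"

lemma is_tabE:
  assumes "is_tab T"
  obtains z where "\<forall>j. 1 \<le> j \<and> j \<le> m \<longrightarrow> z j < n" and "T = hook_tabloid n m z"
  using assms unfolding is_tab_def by (elim exE conjE) (rule that)

lemma is_tabI: "(\<And>j. 1 \<le> j \<Longrightarrow> j \<le> m \<Longrightarrow> z j < n) \<Longrightarrow> is_tab (hook_tabloid n m z)"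
  unfolding is_tab_def by (intro exI[of _ z]) simp

lemma polytabloid_not_tab:
  assumes t: "t \<in> bijective_tableaux \<mu>" and T: "\<not> is_tab T"
  shows "polytabloid \<mu> t T = 0"
  unfolding polytabloid_def
proof (rule sum.neutral, rule ballI)
  fix \<sigma> assume "\<sigma> \<in> column_stabilizer \<mu> t"
  then have "\<sigma> permutes {..<n}" by (simp add: column_stabilizer_def sum_list_hook)
  then have st: "\<sigma> \<circ> t \<in> bijective_tableaux \<mu>" by (rule comp_tableau[OF t])
  have "is_tab (tabloid \<mu> (\<sigma> \<circ> t))"
    unfolding tabloid_hook[OF st] by (intro is_tabI tableau_column(1)[OF st]) simp
  then have "T \<noteq> tabloid \<mu> (\<sigma> \<circ> t)" using T by auto
  then show "real_of_int (sign \<sigma>) * of_bool (T = tabloid \<mu> (\<sigma> \<circ> t)) = 0" by simp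
qed

text \<open>The sum over the column stabilizer is the permutation expansion of a determinant indexed
  by the entries of the first column. A tabloid records only which entries lie below the first row,
  so the row of \<open>t (0, 0)\<close> carries no condition and consists of ones.\<close>

lemma polytabloid_hook:
  assumes t: "t \<in> bijective_tableaux \<mu>"
  shows "polytabloid \<mu> t (hook_tabloid n m x) = boundary_det m x (\<lambda>i. t (i, 0))"
proof -
  let ?c = "\<lambda>i. t (i, 0)"
  let ?C = "?c ` {..m}"
  let ?f = "\<lambda>a b. if a = ?c 0 then 1 else of_bool (x (inv_into {..m} ?c a) = b) :: real"
  have inj: "inj_on ?c {..m}" by (rule tableau_column(2)[OF t])
  have "polytabloid \<mu> t (hook_tabloid n m x) = det_on ?C ?f"
    unfolding polytabloid_def column_stabilizer_hook[OF t] det_on_def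
  proof (intro sum.cong refl arg_cong2[where f=times])
    fix \<sigma> assume "\<sigma> \<in> {\<sigma>. \<sigma> permutes ?C}"
    then have s: "\<sigma> permutes ?C" by simp
    have "\<sigma> permutes {..<n}" by (rule permutes_subset[OF s]) (use tableau_column(1)[OF t] in auto)
    then have st: "\<sigma> \<circ> t \<in> bijective_tableaux \<mu>" by (rule comp_tableau[OF t])
    have eq: "hook_tabloid n m x = tabloid \<mu> (\<sigma> \<circ> t) \<longleftrightarrow> (\<forall>j\<in>{1..m}. x j = \<sigma> (?c j))"
      unfolding tabloid_hook[OF st] hook_tabloid_eq_iff by simp
    have "(\<Prod>a\<in>?C. ?f a (\<sigma> a)) = (\<Prod>j\<in>{..m}. ?f (?c j) (\<sigma> (?c j)))"
      by (rule prod.reindex[OF inj, unfolded o_def])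
    also have "\<dots> = (\<Prod>j\<in>{..m}. if j = 0 then 1 else of_bool (x j = \<sigma> (?c j)))"
    proof (rule prod.cong[OF refl])
      fix j assume j: "j \<in> {..m}"
      then have "inv_into {..m} ?c (?c j) = j" using inv_into_f_f[OF inj] by blast
      moreover have "?c j = ?c 0 \<longleftrightarrow> j = 0" using inj_onD[OF inj, of j 0] j by auto
      ultimately show "?f (?c j) (\<sigma> (?c j)) = (if j = 0 then 1 else of_bool (x j = \<sigma> (?c j)))"
        by simp
    qed
    also have "\<dots> = of_bool (\<forall>j\<in>{1..m}. x j = \<sigma> (?c j))"
    proof -
      have "(\<Prod>j\<in>{..m}. if j = 0 then 1 else of_bool (x j = \<sigma> (?c j)) :: real) =
          (\<Prod>j\<in>{1..m}. of_bool (x j = \<sigma> (?c j)))"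
        by (rule prod.mono_neutral_cong_right) auto
      then show ?thesis by (simp only: prod_of_bool[OF finite_atLeastAtMost])
    qed
    finally show "of_bool (hook_tabloid n m x = tabloid \<mu> (\<sigma> \<circ> t)) = (\<Prod>a\<in>?C. ?f a (\<sigma> a))"
      using eq by simp
  qed
  also have "\<dots> = det_on {..m} (\<lambda>i j. ?f (?c i) (?c j))"
    by (rule det_on_reindex) (use inj in \<open>auto simp: bij_betw_def\<close>)
  also have "\<dots> = boundary_det m x ?c"
    unfolding boundary_det_def
  proof (rule det_on_cong)
    fix i j assume i: "i \<in> {..m}"
    then have "inv_into {..m} ?c (?c i) = i" using inv_into_f_f[OF inj] by blast
    moreover have "?c i = ?c 0 \<longleftrightarrow> i = 0" using inj_onD[OF inj, of i 0] i by auto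
    ultimately show "?f (?c i) (?c j) = (if i = 0 then 1 else of_bool (x i = ?c j))" by simp
  qed
  finally show ?thesis .
qed

lemma exists_tableau_column:
  assumes inj: "inj_on c {..m}" and c: "\<And>i. i \<le> m \<Longrightarrow> c i < n"
  shows "\<exists>t\<in>bijective_tableaux \<mu>. \<forall>i\<le>m. t (i, 0) = c i"
proof -
  have "c ` {..m} \<subseteq> {..<n}" using c by auto
  then have "card ({..<n} - c ` {..m}) = card {1..<k}"
    using card_image[OF inj] m by (subst card_Diff_subset) auto
  then obtain g where g: "bij_betw g {1..<k} ({..<n} - c ` {..m})"
    using finite_same_card_bij[of "{1..<k}" "{..<n} - c ` {..m}"] by auto
  define t where "t = (\<lambda>(i, j). if j = 0 then c i else g j)"
  have "bij_betw t ((\<lambda>i. (i, 0)) ` {..m} \<union> Pair 0 ` {1..<k}) (c ` {..m} \<union> ({..<n} - c ` {..m}))"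
  proof (rule bij_betw_combine)
    show "bij_betw t ((\<lambda>i. (i, 0)) ` {..m}) (c ` {..m})"
      using inj by (auto simp: bij_betw_def t_def inj_on_def image_image)
    have "t ` Pair 0 ` {1..<k} = g ` {1..<k}" by (auto simp: t_def image_image)
    then show "bij_betw t (Pair 0 ` {1..<k}) ({..<n} - c ` {..m})"
      using g by (auto simp: bij_betw_def t_def inj_on_def)
  qed auto
  moreover have "(\<lambda>i. (i, 0)) ` {..m} \<union> Pair 0 ` {1..<k} = young_diagram \<mu>"
  proof (intro Set.equalityI subsetI)
    fix p assume "p \<in> young_diagram \<mu>"
    then show "p \<in> (\<lambda>i. (i, 0)) ` {..m} \<union> Pair 0 ` {1..<k}"
      by (cases p) (auto simp: in_diagram_hook image_iff Suc_le_eq)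
  qed (use k in \<open>auto simp: in_diagram_hook\<close>)
  moreover have "c ` {..m} \<union> ({..<n} - c ` {..m}) = {..<n}" using c by auto
  ultimately have "t \<in> bijective_tableaux \<mu>" by (simp add: tableau_bij)
  moreover have "\<forall>i\<le>m. t (i, 0) = c i" by (simp add: t_def)
  ultimately show ?thesis by blast
qed

lemma perm_action_tab:
  assumes w: "w permutes {..<n}"
  shows "perm_action w f (hook_tabloid n m x) = f (hook_tabloid n m (inv_into UNIV w \<circ> x))"
  unfolding perm_action_def using map_image_hook_tabloid[OF permutes_inv[OF w]] by simp

lemma perm_action_polytabloid:
  assumes w: "w permutes {..<n}" and t: "t \<in> bijective_tableaux \<mu>"
  shows "perm_action w (polytabloid \<mu> t) = polytabloid \<mu> (w \<circ> t)"
proof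
  fix T
  have wt: "w \<circ> t \<in> bijective_tableaux \<mu>" by (rule comp_tableau[OF t w])
  have w': "inv_into UNIV w permutes {..<n}" using w by (rule permutes_inv)
  show "perm_action w (polytabloid \<mu> t) T = polytabloid \<mu> (w \<circ> t) T"
  proof (cases "is_tab T")
    case True
    then obtain z where T: "T = hook_tabloid n m z" by (elim is_tabE) (rule that)
    have eq: "inv_into UNIV w a = b \<longleftrightarrow> a = w b" for a b using w by (auto simp: permutes_inverses)
    show ?thesis
      unfolding T perm_action_tab[OF w] polytabloid_hook[OF t] polytabloid_hook[OF wt] boundary_det_def
      by (rule det_on_cong) (simp add: eq)
  next
    case False
    have "\<not> is_tab (map (image (inv_into UNIV w)) T)"
    proof
      assume "is_tab (map (image (inv_into UNIV w)) T)"
      then obtain z where z: "\<forall>j. 1 \<le> j \<and> j \<le> m \<longrightarrow> z j < n"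
        and T: "map (image (inv_into UNIV w)) T = hook_tabloid n m z" by (elim is_tabE) (rule that)
      have "T = map (image w) (map (image (inv_into UNIV w)) T)"
      proof -
        have "image w \<circ> image (inv_into UNIV w) = id"
          by (rule ext) (simp add: image_comp permutes_inv_o(1)[OF w])
        then show ?thesis by simp
      qed
      also have "\<dots> = hook_tabloid n m (w \<circ> z)"
        unfolding T by (rule map_image_hook_tabloid[OF w])
      finally have "T = hook_tabloid n m (w \<circ> z)" .
      moreover have "(w \<circ> z) j < n" if "1 \<le> j" "j \<le> m" for j
        using z that permutes_in_image[OF w, of "z j"] by simp
      ultimately show False
        using False is_tabI[of "w \<circ> z"] by blast
    qed
    then show ?thesis
      using polytabloid_not_tab[OF t] polytabloid_not_tab[OF wt False] by (simp add: perm_action_def)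
  qed
qed

lemma perm_action_hom: "module_hom fun_scale fun_scale (perm_action w)"
  by unfold_locales (auto simp: perm_action_def fun_scale_def fun_eq_iff algebra_simps)

lemma perm_action_specht:
  assumes w: "w permutes {..<n}" and f: "f \<in> specht_module \<mu>"
  shows "perm_action w f \<in> specht_module \<mu>"
proof -
  interpret P: module_hom fun_scale fun_scale "perm_action w :: (nat set list \<Rightarrow> real) \<Rightarrow> _"
    by (rule perm_action_hom)
  have "perm_action w ` specht_module \<mu> = fun_vs.span (perm_action w ` polytabloid \<mu> ` bijective_tableaux \<mu>)"
    unfolding specht_module_def by (rule P.span_image[symmetric])
  also have "\<dots> \<subseteq> specht_module \<mu>"
    unfolding specht_module_def
    by (rule fun_vs.span_mono) (auto simp: perm_action_polytabloid[OF w] intro!: imageI comp_tableau[OF _ w])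
  finally show ?thesis using f by blast
qed

lemma with_zero_pos_tuples:
  assumes "x \<in> pos_tuples n m"
  shows "inj_on (with_zero x) {..m}" and "i \<le> m \<Longrightarrow> with_zero x i < n"
    and "with_zero x ` {..m} = insert 0 (x ` {1..m})"
proof -
  have x: "x i \<in> {1..<n}" if "i \<in> {1..m}" for i using assms that by (auto simp: pos_tuples_def)
  have inj: "inj_on x {1..m}" using assms by (simp add: pos_tuples_def)
  show "inj_on (with_zero x) {..m}"
  proof (rule inj_onI)
    fix a b assume "a \<in> {..m}" "b \<in> {..m}" "with_zero x a = with_zero x b"
    then show "a = b"
      using x[of a] x[of b] inj_onD[OF inj, of a b] by (auto simp: with_zero_def split: if_splits)
  qed
  show "i \<le> m \<Longrightarrow> with_zero x i < n" using x[of i] n_pos by (auto simp: with_zero_def)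
  have "{..m} = insert 0 {1..m}" by auto
  then show "with_zero x ` {..m} = insert 0 (x ` {1..m})"
    by (auto simp: with_zero_def)
qed

lemma sum_pos_tuples:
  fixes g :: "nat set \<Rightarrow> real"
  shows "(\<Sum>x\<in>pos_tuples n m. g (x ` {1..m})) = fact m * (\<Sum>C | C \<subseteq> {1..<n} \<and> card C = m. g C)"
proof -
  have "(\<Sum>x\<in>pos_tuples n m. g (x ` {1..m})) = (\<Sum>C | C \<subseteq> {1..<n} \<and> card C = m.
      \<Sum>x\<in>{x \<in> pos_tuples n m. x ` {1..m} = C}. g (x ` {1..m}))"
  proof (rule sum.group[symmetric])
    show "(\<lambda>x. x ` {1..m}) ` pos_tuples n m \<subseteq> {C. C \<subseteq> {1..<n} \<and> card C = m}"
      by (auto simp: pos_tuples_def card_image PiE_def Pi_def)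
  qed (auto simp: finite_pos_tuples)
  also have "\<dots> = (\<Sum>C | C \<subseteq> {1..<n} \<and> card C = m. fact m * g C)"
  proof (rule sum.cong[OF refl])
    fix C assume "C \<in> {C. C \<subseteq> {1..<n} \<and> card C = m}"
    then have C: "C \<subseteq> {1..<n}" "card C = m" by auto
    then have finC: "finite C" using finite_subset by blast
    have "{x \<in> pos_tuples n m. x ` {1..m} = C} = {x \<in> {1..m} \<rightarrow>\<^sub>E C. inj_on x {1..m}}"
    proof (intro Set.equalityI subsetI)
      fix x assume "x \<in> {x \<in> {1..m} \<rightarrow>\<^sub>E C. inj_on x {1..m}}"
      then have x: "x \<in> {1..m} \<rightarrow>\<^sub>E C" "inj_on x {1..m}" by auto
      have "x ` {1..m} = C"
        using x C finC by (intro card_subset_eq) (auto simp: card_image)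
      with x C show "x \<in> {x \<in> pos_tuples n m. x ` {1..m} = C}"
        by (auto simp: pos_tuples_def PiE_def Pi_def)
    qed (auto simp: pos_tuples_def PiE_def Pi_def)
    moreover have "card {x \<in> {1..m} \<rightarrow>\<^sub>E C. inj_on x {1..m}} = fact m"
      using C finC by (subst card_inj_on_subset_funcset) (auto simp: fact_prod_rev)
    ultimately have "card {x \<in> pos_tuples n m. x ` {1..m} = C} = fact m" by simp
    then show "(\<Sum>x\<in>{x \<in> pos_tuples n m. x ` {1..m} = C}. g (x ` {1..m})) = fact m * g C"
      by simp
  qed
  finally show ?thesis by (simp add: sum_distrib_left)
qed

lemma irreducible_character_hook:
  assumes w: "w permutes {..<n}"
  shows "irreducible_character \<mu> w = (\<Sum>S | S \<subseteq> {..<n} \<and> 0 \<in> S \<and> card S = Suc m.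
    det_on S (\<lambda>a b. if a = 0 then 1 else of_bool (a = w b)))"
proof -
  let ?X = "pos_tuples n m"
  let ?D = "\<lambda>S. det_on S (\<lambda>a b. if a = 0 then 1 else of_bool (a = w b))"
  have "\<forall>x\<in>?X. \<exists>t. t \<in> bijective_tableaux \<mu> \<and> (\<forall>i\<le>m. t (i, 0) = with_zero x i)"
    using exists_tableau_column[OF with_zero_pos_tuples(1,2)] by blast
  then obtain tb where tb: "\<And>x. x \<in> ?X \<Longrightarrow> tb x \<in> bijective_tableaux \<mu>"
      "\<And>x i. x \<in> ?X \<Longrightarrow> i \<le> m \<Longrightarrow> tb x (i, 0) = with_zero x i"
    by metis
  \<comment> \<open>The factor \<open>1 / fact m\<close> compensates for the \<open>fact m\<close>
    orderings of each set that occur in \<open>pos_tuples\<close>.\<close>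
  define q where "q x = fun_scale (1 / fact m) (polytabloid \<mu> (tb x))" for x
  have qtab: "q x (hook_tabloid n m z) = boundary_det m z (with_zero x) / fact m" if "x \<in> ?X" for x z
    unfolding q_def fun_scale_def polytabloid_hook[OF tb(1)[OF that]]
    using boundary_det_cong[of m z z "\<lambda>i. tb x (i, 0)" "with_zero x"] tb(2)[OF that] by simp
  have qW: "q x \<in> specht_module \<mu>" if "x \<in> ?X" for x
    unfolding q_def specht_module_def using tb(1)[OF that]
    by (intro fun_vs.span_scale fun_vs.span_base imageI)
  have repr0: "polytabloid \<mu> t = (\<Sum>x\<in>?X. fun_scale (polytabloid \<mu> t (hook_tabloid n m x)) (q x))"
    if t: "t \<in> bijective_tableaux \<mu>" for t
  proof
    fix T
    show "polytabloid \<mu> t T = (\<Sum>x\<in>?X. fun_scale (polytabloid \<mu> t (hook_tabloid n m x)) (q x)) T"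
    proof (cases "is_tab T")
      case True
      then obtain z where z: "\<forall>j. 1 \<le> j \<and> j \<le> m \<longrightarrow> z j < n" and T: "T = hook_tabloid n m z"
        by (elim is_tabE) (rule that)
      let ?c = "\<lambda>i. t (i, 0)"
      have "(\<Sum>x\<in>?X. fun_scale (polytabloid \<mu> t (hook_tabloid n m x)) (q x)) T =
          (\<Sum>x\<in>?X. boundary_det m x ?c * boundary_det m z (with_zero x)) / fact m"
        unfolding T by (simp add: sum_fun_apply fun_scale_def[of _ "q _"] qtab polytabloid_hook[OF t] sum_divide_distrib)
      also have "(\<Sum>x\<in>?X. boundary_det m x ?c * boundary_det m z (with_zero x)) = fact m * boundary_det m z ?c"
        by (rule boundary_det_decomp) (use tableau_column(1)[OF t] n_pos z in auto)
      finally show ?thesis unfolding T polytabloid_hook[OF t] by simp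
    next
      case False
      have "q x T = 0" if "x \<in> ?X" for x
        unfolding q_def fun_scale_def using polytabloid_not_tab[OF tb(1)[OF that] False] by simp
      then show ?thesis
        using polytabloid_not_tab[OF t False] by (simp add: sum_fun_apply fun_scale_def)
    qed
  qed
  have repr: "f = (\<Sum>x\<in>?X. fun_scale (f (hook_tabloid n m x)) (q x))" if "f \<in> specht_module \<mu>" for f
    using that unfolding specht_module_def
  proof (induction rule: fun_vs.span_induct_alt)
    case base
    show ?case by (simp add: fun_scale_def fun_eq_iff sum_fun_apply)
  next
    case (step c g f)
    then obtain t where t: "t \<in> bijective_tableaux \<mu>" "g = polytabloid \<mu> t" by auto
    show ?case
    proof
      fix T
      have "g T = (\<Sum>x\<in>?X. g (hook_tabloid n m x) * q x T)"
        using fun_cong[OF repr0[OF t(1)], of T] unfolding t(2) by (simp add: sum_fun_apply fun_scale_def)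
      moreover have "f T = (\<Sum>x\<in>?X. f (hook_tabloid n m x) * q x T)"
        using fun_cong[OF step(2), of T] by (simp add: sum_fun_apply fun_scale_def)
      ultimately show "(fun_scale c g + f) T =
          (\<Sum>x\<in>?X. fun_scale ((fun_scale c g + f) (hook_tabloid n m x)) (q x)) T"
        by (simp add: sum_fun_apply fun_scale_def algebra_simps sum.distrib sum_distrib_left)
    qed
  qed
  have "irreducible_character \<mu> w = (\<Sum>x\<in>?X. perm_action w (q x) (hook_tabloid n m x))"
    unfolding irreducible_character_def
  proof (rule trace_on_eq)
    show "fun_vs.subspace (specht_module \<mu>)" unfolding specht_module_def by (rule fun_vs.subspace_span)
  qed (use finite_pos_tuples qW repr perm_action_specht[OF w] perm_action_hom in auto)
  also have "\<dots> = (\<Sum>x\<in>?X. ?D (insert 0 (x ` {1..m})) / fact m)"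
  proof (rule sum.cong[OF refl])
    fix x assume x: "x \<in> ?X"
    have eq: "inv_into UNIV w a = b \<longleftrightarrow> a = w b" for a b using w by (auto simp: permutes_inverses)
    have "perm_action w (q x) (hook_tabloid n m x) =
        boundary_det m (inv_into UNIV w \<circ> x) (with_zero x) / fact m"
      unfolding perm_action_tab[OF w] by (rule qtab[OF x])
    also have "boundary_det m (inv_into UNIV w \<circ> x) (with_zero x) =
        det_on {..m} (\<lambda>i j. if with_zero x i = 0 then 1 else of_bool (with_zero x i = w (with_zero x j)))"
      unfolding boundary_det_def
    proof (rule det_on_cong)
      fix i j assume i: "i \<in> {..m}"
      have w0: "with_zero x 0 = 0" by (simp add: with_zero_def)
      have "i = 0" if "with_zero x i = 0"
        by (rule inj_onD[OF with_zero_pos_tuples(1)[OF x]]) (use that w0 i in auto)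
      with w0 have "with_zero x i = 0 \<longleftrightarrow> i = 0" by blast
      moreover have "with_zero x i = x i" if "i \<noteq> 0" using that by (simp add: with_zero_def)
      ultimately show "(if i = 0 then 1 else of_bool ((inv_into UNIV w \<circ> x) i = with_zero x j)) =
          (if with_zero x i = 0 then 1 else of_bool (with_zero x i = w (with_zero x j)) :: real)"
        by (cases "i = 0") (simp_all add: eq)
    qed
    also have "\<dots> = ?D (insert 0 (x ` {1..m}))"
      by (rule det_on_reindex[symmetric])
        (use with_zero_pos_tuples[OF x] in \<open>auto simp: bij_betw_def\<close>)
    finally show "perm_action w (q x) (hook_tabloid n m x) = ?D (insert 0 (x ` {1..m})) / fact m" .
  qed
  also have "\<dots> = (\<Sum>C | C \<subseteq> {1..<n} \<and> card C = m. ?D (insert 0 C))"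
    using sum_pos_tuples[of "\<lambda>C. ?D (insert 0 C)"] by (simp add: sum_divide_distrib[symmetric])
  also have "\<dots> = (\<Sum>S | S \<subseteq> {..<n} \<and> 0 \<in> S \<and> card S = Suc m. ?D S)"
  proof (rule sum.reindex_bij_witness[of _ "\<lambda>S. S - {0}" "insert 0"])
    fix C assume "C \<in> {C. C \<subseteq> {1..<n} \<and> card C = m}"
    then have C: "C \<subseteq> {1..<n}" "card C = m" "0 \<notin> C" "finite C" by (auto intro: finite_subset)
    then show "insert 0 C \<in> {S. S \<subseteq> {..<n} \<and> 0 \<in> S \<and> card S = Suc m}"
      using n_pos by auto
    show "insert 0 C - {0} = C" using C by auto
  next
    fix S assume "S \<in> {S. S \<subseteq> {..<n} \<and> 0 \<in> S \<and> card S = Suc m}"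
    then have S: "S \<subseteq> {..<n}" "0 \<in> S" "card S = Suc m" "finite S" by (auto intro: finite_subset)
    then show "insert 0 (S - {0}) = S" by auto
    have "S - {0} \<subseteq> {1..<n}" using S(1) by (auto simp: Suc_le_eq)
    then show "S - {0} \<in> {C. C \<subseteq> {1..<n} \<and> card C = m}"
      using S by (auto simp: card_Diff_singleton)
  qed auto
  finally show ?thesis .
qed

end

section \<open>Nonintersecting paths\<close>

text \<open>Take the least moved point \<open>x\<close> and its preimage \<open>y\<close>:
  minimality forces both \<open>\<sigma> x\<close> and \<open>y\<close> to exceed
  \<open>x\<close>.\<close>

lemma permutes_inversion:
  fixes I :: "nat set"
  assumes s: "\<sigma> permutes I" and ne: "\<sigma> \<noteq> id"
  shows "\<exists>i\<in>I. \<exists>j\<in>I. i < j \<and> \<sigma> j < \<sigma> i"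
proof -
  have "\<exists>x. \<sigma> x \<noteq> x" using ne by (auto simp: fun_eq_iff)
  then obtain x where x: "\<sigma> x \<noteq> x" and least: "\<And>y. y < x \<Longrightarrow> \<sigma> y = y"
    using exists_least_iff[of "\<lambda>x. \<sigma> x \<noteq> x"] by blast
  have inj: "\<sigma> a = \<sigma> b \<Longrightarrow> a = b" for a b using permutes_inj[OF s] by (auto dest: injD)
  obtain y where y: "\<sigma> y = x" using s by (metis permutes_def)
  have "x < \<sigma> x"
    using x least[of "\<sigma> x"] inj[of "\<sigma> x" x] by (metis linorder_neqE_nat)
  moreover have "x < y"
    using y x least[of y] by (metis linorder_neqE_nat)
  moreover have "x \<in> I" "y \<in> I"
    using x y permutes_not_in[OF s, of x] permutes_not_in[OF s, of y] \<open>x < y\<close> by auto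
  ultimately show ?thesis using y by auto
qed

text \<open>The last assumption is the only consequence of planarity that the argument needs.\<close>

locale path_network = fin_digraph "graph F" for F :: "('v, 'e) network" +
  fixes n :: nat
  assumes acyclic: "\<nexists>c. cycle c"
    and source_inj: "i < n \<Longrightarrow> j < n \<Longrightarrow> source F i = source F j \<Longrightarrow> i = j"
    and source_ne_sink: "i < n \<Longrightarrow> j < n \<Longrightarrow> source F i \<noteq> sink F j"
    and crossing: "\<lbrakk>i < i'; i' < n; j < j'; j' < n; awalk (source F i) p (sink F j');
      awalk (source F i') q (sink F j)\<rbrakk> \<Longrightarrow>
      set (awalk_verts (source F i) p) \<inter> set (awalk_verts (source F i') q) \<noteq> {}"
begin

section \<open>Walks in an acyclic network\<close>

lemma closed_awalk_Nil: "awalk u p u \<Longrightarrow> p = []"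
  using acyclic closed_w_imp_cycle[of p] by (auto simp: closed_w_def)

lemma awalk_imp_apath:
  assumes "awalk u p v" shows "apath u p v"
proof (rule ccontr)
  assume "\<not> apath u p v"
  then have "\<not> distinct (awalk_verts u p)" using assms by (simp add: apath_def)
  from awalk_not_distinct_decomp[OF assms this] obtain r w where "0 < length r" "awalk w r w" by blast
  then show False using closed_awalk_Nil by auto
qed

lemma paths_iff: "p \<in> network_paths F i j \<longleftrightarrow> awalk (source F i) p (sink F j)"
  using awalk_imp_apath by (auto simp: network_paths_def apath_def)

lemma finite_paths: "finite (network_paths F i j)"
  unfolding network_paths_def by (rule apaths_finite)

definition path_verts :: "nat \<Rightarrow> 'e list \<Rightarrow> 'v set" where
  "path_verts i p = set (awalk_verts (source F i) p)"

definition path_weight :: "'e list \<Rightarrow> real" where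
  "path_weight p = prod_list (map (weight F) p)"

definition path_sum :: "nat \<Rightarrow> nat \<Rightarrow> real" where
  "path_sum i j = (\<Sum>p\<in>network_paths F i j. path_weight p)"

lemma path_weight_append: "path_weight (p @ q) = path_weight p * path_weight q"
  by (simp add: path_weight_def)

text \<open>By acyclicity, a walk through \<open>v\<close> splits at \<open>v\<close> in only one way.\<close>

definition init_seg :: "'v \<Rightarrow> 'v \<Rightarrow> 'e list \<Rightarrow> 'e list" where
  "init_seg v u p = (SOME q. \<exists>r w. p = q @ r \<and> awalk u q v \<and> awalk v r w)"

definition final_seg :: "'v \<Rightarrow> 'v \<Rightarrow> 'e list \<Rightarrow> 'e list" where
  "final_seg v u p = drop (length (init_seg v u p)) p"

text \<open>Of two initial segments ending at \<open>v\<close>, the longer one extends the shorter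
  by a closed walk at \<open>v\<close>, which acyclicity makes empty.\<close>

lemma awalk_split_unique:
  assumes "awalk u q v" "awalk v r w" "awalk u q' v" "awalk v r' w'" "q @ r = q' @ r'"
  shows "q = q'"
proof -
  have *: "q = q'" if "awalk u q v" "awalk u q' v" "q' = q @ d" for q q' d
  proof -
    have "awalk v d v"
      using that awalk_append_iff[of u q d v] awalk_ends[of u q v] by (auto dest: awalk_ends_eqD)
    then show ?thesis using closed_awalk_Nil that by auto
  qed
  from assms(5) obtain d where "q = q' @ d \<or> q' = q @ d"
    by (auto simp: append_eq_append_conv2)
  then show ?thesis
    using *[OF assms(1,3)] *[OF assms(3,1)] by metis
qed

lemma seg_append:
  assumes "awalk u q v" "awalk v r w"
  shows "init_seg v u (q @ r) = q" and "final_seg v u (q @ r) = r"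
proof -
  have "\<exists>r' w'. q @ r = init_seg v u (q @ r) @ r' \<and> awalk u (init_seg v u (q @ r)) v \<and> awalk v r' w'"
    unfolding init_seg_def by (rule someI[of _ q]) (use assms in blast)
  then show i: "init_seg v u (q @ r) = q"
    using awalk_split_unique[OF assms] by metis
  show "final_seg v u (q @ r) = r" by (simp add: final_seg_def i)
qed

lemma seg:
  assumes "awalk u p w" "v \<in> set (awalk_verts u p)"
  shows "awalk u (init_seg v u p) v" "awalk v (final_seg v u p) w"
    "init_seg v u p @ final_seg v u p = p"
proof -
  obtain q r where "p = q @ r" "awalk u q v" "awalk v r w" using awalk_decomp[OF assms] by blast
  then show "awalk u (init_seg v u p) v" "awalk v (final_seg v u p) w"
    "init_seg v u p @ final_seg v u p = p"
    using seg_append by auto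
qed

text \<open>Following \<open>q\<close> from \<open>u\<close> to \<open>v\<close> and then
  \<open>r\<close> back to \<open>u\<close> gives a closed walk. Hence a walk into \<open>v\<close>
  and a walk out of \<open>v\<close> share no vertex but \<open>v\<close>.\<close>

lemma meet_unique:
  assumes "awalk x q v" "awalk v r y" "u \<in> set (awalk_verts x q)" "u \<in> set (awalk_verts v r)"
  shows "u = v"
proof -
  obtain q' where q': "awalk u q' v" using awalk_decomp[OF assms(1,3)] by blast
  obtain r' where r': "awalk v r' u" using awalk_decomp[OF assms(2,4)] by blast
  have "awalk u (q' @ r') u" using q' r' by (rule awalk_appendI)
  then have "q' = []" using closed_awalk_Nil by blast
  then show ?thesis using q' by (simp add: awalk_Nil_iff)
qed

section \<open>Path families and the exchange of tails\<close>

definition families :: "nat set \<Rightarrow> (nat \<Rightarrow> nat) \<Rightarrow> (nat \<Rightarrow> 'e list) set" where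
  "families I \<sigma> = Pi\<^sub>E I (\<lambda>i. network_paths F i (\<sigma> i))"

definition family_weight :: "nat set \<Rightarrow> (nat \<Rightarrow> 'e list) \<Rightarrow> real" where
  "family_weight I \<pi> = (\<Prod>i\<in>I. path_weight (\<pi> i))"

definition nonintersecting :: "nat set \<Rightarrow> (nat \<Rightarrow> 'e list) \<Rightarrow> bool" where
  "nonintersecting I \<pi> \<longleftrightarrow> (\<forall>i\<in>I. \<forall>j\<in>I. i \<noteq> j \<longrightarrow> path_verts i (\<pi> i) \<inter> path_verts j (\<pi> j) = {})"

lemma finite_families: "finite I \<Longrightarrow> finite (families I \<sigma>)"
  unfolding families_def by (rule finite_PiE) (simp_all add: finite_paths)

definition through :: "nat set \<Rightarrow> (nat \<Rightarrow> 'e list) \<Rightarrow> 'v \<Rightarrow> nat set" where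
  "through I \<pi> v = {i \<in> I. v \<in> path_verts i (\<pi> i)}"

definition swap_tails :: "nat \<Rightarrow> nat \<Rightarrow> 'v \<Rightarrow> (nat \<Rightarrow> 'e list) \<Rightarrow> nat \<Rightarrow> 'e list" where
  "swap_tails i j v \<pi> = \<pi>
    (i := init_seg v (source F i) (\<pi> i) @ final_seg v (source F j) (\<pi> j),
     j := init_seg v (source F j) (\<pi> j) @ final_seg v (source F i) (\<pi> i))"

context
  fixes I :: "nat set" and i j :: nat and v :: 'v and \<pi> :: "nat \<Rightarrow> 'e list" and \<sigma> :: "nat \<Rightarrow> nat"
  assumes fin: "finite I" and ij: "i \<in> I" "j \<in> I" "i \<noteq> j"
    and vi: "v \<in> path_verts i (\<pi> i)" and vj: "v \<in> path_verts j (\<pi> j)"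
    and \<pi>: "\<pi> \<in> families I \<sigma>"
begin

lemma swap_awalks:
  "awalk (source F i) (\<pi> i) (sink F (\<sigma> i))" "awalk (source F j) (\<pi> j) (sink F (\<sigma> j))"
  using \<pi> ij by (auto simp: families_def paths_iff[symmetric])

lemma swap_segs:
  "awalk (source F i) (init_seg v (source F i) (\<pi> i)) v"
  "awalk v (final_seg v (source F i) (\<pi> i)) (sink F (\<sigma> i))"
  "init_seg v (source F i) (\<pi> i) @ final_seg v (source F i) (\<pi> i) = \<pi> i"
  "awalk (source F j) (init_seg v (source F j) (\<pi> j)) v"
  "awalk v (final_seg v (source F j) (\<pi> j)) (sink F (\<sigma> j))"
  "init_seg v (source F j) (\<pi> j) @ final_seg v (source F j) (\<pi> j) = \<pi> j"
  using seg[OF swap_awalks(1)] seg[OF swap_awalks(2)] vi vj by (auto simp: path_verts_def)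

lemma swap_tails_families: "swap_tails i j v \<pi> \<in> families I (\<sigma> \<circ> Transposition.transpose i j)"
proof -
  have "awalk (source F i) (init_seg v (source F i) (\<pi> i) @ final_seg v (source F j) (\<pi> j)) (sink F (\<sigma> j))"
    "awalk (source F j) (init_seg v (source F j) (\<pi> j) @ final_seg v (source F i) (\<pi> i)) (sink F (\<sigma> i))"
    using swap_segs awalk_appendI by blast+
  note new = this
  have old: "\<pi> l \<in> network_paths F l (\<sigma> l)" if "l \<in> I" for l
    using \<pi> that by (auto simp: families_def)
  have und: "\<pi> l = undefined" if "l \<notin> I" for l
    using \<pi> that by (auto simp: families_def)
  show ?thesis
    unfolding families_def
  proof (rule PiE_I)
    fix l assume l: "l \<in> I"
    consider "l = i" | "l = j" | "l \<noteq> i" "l \<noteq> j" by blast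
    then show "swap_tails i j v \<pi> l \<in> network_paths F l ((\<sigma> \<circ> Transposition.transpose i j) l)"
      by cases (use new ij(3) old[OF l] in \<open>simp_all add: swap_tails_def paths_iff\<close>)
  next
    fix l assume "l \<notin> I"
    then show "swap_tails i j v \<pi> l = undefined"
      using und ij by (auto simp: swap_tails_def)
  qed
qed

lemma swap_tails_twice: "swap_tails i j v (swap_tails i j v \<pi>) = \<pi>"
  using swap_segs ij seg_append[OF swap_segs(1) swap_segs(5)] seg_append[OF swap_segs(4) swap_segs(2)]
  by (auto simp: swap_tails_def fun_eq_iff)

lemma swap_tails_weight: "family_weight I (swap_tails i j v \<pi>) = family_weight I \<pi>"
proof -
  have split: "family_weight I \<rho> = path_weight (\<rho> i) * (path_weight (\<rho> j) * (\<Prod>l\<in>I-{i}-{j}. path_weight (\<rho> l)))" for \<rho>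
    unfolding family_weight_def using fin ij
    by (simp add: prod.remove[of I i] prod.remove[of "I - {i}" j])
  have "(\<Prod>l\<in>I-{i}-{j}. path_weight (swap_tails i j v \<pi> l)) = (\<Prod>l\<in>I-{i}-{j}. path_weight (\<pi> l))"
    by (rule prod.cong) (auto simp: swap_tails_def)
  moreover have "path_weight (swap_tails i j v \<pi> i) * path_weight (swap_tails i j v \<pi> j) =
      path_weight (\<pi> i) * path_weight (\<pi> j)"
  proof -
    have "path_weight (\<pi> i) = path_weight (init_seg v (source F i) (\<pi> i)) * path_weight (final_seg v (source F i) (\<pi> i))"
      "path_weight (\<pi> j) = path_weight (init_seg v (source F j) (\<pi> j)) * path_weight (final_seg v (source F j) (\<pi> j))"
      using swap_segs by (simp_all add: path_weight_append[symmetric])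
    then show ?thesis using ij(3) by (simp add: swap_tails_def path_weight_append)
  qed
  ultimately show ?thesis unfolding split[of "swap_tails i j v \<pi>"] split[of \<pi>]
    by (simp add: mult.assoc[symmetric])
qed

lemma swap_tails_through_self: "through I (swap_tails i j v \<pi>) v = through I \<pi> v"
proof -
  have "v \<in> path_verts i (swap_tails i j v \<pi> i)" "v \<in> path_verts j (swap_tails i j v \<pi> j)"
    using swap_segs ij(3) hd_in_awalk_verts(1)[OF swap_segs(2)] hd_in_awalk_verts(1)[OF swap_segs(5)]
    by (auto simp: path_verts_def swap_tails_def set_awalk_verts_append)
  then show ?thesis using vi vj by (auto simp: through_def swap_tails_def)
qed

text \<open>The set of paths through \<open>u\<close> may change, because a vertex on a final
  segment moves to the other path. Its size does not: by \<open>meet_unique\<close> no vertex other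
  than \<open>v\<close> lies on both an initial and a final segment. At \<open>v\<close> even the
  set is preserved, so that the exchanged pair can be recovered from it.\<close>

lemma swap_tails_card_through: "card (through I (swap_tails i j v \<pi>) u) = card (through I \<pi> u)"
proof (cases "u = v")
  case True
  then show ?thesis using swap_tails_through_self by simp
next
  case False
  let ?\<rho> = "swap_tails i j v \<pi>"
  let ?Q = "\<lambda>l. u \<in> set (awalk_verts (source F l) (init_seg v (source F l) (\<pi> l)))"
  let ?R = "\<lambda>l. u \<in> set (awalk_verts v (final_seg v (source F l) (\<pi> l)))"
  have pv: "u \<in> path_verts i (\<pi> i) \<longleftrightarrow> ?Q i \<or> ?R i" "u \<in> path_verts j (\<pi> j) \<longleftrightarrow> ?Q j \<or> ?R j"
    using set_awalk_verts_append[OF swap_segs(1,2)] set_awalk_verts_append[OF swap_segs(4,5)] swap_segs(3,6)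
    by (auto simp: path_verts_def)
  have rv: "u \<in> path_verts i (?\<rho> i) \<longleftrightarrow> ?Q i \<or> ?R j" "u \<in> path_verts j (?\<rho> j) \<longleftrightarrow> ?Q j \<or> ?R i"
    using set_awalk_verts_append[OF swap_segs(1,5)] set_awalk_verts_append[OF swap_segs(4,2)] ij(3)
    by (auto simp: path_verts_def swap_tails_def)
  have dis: "\<not> (?Q i \<and> ?R i)" "\<not> (?Q j \<and> ?R j)" "\<not> (?Q i \<and> ?R j)" "\<not> (?Q j \<and> ?R i)"
    using meet_unique[OF swap_segs(1,2)] meet_unique[OF swap_segs(4,5)] meet_unique[OF swap_segs(1,5)]
      meet_unique[OF swap_segs(4,2)] False by blast+
  have card: "card (through I \<rho> u) = of_bool (u \<in> path_verts i (\<rho> i)) + of_bool (u \<in> path_verts j (\<rho> j)) +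
      card (through (I - {i} - {j}) \<rho> u)" for \<rho>
  proof -
    have c: "card (through K \<rho> u) = (\<Sum>l\<in>K. of_bool (u \<in> path_verts l (\<rho> l)))" if "finite K" for K
      using that by (simp add: through_def Collect_conj_eq)
    have "card (through I \<rho> u) = (\<Sum>l\<in>I. of_bool (u \<in> path_verts l (\<rho> l)))"
      by (rule c[OF fin])
    also have "\<dots> = of_bool (u \<in> path_verts i (\<rho> i)) + (of_bool (u \<in> path_verts j (\<rho> j)) +
        (\<Sum>l\<in>I - {i} - {j}. of_bool (u \<in> path_verts l (\<rho> l))))"
      using fin ij by (simp add: sum.remove[of I i] sum.remove[of "I - {i}" j] del: sum_of_bool_eq)
    also have "(\<Sum>l\<in>I - {i} - {j}. of_bool (u \<in> path_verts l (\<rho> l))) = card (through (I - {i} - {j}) \<rho> u)"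
      by (rule c[symmetric]) (use fin in simp)
    finally show ?thesis by simp
  qed
  have "through (I - {i} - {j}) ?\<rho> u = through (I - {i} - {j}) \<pi> u"
    by (auto simp: through_def swap_tails_def)
  then show ?thesis
    unfolding card[of ?\<rho>] card[of \<pi>] pv rv using dis by auto
qed

end

lemma nonintersecting_imp_id:
  assumes s: "\<sigma> permutes I" and I: "I \<subseteq> {..<n}" and p: "\<pi> \<in> families I \<sigma>" and ni: "nonintersecting I \<pi>"
  shows "\<sigma> = id"
proof (rule ccontr)
  assume "\<sigma> \<noteq> id"
  then obtain i j where ij: "i \<in> I" "j \<in> I" "i < j" "\<sigma> j < \<sigma> i"
    using permutes_inversion[OF s] by blast
  have "\<sigma> i \<in> I" using permutes_in_image[OF s] ij by blast
  then have "path_verts i (\<pi> i) \<inter> path_verts j (\<pi> j) \<noteq> {}"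
    unfolding path_verts_def using ij I p
    by (intro crossing[of i j "\<sigma> j" "\<sigma> i"]) (auto simp: families_def PiE_iff paths_iff)
  then show False using ni ij unfolding nonintersecting_def by auto
qed

lemma intersecting_sum_zero:
  assumes fin: "finite I"
  shows "(\<Sum>(\<sigma>, \<pi>) \<in> {(\<sigma>, \<pi>). \<sigma> permutes I \<and> \<pi> \<in> families I \<sigma> \<and> \<not> nonintersecting I \<pi>}.
    real_of_int (sign \<sigma>) * family_weight I \<pi>) = 0"
proof -
  txt \<open>The vertex and the two paths are chosen as functions of data that the swap preserves.\<close>
  define vx where "vx \<pi> = (SOME v. 2 \<le> card (through I \<pi> v))" for \<pi>
  define a where "a \<pi> = Min (through I \<pi> (vx \<pi>))" for \<pi>
  define b where "b \<pi> = Min (through I \<pi> (vx \<pi>) - {a \<pi>})" for \<pi>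
  define h where "h = (\<lambda>(\<sigma> :: nat \<Rightarrow> nat, \<pi>). (\<sigma> \<circ> Transposition.transpose (a \<pi>) (b \<pi>), swap_tails (a \<pi>) (b \<pi>) (vx \<pi>) \<pi>))"
  let ?S = "{(\<sigma>, \<pi>). \<sigma> permutes I \<and> \<pi> \<in> families I \<sigma> \<and> \<not> nonintersecting I \<pi>}"
  have fint: "finite (through I \<pi> v)" for \<pi> v using fin by (simp add: through_def)
  \<comment> \<open>Intersection is expressed by the numbers
    \<open>card (through I \<pi> v)\<close>, which the exchange preserves, so the image of an
    intersecting family is again intersecting.\<close>
  have ni_iff: "\<not> nonintersecting I \<pi> \<longleftrightarrow> (\<exists>v. 2 \<le> card (through I \<pi> v))" for \<pi>
  proof
    assume "\<not> nonintersecting I \<pi>"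
    then obtain i j v where "i \<in> through I \<pi> v" "j \<in> through I \<pi> v" "i \<noteq> j"
      by (auto simp: nonintersecting_def through_def)
    then have "card {i, j} \<le> card (through I \<pi> v)" by (intro card_mono fint) auto
    moreover have "card {i, j} = 2" using \<open>i \<noteq> j\<close> by simp
    ultimately show "\<exists>v. 2 \<le> card (through I \<pi> v)" by (intro exI[of _ v]) simp
  next
    assume "\<exists>v. 2 \<le> card (through I \<pi> v)"
    then obtain v where "2 \<le> card (through I \<pi> v)" by blast
    then have "\<not> card (through I \<pi> v) \<le> Suc 0" by simp
    then obtain i j where "i \<in> through I \<pi> v" "j \<in> through I \<pi> v" "i \<noteq> j"
      unfolding card_le_Suc0_iff_eq[OF fint] by blast
    then show "\<not> nonintersecting I \<pi>" by (auto simp: nonintersecting_def through_def)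
  qed
  have ab: "a \<pi> \<in> I" "b \<pi> \<in> I" "a \<pi> \<noteq> b \<pi>" "vx \<pi> \<in> path_verts (a \<pi>) (\<pi> (a \<pi>))"
    "vx \<pi> \<in> path_verts (b \<pi>) (\<pi> (b \<pi>))" if "\<not> nonintersecting I \<pi>" for \<pi>
  proof -
    have 2: "2 \<le> card (through I \<pi> (vx \<pi>))"
      unfolding vx_def by (rule someI_ex) (rule ni_iff[THEN iffD1, OF that])
    then have "through I \<pi> (vx \<pi>) \<noteq> {}" by auto
    then have 1: "a \<pi> \<in> through I \<pi> (vx \<pi>)" unfolding a_def by (intro Min_in fint)
    have "card (through I \<pi> (vx \<pi>) - {a \<pi>}) \<noteq> 0" using 1 2 fint by (simp add: card_Diff_singleton)
    then have "through I \<pi> (vx \<pi>) - {a \<pi>} \<noteq> {}" by (metis card.empty)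
    then have "b \<pi> \<in> through I \<pi> (vx \<pi>) - {a \<pi>}" unfolding b_def by (intro Min_in finite_Diff fint)
    with 1 show "a \<pi> \<in> I" "b \<pi> \<in> I" "a \<pi> \<noteq> b \<pi>" "vx \<pi> \<in> path_verts (a \<pi>) (\<pi> (a \<pi>))"
      "vx \<pi> \<in> path_verts (b \<pi>) (\<pi> (b \<pi>))" by (auto simp: through_def)
  qed
  have vx_cong: "vx \<rho> = vx \<pi>" if "\<And>u. card (through I \<rho> u) = card (through I \<pi> u)" for \<rho> \<pi>
    using that by (simp add: vx_def)
  have ab_cong: "a \<rho> = a \<pi> \<and> b \<rho> = b \<pi>"
    if "vx \<rho> = vx \<pi>" "through I \<rho> (vx \<pi>) = through I \<pi> (vx \<pi>)" for \<rho> \<pi>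
    using that by (simp add: a_def b_def)
  have key: "h (\<sigma>, \<pi>) \<in> ?S \<and> h (h (\<sigma>, \<pi>)) = (\<sigma>, \<pi>) \<and>
      real_of_int (sign (fst (h (\<sigma>, \<pi>)))) * family_weight I (snd (h (\<sigma>, \<pi>))) = - (real_of_int (sign \<sigma>) * family_weight I \<pi>)"
    if s: "\<sigma> permutes I" and p: "\<pi> \<in> families I \<sigma>" and ni: "\<not> nonintersecting I \<pi>" for \<sigma> \<pi>
  proof -
    note sw = fin ab[OF ni] p
    let ?\<rho> = "swap_tails (a \<pi>) (b \<pi>) (vx \<pi>) \<pi>"
    let ?t = "Transposition.transpose (a \<pi>) (b \<pi>)"
    have ct: "card (through I ?\<rho> u) = card (through I \<pi> u)" for u
      by (rule swap_tails_card_through[OF sw])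
    have vx: "vx ?\<rho> = vx \<pi>" by (rule vx_cong) (rule ct)
    have a: "a ?\<rho> = a \<pi>" and b: "b ?\<rho> = b \<pi>"
      using ab_cong[OF vx swap_tails_through_self[OF sw]] by simp_all
    have t: "?t permutes I" using ab[OF ni] by (intro Permutations.permutes_swap_id)
    have s': "\<sigma> \<circ> ?t permutes I" using t s by (rule permutes_compose)
    have ni': "\<not> nonintersecting I ?\<rho>" using ni unfolding ni_iff ct .
    have sg: "sign (\<sigma> \<circ> ?t) = - sign \<sigma>"
    proof -
      have "permutation \<sigma>" "permutation ?t" using s t fin by (auto simp: permutation_permutes)
      then show ?thesis using ab(3)[OF ni] by (simp add: sign_compose sign_swap_id)
    qed
    have "h (h (\<sigma>, \<pi>)) = (\<sigma>, \<pi>)"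
      unfolding h_def using swap_tails_twice[OF sw] by (simp add: a b vx comp_assoc)
    moreover have "h (\<sigma>, \<pi>) \<in> ?S"
      using swap_tails_families[OF sw] s' ni' by (simp add: h_def)
    ultimately show ?thesis
      using sg swap_tails_weight[OF sw] by (simp add: h_def)
  qed
  show ?thesis
  proof (rule sum_involution_zero[where h = h])
    fix x assume "x \<in> ?S"
    then obtain \<sigma> \<pi> where x: "x = (\<sigma>, \<pi>)" and *: "\<sigma> permutes I" "\<pi> \<in> families I \<sigma>" "\<not> nonintersecting I \<pi>"
      by auto
    show "h x \<in> ?S" unfolding x by (rule key[OF *, THEN conjunct1])
    show "h (h x) = x" unfolding x by (rule key[OF *, THEN conjunct2, THEN conjunct1])
    show "(case h x of (\<sigma>, \<pi>) \<Rightarrow> real_of_int (sign \<sigma>) * family_weight I \<pi>) =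
        - (case x of (\<sigma>, \<pi>) \<Rightarrow> real_of_int (sign \<sigma>) * family_weight I \<pi>)"
      using key[OF *] unfolding x by (simp add: case_prod_beta)
  qed
qed

text \<open>Expanding the products of path sums gives all signed families. The intersecting ones
  cancel, and a nonintersecting one has \<open>\<sigma> = id\<close>, hence sign 1.\<close>

theorem lindstroem_gessel_viennot:
  assumes I: "I \<subseteq> {..<n}"
  shows "det_on I path_sum = (\<Sum>\<pi> | \<pi> \<in> families I id \<and> nonintersecting I \<pi>. family_weight I \<pi>)"
proof -
  have fin: "finite I" using I finite_subset by blast
  have finp: "finite {\<sigma>. \<sigma> permutes I}" by (rule finite_permutations[OF fin])
  let ?w = "\<lambda>(\<sigma>, \<pi>). real_of_int (sign \<sigma>) * family_weight I \<pi>"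
  let ?S = "{(\<sigma>, \<pi>). \<sigma> permutes I \<and> \<pi> \<in> families I \<sigma> \<and> \<not> nonintersecting I \<pi>}"
  let ?N = "{(\<sigma>, \<pi>). \<sigma> permutes I \<and> \<pi> \<in> families I \<sigma> \<and> nonintersecting I \<pi>}"
  have all: "Sigma {\<sigma>. \<sigma> permutes I} (families I) = ?S \<union> ?N" by auto
  have finS: "finite (Sigma {\<sigma>. \<sigma> permutes I} (families I))"
    using finp finite_families[OF fin] by blast
  have "det_on I path_sum = (\<Sum>\<sigma> | \<sigma> permutes I. \<Sum>\<pi>\<in>families I \<sigma>. real_of_int (sign \<sigma>) * family_weight I \<pi>)"
    unfolding det_on_def path_sum_def family_weight_def families_def
    using prod_sum_PiE[OF fin, of "\<lambda>i. network_paths F i (_ i)" "\<lambda>_. path_weight"] finite_paths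
    by (simp add: sum_distrib_left)
  also have "\<dots> = sum ?w (Sigma {\<sigma>. \<sigma> permutes I} (families I))"
    by (rule sum.Sigma) (use finp finite_families[OF fin] in auto)
  also have "\<dots> = sum ?w ?S + sum ?w ?N"
    unfolding all by (rule sum.union_disjoint) (use finS[unfolded all] in auto)
  also have "sum ?w ?S = 0" by (rule intersecting_sum_zero[OF fin])
  also have "sum ?w ?N = (\<Sum>\<pi> | \<pi> \<in> families I id \<and> nonintersecting I \<pi>. family_weight I \<pi>)"
  proof (rule sum.reindex_bij_witness[of _ "Pair id" snd])
    fix x assume "x \<in> ?N"
    then obtain \<sigma> \<pi> where x: "x = (\<sigma>, \<pi>)" and *: "\<sigma> permutes I" "\<pi> \<in> families I \<sigma>" "nonintersecting I \<pi>"
      by auto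
    have id: "\<sigma> = id" using nonintersecting_imp_id[OF *(1) I *(2,3)] .
    show "(id, snd x) = x" using x id by simp
    show "snd x \<in> {\<pi>. \<pi> \<in> families I id \<and> nonintersecting I \<pi>}" using x id * by simp
    show "family_weight I (snd x) = ?w x" using x id by simp
  qed (auto simp: permutes_id)
  finally show ?thesis by simp
qed

text \<open>A path meeting both outer ones of three successively disjoint paths would make it possible to
  cross the middle one.\<close>

lemma disjoint_trans:
  assumes "i < j" "j < l" "l < n"
    and p: "p \<in> network_paths F i i" and q: "q \<in> network_paths F j j" and r: "r \<in> network_paths F l l"
    and pq: "path_verts i p \<inter> path_verts j q = {}" and qr: "path_verts j q \<inter> path_verts l r = {}"
  shows "path_verts i p \<inter> path_verts l r = {}"
proof (rule ccontr)
  assume "path_verts i p \<inter> path_verts l r \<noteq> {}"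
  then obtain v where v: "v \<in> set (awalk_verts (source F i) p)" "v \<in> set (awalk_verts (source F l) r)"
    by (auto simp: path_verts_def)
  have p': "awalk (source F i) p (sink F i)" and q': "awalk (source F j) q (sink F j)"
    and r': "awalk (source F l) r (sink F l)" using p q r by (simp_all add: paths_iff)
  obtain p1 p2 where 1: "p = p1 @ p2" "awalk (source F i) p1 v" "awalk v p2 (sink F i)"
    using awalk_decomp[OF p' v(1)] by blast
  obtain r1 r2 where 2: "r = r1 @ r2" "awalk (source F l) r1 v" "awalk v r2 (sink F l)"
    using awalk_decomp[OF r' v(2)] by blast
  have "awalk (source F i) (p1 @ r2) (sink F l)" using 1 2 awalk_appendI by blast
  then have "set (awalk_verts (source F i) (p1 @ r2)) \<inter> set (awalk_verts (source F j) q) \<noteq> {}"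
    using assms(1-3) q' by (intro crossing[of i j j l]) auto
  moreover have "set (awalk_verts (source F i) (p1 @ r2)) \<subseteq> path_verts i p \<union> path_verts l r"
    using set_awalk_verts_append[OF 1(2) 2(3)] set_awalk_verts_append[OF 1(2,3)]
      set_awalk_verts_append[OF 2(2,3)] 1(1) 2(1) by (auto simp: path_verts_def)
  ultimately show False using pq qr by (auto simp: path_verts_def)
qed

end

section \<open>Words with prescribed descents\<close>

context path_network
begin

text \<open>The relation \<open>desc \<pi> a b\<close> says that \<open>\<pi> a\<close> is above \<open>\<pi> b\<close> in the poset \<open>P(\<pi>)\<close>.\<close>

definition desc :: "(nat \<Rightarrow> 'e list) \<Rightarrow> nat \<Rightarrow> nat \<Rightarrow> bool" where
  "desc \<pi> a b \<longleftrightarrow> b < a \<and> path_verts a (\<pi> a) \<inter> path_verts b (\<pi> b) = {}"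

definition desc_words :: "(nat \<Rightarrow> 'e list) \<Rightarrow> nat set \<Rightarrow> nat list set" where
  "desc_words \<pi> J = {xs \<in> permutations_of_set J. \<forall>p. Suc p < card J \<longrightarrow> desc \<pi> (xs ! p) (xs ! Suc p)}"

definition nondesc_words :: "(nat \<Rightarrow> 'e list) \<Rightarrow> nat set \<Rightarrow> nat list set" where
  "nondesc_words \<pi> J = {xs \<in> permutations_of_set J. \<forall>p. Suc p < card J \<longrightarrow> \<not> desc \<pi> (xs ! p) (xs ! Suc p)}"

text \<open>Nothing is required at the junction of the two parts of the word, between the positions
  \<open>m - 1\<close> and \<open>m\<close>.\<close>

definition cut_words :: "(nat \<Rightarrow> 'e list) \<Rightarrow> nat set \<Rightarrow> nat \<Rightarrow> nat list set" where
  "cut_words \<pi> J m = {xs \<in> permutations_of_set J.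
     (\<forall>p. Suc p < m \<longrightarrow> desc \<pi> (xs ! p) (xs ! Suc p)) \<and>
     (\<forall>p. m \<le> p \<and> Suc p < card J \<longrightarrow> \<not> desc \<pi> (xs ! p) (xs ! Suc p))}"

definition hook_words :: "(nat \<Rightarrow> 'e list) \<Rightarrow> nat set \<Rightarrow> nat \<Rightarrow> nat list set" where
  "hook_words \<pi> J m = {xs \<in> permutations_of_set J.
     (\<forall>p. p < m \<and> Suc p < card J \<longrightarrow> desc \<pi> (xs ! p) (xs ! Suc p)) \<and>
     (\<forall>p. m \<le> p \<and> Suc p < card J \<longrightarrow> \<not> desc \<pi> (xs ! p) (xs ! Suc p))}"

lemma finite_words [simp]:
  "finite (desc_words \<pi> J)" "finite (nondesc_words \<pi> J)" "finite (cut_words \<pi> J m)" "finite (hook_words \<pi> J m)"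
  by (auto simp: desc_words_def nondesc_words_def cut_words_def hook_words_def)

section \<open>Recursion for weighted word counts\<close>

definition cut_sum :: "nat set \<Rightarrow> nat \<Rightarrow> real" where
  "cut_sum J m = (\<Sum>\<pi>\<in>families J id. family_weight J \<pi> * real (card (cut_words \<pi> J m)))"

definition hook_sum :: "nat set \<Rightarrow> nat \<Rightarrow> real" where
  "hook_sum J m = (\<Sum>\<pi>\<in>families J id. family_weight J \<pi> * real (card (hook_words \<pi> J m)))"

lemma cut_sum_0: "cut_sum J 0 = hook_sum J 0"
  by (simp add: cut_sum_def hook_sum_def cut_words_def hook_words_def)

text \<open>Position \<open>m\<close> is the unconstrained junction for the cut
  \<open>Suc m\<close>. A descent there lengthens the descending part, a non-descent leaves it at
  \<open>m\<close>; this is the analogue of \<open>T (Suc m) + T m = E (Suc m)\<close> for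
  permutation matrices.\<close>

lemma cut_sum_Suc:
  assumes "Suc m < card J"
  shows "cut_sum J (Suc m) = hook_sum J (Suc m) + hook_sum J m"
proof -
  have "card (cut_words \<pi> J (Suc m)) = card (hook_words \<pi> J (Suc m)) + card (hook_words \<pi> J m)" for \<pi>
  proof -
    have "cut_words \<pi> J (Suc m) = hook_words \<pi> J (Suc m) \<union> hook_words \<pi> J m"
    proof (intro Set.equalityI subsetI)
      fix xs assume xs: "xs \<in> cut_words \<pi> J (Suc m)"
      show "xs \<in> hook_words \<pi> J (Suc m) \<union> hook_words \<pi> J m"
      proof (cases "desc \<pi> (xs ! m) (xs ! Suc m)")
        case True
        then have "xs \<in> hook_words \<pi> J (Suc m)"
          using xs by (auto simp: cut_words_def hook_words_def elim!: less_SucE)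
        then show ?thesis ..
      next
        case False
        then have "\<not> desc \<pi> (xs ! p) (xs ! Suc p)" if "m \<le> p" "Suc p < card J" for p
          using xs that by (cases "p = m") (auto simp: cut_words_def)
        then have "xs \<in> hook_words \<pi> J m"
          using xs by (auto simp: cut_words_def hook_words_def)
        then show ?thesis ..
      qed
    next
      fix xs assume "xs \<in> hook_words \<pi> J (Suc m) \<union> hook_words \<pi> J m"
      then show "xs \<in> cut_words \<pi> J (Suc m)"
        using assms by (auto simp: cut_words_def hook_words_def)
    qed
    moreover have "hook_words \<pi> J (Suc m) \<inter> hook_words \<pi> J m = {}"
      using assms by (auto simp: hook_words_def)
    ultimately show ?thesis by (simp add: card_Un_disjoint)
  qed
  then show ?thesis by (simp add: cut_sum_def hook_sum_def sum.distrib algebra_simps)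
qed

lemma cut_sum_card:
  assumes "card J = Suc m"
  shows "cut_sum J (Suc m) = hook_sum J m"
proof -
  have "cut_words \<pi> J (Suc m) = hook_words \<pi> J m" for \<pi>
    unfolding cut_words_def hook_words_def assms by auto
  then show ?thesis by (simp add: cut_sum_def hook_sum_def)
qed

text \<open>By \<open>cut_sum_Suc\<close> the partial sums telescope to
  \<open>(-1) ^ M * hook_sum J M\<close>. At \<open>card J\<close> no junction is left, and
  \<open>cut_sum_card\<close> cancels the remainder.\<close>

lemma cut_sum_alternating:
  assumes "card J > 0"
  shows "(\<Sum>m\<le>card J. (-1) ^ m * cut_sum J m) = 0"
proof -
  have part: "(\<Sum>m\<le>M. (-1) ^ m * cut_sum J m) = (-1) ^ M * hook_sum J M" if "M < card J" for M
    using that by (induction M) (auto simp: cut_sum_0 cut_sum_Suc algebra_simps)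
  obtain M where "card J = Suc M" using assms by (cases "card J") auto
  then show ?thesis using part[of M] cut_sum_card[of J M] by simp
qed

text \<open>\<open>I\<close> is the set of the first \<open>m\<close> letters. Since the junction is
  free, the conditions on the two parts are independent.\<close>

lemma card_cut_words:
  assumes fin: "finite J" and "m \<le> card J"
  shows "card (cut_words \<pi> J m) = (\<Sum>I | I \<subseteq> J \<and> card I = m. card (desc_words \<pi> I) * card (nondesc_words \<pi> (J - I)))"
proof -
  let ?D = "SIGMA I:{I. I \<subseteq> J \<and> card I = m}. desc_words \<pi> I \<times> nondesc_words \<pi> (J - I)"
  have "bij_betw (\<lambda>xs. (set (take m xs), take m xs, drop m xs)) (cut_words \<pi> J m) ?D"
  proof (rule bij_betw_byWitness[where f' = "\<lambda>(I, ys, zs). ys @ zs"])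
    show "\<forall>xs\<in>cut_words \<pi> J m. (\<lambda>(I, ys, zs). ys @ zs) (set (take m xs), take m xs, drop m xs) = xs"
      by simp
    show "\<forall>x\<in>?D. (\<lambda>xs. (set (take m xs), take m xs, drop m xs)) ((\<lambda>(I, ys, zs). ys @ zs) x) = x"
      using fin finite_subset
      by (auto simp: desc_words_def permutations_of_set_def distinct_card[symmetric])
    show "(\<lambda>xs. (set (take m xs), take m xs, drop m xs)) ` cut_words \<pi> J m \<subseteq> ?D"
    proof (rule image_subsetI)
      fix xs assume "xs \<in> cut_words \<pi> J m"
      then have xs: "set xs = J" "distinct xs"
        and d: "\<And>p. Suc p < m \<Longrightarrow> desc \<pi> (xs ! p) (xs ! Suc p)"
        and nd: "\<And>p. m \<le> p \<Longrightarrow> Suc p < card J \<Longrightarrow> \<not> desc \<pi> (xs ! p) (xs ! Suc p)"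
        by (auto simp: cut_words_def permutations_of_set_def)
      have len: "length xs = card J" using xs distinct_card by metis
      let ?I = "set (take m xs)"
      have cI: "card ?I = m" using xs len \<open>m \<le> card J\<close> by (simp add: distinct_card)
      have I: "?I \<subseteq> J" using xs(1) set_take_subset by metis
      have dr: "set (drop m xs) = J - ?I"
      proof -
        have "set (take m xs) \<union> set (drop m xs) = J" using xs(1) set_append[of "take m xs" "drop m xs"] by simp
        moreover have "set (take m xs) \<inter> set (drop m xs) = {}"
          using xs(2) distinct_append[of "take m xs" "drop m xs"] by simp
        ultimately show ?thesis by blast
      qed
      have "take m xs \<in> desc_words \<pi> ?I"
        using d xs cI by (auto simp: desc_words_def permutations_of_set_def)
      moreover have "drop m xs \<in> nondesc_words \<pi> (J - ?I)"
      proof -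
        have "card (J - ?I) = card J - m" using I cI fin by (simp add: card_Diff_subset finite_subset)
        then show ?thesis
          using nd xs dr len \<open>m \<le> card J\<close> by (auto simp: nondesc_words_def permutations_of_set_def)
      qed
      ultimately show "(?I, take m xs, drop m xs) \<in> ?D" using I cI by auto
    qed
    show "(\<lambda>(I, ys, zs). ys @ zs) ` ?D \<subseteq> cut_words \<pi> J m"
    proof (rule image_subsetI)
      fix x assume "x \<in> ?D"
      then obtain I ys zs where x: "x = (I, ys, zs)" and I: "I \<subseteq> J" "card I = m"
        and ys: "ys \<in> desc_words \<pi> I" and zs: "zs \<in> nondesc_words \<pi> (J - I)" by auto
      have y: "set ys = I" "distinct ys" and z: "set zs = J - I" "distinct zs"
        using ys zs by (auto simp: desc_words_def nondesc_words_def permutations_of_set_def)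
      have ly: "length ys = m" using y I distinct_card by metis
      have cJ: "card (J - I) = card J - m" using I fin by (simp add: card_Diff_subset finite_subset)
      have "desc \<pi> ((ys @ zs) ! p) ((ys @ zs) ! Suc p)" if "Suc p < m" for p
        using that ys ly I by (simp add: desc_words_def nth_append)
      moreover have "\<not> desc \<pi> ((ys @ zs) ! p) ((ys @ zs) ! Suc p)" if "m \<le> p" "Suc p < card J" for p
      proof -
        have "Suc (p - m) < card (J - I)" using that cJ by linarith
        then have "\<not> desc \<pi> (zs ! (p - m)) (zs ! Suc (p - m))" using zs by (simp add: nondesc_words_def)
        then show ?thesis using that ly by (simp add: nth_append Suc_diff_le)
      qed
      moreover have "ys @ zs \<in> permutations_of_set J"
        using y z I by (auto simp: permutations_of_set_def)
      ultimately show "(\<lambda>(I, ys, zs). ys @ zs) x \<in> cut_words \<pi> J m"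
        unfolding x by (simp add: cut_words_def)
    qed
  qed
  then have "card (cut_words \<pi> J m) = card ?D" by (rule bij_betw_same_card)
  also have "\<dots> = (\<Sum>I | I \<subseteq> J \<and> card I = m. card (desc_words \<pi> I \<times> nondesc_words \<pi> (J - I)))"
    by (rule card_SigmaI) (use fin in auto)
  finally show ?thesis by (simp add: card_cartesian_product)
qed

lemma words_cong:
  assumes "\<And>i. i \<in> I \<Longrightarrow> \<pi> i = \<rho> i"
  shows "desc_words \<pi> I = desc_words \<rho> I" and "nondesc_words \<pi> I = nondesc_words \<rho> I"
proof -
  have "desc \<pi> (xs ! p) (xs ! Suc p) = desc \<rho> (xs ! p) (xs ! Suc p)"
    if "xs \<in> permutations_of_set I" "Suc p < card I" for xs p
  proof -
    have "length xs = card I" "set xs = I"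
      using that by (auto simp: permutations_of_set_def distinct_card)
    then have "xs ! p \<in> I" "xs ! Suc p \<in> I" using that(2) nth_mem by fastforce+
    then show ?thesis using assms by (simp add: desc_def)
  qed
  then show "desc_words \<pi> I = desc_words \<rho> I" and "nondesc_words \<pi> I = nondesc_words \<rho> I"
    by (auto simp: desc_words_def nondesc_words_def)
qed

lemma sum_families_split:
  assumes I: "I \<subseteq> J"
    and f: "\<And>\<pi> \<rho>. (\<And>i. i \<in> I \<Longrightarrow> \<pi> i = \<rho> i) \<Longrightarrow> f \<pi> = f \<rho>"
    and g: "\<And>\<pi> \<rho>. (\<And>i. i \<in> J - I \<Longrightarrow> \<pi> i = \<rho> i) \<Longrightarrow> g \<pi> = g \<rho>"
  shows "(\<Sum>\<pi>\<in>families J id. f \<pi> * g \<pi>) = (\<Sum>\<pi>\<in>families I id. f \<pi>) * ((\<Sum>\<pi>\<in>families (J - I) id. g \<pi>) :: real)"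
proof -
  let ?m = "\<lambda>(\<pi>, \<rho>) i. if i \<in> I then \<pi> i else \<rho> i"
  have "(\<Sum>\<pi>\<in>families I id. f \<pi>) * (\<Sum>\<pi>\<in>families (J - I) id. g \<pi>) =
      (\<Sum>(\<pi>, \<rho>)\<in>families I id \<times> families (J - I) id. f \<pi> * g \<rho>)"
    by (simp only: sum_product sum.cartesian_product)
  also have "\<dots> = (\<Sum>\<pi>\<in>families J id. f \<pi> * g \<pi>)"
  proof (rule sum.reindex_bij_witness[of _ "\<lambda>\<pi>. (restrict \<pi> I, restrict \<pi> (J - I))" ?m])
    fix x assume x: "x \<in> families I id \<times> families (J - I) id"
    obtain \<pi> \<rho> where x': "x = (\<pi>, \<rho>)" by (cases x)
    have p: "\<pi> \<in> families I id" and r: "\<rho> \<in> families (J - I) id" using x x' by auto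
    have "restrict (?m x) I = \<pi>"
      using p x' by (auto simp: families_def fun_eq_iff restrict_def PiE_iff extensional_def)
    moreover have "restrict (?m x) (J - I) = \<rho>"
      using r x' by (auto simp: families_def fun_eq_iff restrict_def PiE_iff extensional_def)
    ultimately show "(restrict (?m x) I, restrict (?m x) (J - I)) = x" using x' by simp
    show "?m x \<in> families J id"
      using p r I x' by (auto simp: families_def PiE_iff extensional_def)
    have "f (?m x) = f \<pi>" by (rule f) (simp add: x')
    moreover have "g (?m x) = g \<rho>" by (rule g) (simp add: x')
    ultimately show "f (?m x) * g (?m x) = (case x of (\<pi>, \<rho>) \<Rightarrow> f \<pi> * g \<rho>)" by (simp add: x')
  next
    fix \<pi> assume p: "\<pi> \<in> families J id"
    show "?m (restrict \<pi> I, restrict \<pi> (J - I)) = \<pi>"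
      using p I by (auto simp: families_def fun_eq_iff restrict_def PiE_iff extensional_def)
    show "(restrict \<pi> I, restrict \<pi> (J - I)) \<in> families I id \<times> families (J - I) id"
      using p I by (auto simp: families_def PiE_iff)
  qed
  finally show ?thesis ..
qed

lemma family_weight_cong: "(\<And>i. i \<in> I \<Longrightarrow> \<pi> i = \<rho> i) \<Longrightarrow> family_weight I \<pi> = family_weight I \<rho>"
  unfolding family_weight_def by (rule prod.cong) auto

text \<open>By \<open>disjoint_trans\<close> descents compose, so a word with descents everywhere
  has pairwise disjoint paths and is strictly decreasing. This leaves the decreasing listing of
  \<open>I\<close> as the only candidate.\<close>

lemma card_desc_words:
  assumes I: "I \<subseteq> {..<n}" and p: "\<pi> \<in> families I id"
  shows "card (desc_words \<pi> I) = of_bool (nonintersecting I \<pi>)"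
proof -
  have fin: "finite I" using I finite_subset by blast
  \<comment> \<open>Membership in \<open>I\<close> is built into the relation because
    \<open>disjoint_trans\<close> applies only to indices below \<open>n\<close> and to members of
    the family; the relation is then transitive without side conditions.\<close>
  let ?D = "\<lambda>a b. desc \<pi> a b \<and> a \<in> I \<and> b \<in> I"
  have trans: "transp ?D"
  proof (rule transpI)
    fix a b c assume ab: "?D a b" and bc: "?D b c"
    then have "path_verts c (\<pi> c) \<inter> path_verts a (\<pi> a) = {}"
      using p I by (intro disjoint_trans[of c b a "\<pi> c" "\<pi> b" "\<pi> a"]) (auto simp: desc_def families_def PiE_iff)
    then show "?D a c" using ab bc by (auto simp: desc_def)
  qed
  have iff: "xs \<in> desc_words \<pi> I \<longleftrightarrow> set xs = I \<and> distinct xs \<and> sorted_wrt ?D xs" for xs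
  proof -
    have "(\<forall>q. Suc q < card I \<longrightarrow> desc \<pi> (xs ! q) (xs ! Suc q)) \<longleftrightarrow> sorted_wrt ?D xs"
      if "set xs = I" "distinct xs"
    proof -
      have "length xs = card I" using that distinct_card by metis
      moreover have "xs ! q \<in> I" "xs ! Suc q \<in> I" if "Suc q < length xs" for q
        using that \<open>set xs = I\<close> nth_mem[of q xs] nth_mem[of "Suc q" xs] by auto
      ultimately show ?thesis
        unfolding sorted_wrt_iff_nth_Suc_transp[OF trans] by auto
    qed
    then show ?thesis by (auto simp: desc_words_def permutations_of_set_def)
  qed
  let ?s = "rev (sorted_list_of_set I)"
  have eq_s: "xs = ?s" if "set xs = I" "sorted_wrt ?D xs" for xs
  proof -
    have "sorted_wrt (\<lambda>a b. b < a) xs"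
      by (rule sorted_wrt_mono_rel[OF _ that(2)]) (simp add: desc_def)
    then have "sorted_wrt (<) (rev xs)" by (simp add: sorted_wrt_rev)
    then have "rev xs = sorted_list_of_set I"
      using that(1) fin by (intro strict_sorted_equal) auto
    then show ?thesis by (metis rev_rev_ident)
  qed
  show ?thesis
  proof (cases "nonintersecting I \<pi>")
    case True
    have "sorted_wrt (\<lambda>a b. b < a) ?s" using fin by (simp add: sorted_wrt_rev)
    then have "sorted_wrt ?D ?s"
    proof (rule sorted_wrt_mono_rel[rotated])
      fix a b assume "a \<in> set ?s" "b \<in> set ?s" "b < a"
      then show "?D a b" using True fin by (auto simp: desc_def nonintersecting_def)
    qed
    then have "desc_words \<pi> I = {?s}"
      using eq_s fin iff by auto
    then show ?thesis using True by simp
  next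
    case False
    then obtain a b where ab: "a \<in> I" "b \<in> I" "b < a" "path_verts a (\<pi> a) \<inter> path_verts b (\<pi> b) \<noteq> {}"
    proof -
      obtain a b where *: "a \<in> I" "b \<in> I" "a \<noteq> b" "path_verts a (\<pi> a) \<inter> path_verts b (\<pi> b) \<noteq> {}"
        using False unfolding nonintersecting_def by blast
      show ?thesis
        using * that[of a b] that[of b a] by (cases "b < a") (auto simp: Int_commute)
    qed
    have "desc_words \<pi> I = {}"
    proof (rule ccontr)
      assume "desc_words \<pi> I \<noteq> {}"
      then obtain xs where xs: "set xs = I" "distinct xs" "sorted_wrt ?D xs" using iff by auto
      obtain i j where ij: "i < length xs" "j < length xs" "xs ! i = a" "xs ! j = b"
        using ab xs(1) by (metis in_set_conv_nth)
      then have "i \<noteq> j" using ab by auto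
      then have "?D a b \<or> ?D b a"
        using sorted_wrt_nth_less[OF xs(3), of i j] sorted_wrt_nth_less[OF xs(3), of j i] ij
        by (cases "i < j") auto
      then show False using ab by (auto simp: desc_def)
    qed
    then show ?thesis using False by simp
  qed
qed

lemma cut_sum_0_nondesc:
  "cut_sum J 0 = (\<Sum>\<pi>\<in>families J id. family_weight J \<pi> * real (card (nondesc_words \<pi> J)))"
  by (simp add: cut_sum_def cut_words_def nondesc_words_def)

text \<open>A family on \<open>J\<close> is a pair of families on \<open>I\<close> and
  \<open>J - I\<close>. On \<open>I\<close>, the existence of the unique descending word singles out
  the nonintersecting families, whose weights sum to a minor.\<close>

lemma cut_sum_eq:
  assumes J: "J \<subseteq> {..<n}" and m: "m \<le> card J"
  shows "cut_sum J m = (\<Sum>I | I \<subseteq> J \<and> card I = m. det_on I path_sum * cut_sum (J - I) 0)"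
proof -
  have fin: "finite J" using J finite_subset by blast
  have "cut_sum J m = (\<Sum>I | I \<subseteq> J \<and> card I = m. \<Sum>\<pi>\<in>families J id.
      (family_weight I \<pi> * real (card (desc_words \<pi> I))) *
      (family_weight (J - I) \<pi> * real (card (nondesc_words \<pi> (J - I)))))"
  proof -
    have fw: "family_weight J \<pi> = family_weight I \<pi> * family_weight (J - I) \<pi>" if "I \<subseteq> J" for I \<pi>
      unfolding family_weight_def using prod.subset_diff[OF that fin] by (simp add: mult.commute)
    have "cut_sum J m = (\<Sum>\<pi>\<in>families J id. \<Sum>I | I \<subseteq> J \<and> card I = m.
      (family_weight I \<pi> * real (card (desc_words \<pi> I))) *
      (family_weight (J - I) \<pi> * real (card (nondesc_words \<pi> (J - I)))))"
      unfolding cut_sum_def card_cut_words[OF fin m] of_nat_sum sum_distrib_left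
      by (intro sum.cong refl) (auto simp: fw)
    then show ?thesis by (simp only: sum.swap[of _ "families J id"])
  qed
  also have "\<dots> = (\<Sum>I | I \<subseteq> J \<and> card I = m. det_on I path_sum * cut_sum (J - I) 0)"
  proof (rule sum.cong[OF refl])
    fix I assume "I \<in> {I. I \<subseteq> J \<and> card I = m}"
    then have I: "I \<subseteq> J" by simp
    have In: "I \<subseteq> {..<n}" using I J by blast
    have finI: "finite I" using I fin finite_subset by blast
    have "(\<Sum>\<pi>\<in>families J id. (family_weight I \<pi> * real (card (desc_words \<pi> I))) *
        (family_weight (J - I) \<pi> * real (card (nondesc_words \<pi> (J - I))))) =
        (\<Sum>\<pi>\<in>families I id. family_weight I \<pi> * real (card (desc_words \<pi> I))) *
        (\<Sum>\<pi>\<in>families (J - I) id. family_weight (J - I) \<pi> * real (card (nondesc_words \<pi> (J - I))))"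
    proof (rule sum_families_split[OF I])
      fix \<pi> \<rho> :: "nat \<Rightarrow> 'e list" assume *: "\<And>i. i \<in> I \<Longrightarrow> \<pi> i = \<rho> i"
      show "family_weight I \<pi> * real (card (desc_words \<pi> I)) = family_weight I \<rho> * real (card (desc_words \<rho> I))"
        using family_weight_cong[of I \<pi> \<rho>] words_cong(1)[of I \<pi> \<rho>] * by simp
    next
      fix \<pi> \<rho> :: "nat \<Rightarrow> 'e list" assume *: "\<And>i. i \<in> J - I \<Longrightarrow> \<pi> i = \<rho> i"
      show "family_weight (J - I) \<pi> * real (card (nondesc_words \<pi> (J - I))) =
          family_weight (J - I) \<rho> * real (card (nondesc_words \<rho> (J - I)))"
        using family_weight_cong[of "J - I" \<pi> \<rho>] words_cong(2)[of "J - I" \<pi> \<rho>] * by simp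
    qed
    also have "(\<Sum>\<pi>\<in>families I id. family_weight I \<pi> * real (card (desc_words \<pi> I))) = det_on I path_sum"
      unfolding lindstroem_gessel_viennot[OF In] using finite_families[OF finI]
      by (intro sum.mono_neutral_cong_right) (auto simp: card_desc_words[OF In])
    finally show "(\<Sum>\<pi>\<in>families J id. (family_weight I \<pi> * real (card (desc_words \<pi> I))) *
        (family_weight (J - I) \<pi> * real (card (nondesc_words \<pi> (J - I))))) =
        det_on I path_sum * cut_sum (J - I) 0" unfolding cut_sum_0_nondesc .
  qed
  finally show ?thesis .
qed

text \<open>\<open>cut_sum_alternating\<close> with \<open>cut_sum_eq\<close> inserted, and
  \<open>alternating_det_per\<close>, are the same relation for two functions of the index set. Its
  term \<open>S = {}\<close> is the value at \<open>J\<close>, and all others involve proper subsets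
  of \<open>J\<close>, so induction gives equality.\<close>

lemma cut_sum_0_eq_per:
  assumes "J \<subseteq> {..<n}"
  shows "cut_sum J 0 = per_on J path_sum"
  using assms
proof (induction "card J" arbitrary: J rule: less_induct)
  case less
  have fin: "finite J" using less(2) finite_subset by blast
  show ?case
  proof (cases "J = {}")
    case True
    then show ?thesis
      by (simp add: cut_sum_def families_def family_weight_def cut_words_def permutations_of_set_empty)
  next
    case False
    let ?g = "\<lambda>c. \<Sum>S\<in>Pow J. (-1) ^ card S * (det_on S path_sum * c (J - S))"
    have "?g (\<lambda>K. cut_sum K 0) = (\<Sum>m\<le>card J. (-1) ^ m * cut_sum J m)"
      unfolding sum_Pow_by_card[OF fin, of "\<lambda>m. (-1) ^ m"]
      by (intro sum.cong refl) (simp add: cut_sum_eq[OF less(2)])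
    also have "\<dots> = 0" using cut_sum_alternating[of J] fin False by (simp add: card_gt_0_iff)
    finally have 1: "?g (\<lambda>K. cut_sum K 0) = 0" .
    have 2: "?g (\<lambda>K. per_on K path_sum) = 0" by (rule alternating_det_per[OF fin False])
    have split: "?g c = c J + (\<Sum>S\<in>Pow J - {{}}. (-1) ^ card S * (det_on S path_sum * c (J - S)))" for c
      using fin by (subst sum.remove[of _ "{}"]) auto
    have "(\<Sum>S\<in>Pow J - {{}}. (-1) ^ card S * (det_on S path_sum * cut_sum (J - S) 0)) =
        (\<Sum>S\<in>Pow J - {{}}. (-1) ^ card S * (det_on S path_sum * per_on (J - S) path_sum))"
    proof (rule sum.cong[OF refl])
      fix S assume "S \<in> Pow J - {{}}"
      then have S: "S \<subseteq> J" "S \<noteq> {}" by auto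
      then have "card (J - S) < card J" using fin by (intro psubset_card_mono) auto
      then have "cut_sum (J - S) 0 = per_on (J - S) path_sum" using less(2) by (intro less(1)) auto
      then show "(-1) ^ card S * (det_on S path_sum * cut_sum (J - S) 0) =
          (-1) ^ card S * (det_on S path_sum * per_on (J - S) path_sum)" by simp
    qed
    then show ?thesis
      using 1 2 split[of "\<lambda>K. cut_sum K 0"] split[of "\<lambda>K. per_on K path_sum"] by linarith
  qed
qed

text \<open>Both sides have the same value at \<open>m = 0\<close>, the permanent, and consecutive
  values add up to the same sum of minors times complementary permanents. The distinguished row 0 is
  the one occurring in the character formula.\<close>

lemma hook_sum_eq:
  assumes "m < n"
  shows "hook_sum {..<n} m = (\<Sum>w | w permutes {..<n}.
    (\<Sum>S | S \<subseteq> {..<n} \<and> 0 \<in> S \<and> card S = Suc m. det_on S (\<lambda>a b. if a = 0 then 1 else of_bool (a = w b))) *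
    (\<Prod>i<n. path_sum i (w i)))"
  using assms
proof (induction m)
  case 0
  have "(\<Sum>S | S \<subseteq> {..<n} \<and> 0 \<in> S \<and> card S = Suc 0.
      det_on S (\<lambda>a b. if a = 0 then 1 else of_bool (a = w b))) = 1" if "w permutes {..<n}" for w
  proof -
    have *: "{S. S \<subseteq> {..<n} \<and> card S = 0} = {{}}"
      using finite_subset[OF _ finite_lessThan] by auto
    show ?thesis
      using det_on_perm_coeffs(1)[OF finite_lessThan that, of 0] 0 unfolding * by simp
  qed
  then show ?case
    using cut_sum_0_eq_per[of "{..<n}"] by (simp add: cut_sum_0[symmetric] per_on_def)
next
  case (Suc m)
  let ?T = "\<lambda>m w. \<Sum>S | S \<subseteq> {..<n} \<and> 0 \<in> S \<and> card S = Suc m.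
    det_on S (\<lambda>a b. if a = 0 then 1 else of_bool (a = w b))"
  let ?E = "\<lambda>m w. \<Sum>S | S \<subseteq> {..<n} \<and> card S = m. det_on S (\<lambda>a b. of_bool (a = w b))"
  let ?P = "\<lambda>w. \<Prod>i<n. path_sum i (w i)"
  have "cut_sum {..<n} (Suc m) = (\<Sum>I | I \<subseteq> {..<n} \<and> card I = Suc m.
      det_on I path_sum * per_on ({..<n} - I) path_sum)"
    using Suc(2) by (subst cut_sum_eq) (auto simp: cut_sum_0_eq_per)
  also have "\<dots> = (\<Sum>I | I \<subseteq> {..<n} \<and> card I = Suc m. \<Sum>w | w permutes {..<n}.
      det_on I (\<lambda>a b. of_bool (a = w b)) * ?P w)"
    by (intro sum.cong refl sum_perms_det_on[symmetric]) auto
  also have "\<dots> = (\<Sum>w | w permutes {..<n}. ?E (Suc m) w * ?P w)"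
    by (subst sum.swap) (simp add: sum_distrib_right)
  also have "\<dots> = (\<Sum>w | w permutes {..<n}. (?T (Suc m) w + ?T m w) * ?P w)"
    using det_on_perm_coeffs(2)[OF finite_lessThan, of _ n 0 m] Suc(2) by (intro sum.cong refl) auto
  also have "\<dots> = (\<Sum>w | w permutes {..<n}. ?T (Suc m) w * ?P w) + hook_sum {..<n} m"
    using Suc by (simp add: algebra_simps sum.distrib)
  finally show ?case using cut_sum_Suc[of m "{..<n}"] Suc(2) by simp
qed

end

section \<open>Tableaux of hook shape\<close>

lemma skeleton_weight_sum:
  "finite A \<Longrightarrow> skeleton_weight F (\<Sum>i\<in>A. mset (f i)) = (\<Prod>i\<in>A. prod_list (map (weight F) (f i)))"
proof (induction A rule: finite_induct)
  case (insert x A)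
  have "skeleton_weight F (mset (f x)) = prod_list (map (weight F) (f x))"
    unfolding skeleton_weight_def mset_map[symmetric] prod_mset_prod_list ..
  then show ?case using insert by (simp add: skeleton_weight_def)
qed (simp add: skeleton_weight_def)

locale hook_network = path_network F n + hook_shape n k m
  for F :: "('v, 'e) network" and n k m
begin

text \<open>A filling of the hook is read as a word by going down the first column and then along the
  first row.\<close>

definition box :: "nat \<Rightarrow> nat \<times> nat" where
  "box p = (if p \<le> m then (m - p, 0) else (0, p - m))"

definition position :: "nat \<times> nat \<Rightarrow> nat" where
  "position b = (if snd b = 0 then m - fst b else m + snd b)"

lemma leg_less: "m < n" and arm_less: "j < k \<Longrightarrow> m + j < n"
  using m k by linarith+

lemma box_in:
  assumes "p < n" shows "box p \<in> young_diagram \<mu>"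
proof -
  have "p - m < k" using assms m k by linarith
  then show ?thesis by (auto simp: box_def in_diagram_hook)
qed

lemma position_less: "b \<in> young_diagram \<mu> \<Longrightarrow> position b < n"
  using leg_less arm_less by (cases b) (auto simp: position_def in_diagram_hook less_imp_diff_less)

lemma box_position: "b \<in> young_diagram \<mu> \<Longrightarrow> box (position b) = b"
  by (cases b) (auto simp: position_def box_def in_diagram_hook)

lemma position_box: "p < n \<Longrightarrow> position (box p) = p"
  by (auto simp: position_def box_def)

definition filling :: "(nat \<Rightarrow> 'e list) \<Rightarrow> nat list \<Rightarrow> nat \<times> nat \<Rightarrow> 'e list" where
  "filling \<pi> xs = restrict (\<lambda>b. \<pi> (xs ! position b)) (young_diagram \<mu>)"

lemma permutations_of_lessThan:
  assumes "xs \<in> permutations_of_set {..<n}"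
  shows "length xs = n" and "set xs = {..<n}" and "distinct xs"
proof -
  show *: "set xs = {..<n}" "distinct xs" using assms by (simp_all add: permutations_of_set_def)
  show "length xs = n" using distinct_card[OF *(2)] *(1) by simp
qed

text \<open>Paths are edge lists, and an empty list would not determine its source. Since sources
  differ from sinks, every path has a first edge, whose tail is its source. Thus the elements of
  \<open>P(\<pi>)\<close>, which are edge lists, can be replaced by indices.\<close>

lemma family_inj:
  assumes p: "\<pi> \<in> families {..<n} id"
  shows "inj_on \<pi> {..<n}"
proof (rule inj_onI)
  fix i j assume ij: "i \<in> {..<n}" "j \<in> {..<n}" "\<pi> i = \<pi> j"
  have "awalk (source F l) (\<pi> l) (sink F l)" if "l < n" for l
    using p that by (auto simp: families_def PiE_iff paths_iff)
  then have wi: "awalk (source F i) (\<pi> i) (sink F i)" and wj: "awalk (source F j) (\<pi> j) (sink F j)"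
    using ij(1,2) by blast+
  have "source F i \<noteq> sink F i" using source_ne_sink[of i i] ij(1) by simp
  then have "\<pi> i \<noteq> []" using wi by (auto simp: awalk_Nil_iff)
  then obtain e es where "\<pi> i = e # es" by (cases "\<pi> i") auto
  then have "source F i = source F j" using wi wj ij(3) by (auto simp: awalk_Cons_iff)
  then show "i = j" using source_inj ij by auto
qed

lemma path_less_iff:
  assumes p: "\<pi> \<in> families {..<n} id" and ab: "a < n" "b < n"
  shows "path_less F (map \<pi> [0..<n]) (\<pi> a) (\<pi> b) \<longleftrightarrow> desc \<pi> b a"
proof
  assume "path_less F (map \<pi> [0..<n]) (\<pi> a) (\<pi> b)"
  then obtain i j where ij: "i < j" "j < n" "\<pi> a = \<pi> i" "\<pi> b = \<pi> j"
    and d: "path_verts i (\<pi> a) \<inter> path_verts j (\<pi> b) = {}"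
    by (auto simp: path_less_def path_verts_def)
  have "a = i" using inj_onD[OF family_inj[OF p] ij(3)] ab ij by simp
  moreover have "b = j" using inj_onD[OF family_inj[OF p] ij(4)] ab ij by simp
  ultimately show "desc \<pi> b a" using ij d by (auto simp: desc_def)
next
  assume "desc \<pi> b a"
  then show "path_less F (map \<pi> [0..<n]) (\<pi> a) (\<pi> b)"
    unfolding path_less_def using ab
    by (intro exI[of _ a] exI[of _ b]) (auto simp: desc_def path_verts_def)
qed

text \<open>The reading order makes every adjacency of boxes one of consecutive letters. Going down
  a column turns an increase upwards into a descent at a position below \<open>m\<close>; along the
  row, from position \<open>m\<close> on, the condition is the absence of descents. The corner box
  is at position \<open>m\<close> and takes part in both.\<close>

lemma standard_iff:
  assumes p: "\<pi> \<in> families {..<n} id" and xs: "xs \<in> permutations_of_set {..<n}"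
  shows "standard_tableau (path_less F (map \<pi> [0..<n])) \<mu> (filling \<pi> xs) \<longleftrightarrow> xs \<in> hook_words \<pi> {..<n} m"
proof -
  let ?lt = "path_less F (map \<pi> [0..<n])"
  note len = permutations_of_lessThan(1)[OF xs] and set = permutations_of_lessThan(2)[OF xs]
  have x: "xs ! q < n" if "q < n" for q using nth_mem[of q xs] that len set by auto
  have fill: "filling \<pi> xs (box q) = \<pi> (xs ! q)" if "q < n" for q
    using box_in[OF that] position_box[OF that] by (simp add: filling_def)
  have lt: "?lt (filling \<pi> xs (box q)) (filling \<pi> xs (box r)) \<longleftrightarrow> desc \<pi> (xs ! r) (xs ! q)"
    if "q < n" "r < n" for q r
    using path_less_iff[OF p x[OF that(1)] x[OF that(2)]] fill that by simp
  have rows: "(\<forall>i j. (i, j) \<in> young_diagram \<mu> \<and> (i, Suc j) \<in> young_diagram \<mu> \<longrightarrow>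
      \<not> ?lt (filling \<pi> xs (i, Suc j)) (filling \<pi> xs (i, j))) \<longleftrightarrow>
      (\<forall>q. m \<le> q \<and> Suc q < n \<longrightarrow> \<not> desc \<pi> (xs ! q) (xs ! Suc q))" (is "?A \<longleftrightarrow> ?B")
  proof
    assume A: ?A
    show ?B
    proof (intro allI impI)
      fix q assume q: "m \<le> q \<and> Suc q < n"
      have b: "box q = (0, q - m)" "box (Suc q) = (0, Suc (q - m))" using q by (auto simp: box_def Suc_diff_le)
      have "\<not> ?lt (filling \<pi> xs (box (Suc q))) (filling \<pi> xs (box q))"
        using A box_in[of q] box_in[of "Suc q"] q unfolding b by simp
      then show "\<not> desc \<pi> (xs ! q) (xs ! Suc q)" using lt[of "Suc q" q] q by simp
    qed
  next
    assume B: ?B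
    show ?A
    proof (intro allI impI)
      fix i j assume ij: "(i, j) \<in> young_diagram \<mu> \<and> (i, Suc j) \<in> young_diagram \<mu>"
      then have i: "i = 0" and j: "Suc j < k" by (auto simp: in_diagram_hook)
      have b: "box (m + j) = (0, j)" "box (Suc (m + j)) = (0, Suc j)" by (auto simp: box_def)
      have q: "Suc (m + j) < n" "m + j < n" using arm_less[OF j] by simp_all
      then have "\<not> desc \<pi> (xs ! (m + j)) (xs ! Suc (m + j))" using B by simp
      then show "\<not> ?lt (filling \<pi> xs (i, Suc j)) (filling \<pi> xs (i, j))"
        unfolding i b[symmetric] using lt[OF q] by blast
    qed
  qed
  have cols: "(\<forall>i j. (i, j) \<in> young_diagram \<mu> \<and> (Suc i, j) \<in> young_diagram \<mu> \<longrightarrow>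
      ?lt (filling \<pi> xs (i, j)) (filling \<pi> xs (Suc i, j))) \<longleftrightarrow>
      (\<forall>q. q < m \<and> Suc q < n \<longrightarrow> desc \<pi> (xs ! q) (xs ! Suc q))" (is "?A \<longleftrightarrow> ?B")
  proof
    assume A: ?A
    show ?B
    proof (intro allI impI)
      fix q assume q: "q < m \<and> Suc q < n"
      have b: "box q = (Suc (m - Suc q), 0)" "box (Suc q) = (m - Suc q, 0)" using q by (auto simp: box_def)
      have "?lt (filling \<pi> xs (box (Suc q))) (filling \<pi> xs (box q))"
        using A box_in[of q] box_in[of "Suc q"] q unfolding b by simp
      then show "desc \<pi> (xs ! q) (xs ! Suc q)" using lt[of "Suc q" q] q by simp
    qed
  next
    assume B: ?B
    show ?A
    proof (intro allI impI)
      fix i j assume ij: "(i, j) \<in> young_diagram \<mu> \<and> (Suc i, j) \<in> young_diagram \<mu>"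
      then have j: "j = 0" and i: "Suc i \<le> m" by (auto simp: in_diagram_hook)
      let ?q = "m - Suc i"
      have b: "box (Suc ?q) = (i, 0)" "box ?q = (Suc i, 0)" using i by (auto simp: box_def)
      have q: "?q < m" "Suc ?q < n" "?q < n" using i leg_less by auto
      have "desc \<pi> (xs ! ?q) (xs ! Suc ?q)" using B q by blast
      then have "?lt (filling \<pi> xs (box (Suc ?q))) (filling \<pi> xs (box ?q))"
        using lt[OF q(2,3)] by blast
      then show "?lt (filling \<pi> xs (i, j)) (filling \<pi> xs (Suc i, j))"
        unfolding j b .
    qed
  qed
  show ?thesis
    unfolding standard_tableau_def rows cols using xs by (auto simp: hook_words_def)
qed

definition tableau_of :: "(nat \<Rightarrow> 'e list) \<times> nat list \<Rightarrow> 'e multiset \<times> 'e list list \<times> (nat \<times> nat \<Rightarrow> 'e list)" where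
  "tableau_of = (\<lambda>(\<pi>, xs). (\<Sum>i<n. mset (\<pi> i), map \<pi> [0..<n], filling \<pi> xs))"

lemma path_families_map:
  assumes "\<pi> \<in> families {..<n} id"
  shows "map \<pi> [0..<n] \<in> path_families n F (\<Sum>i<n. mset (\<pi> i))"
  using assms by (auto simp: path_families_def families_def PiE_iff intro!: sum.cong)

lemma tableau_of_inj:
  "inj_on tableau_of (SIGMA \<pi>:families {..<n} id. hook_words \<pi> {..<n} m)"
proof (rule inj_onI)
  fix x y assume "x \<in> (SIGMA \<pi>:families {..<n} id. hook_words \<pi> {..<n} m)"
    "y \<in> (SIGMA \<pi>:families {..<n} id. hook_words \<pi> {..<n} m)" and eq: "tableau_of x = tableau_of y"
  then obtain \<pi> xs \<rho> ys where x: "x = (\<pi>, xs)" and y: "y = (\<rho>, ys)"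
    and p: "\<pi> \<in> families {..<n} id" and r: "\<rho> \<in> families {..<n} id"
    and xs: "xs \<in> permutations_of_set {..<n}" and ys: "ys \<in> permutations_of_set {..<n}"
    by (auto simp: hook_words_def)
  have m: "map \<pi> [0..<n] = map \<rho> [0..<n]" and f: "filling \<pi> xs = filling \<rho> ys"
    using eq x y by (auto simp: tableau_of_def)
  have "\<pi> i = \<rho> i" for i
    using m p r by (cases "i < n") (auto simp: families_def PiE_iff extensional_def)
  then have pr: "\<pi> = \<rho>" by blast
  have "xs = ys"
  proof (rule nth_equalityI)
    note lx = permutations_of_lessThan[OF xs] and ly = permutations_of_lessThan[OF ys]
    then show "length xs = length ys" by simp
    fix q assume "q < length xs"
    then have q: "q < n" using lx by simp
    have "filling \<pi> xs (box q) = filling \<pi> ys (box q)" using f pr by simp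
    then have "\<pi> (xs ! q) = \<pi> (ys ! q)"
      using box_in[OF q] position_box[OF q] by (simp add: filling_def)
    moreover have "xs ! q \<in> {..<n}" "ys ! q \<in> {..<n}"
      using q lx ly nth_mem[of q xs] nth_mem[of q ys] by simp_all
    ultimately show "xs ! q = ys ! q" using inj_onD[OF family_inj[OF p]] by blast
  qed
  then show "x = y" using pr x y by simp
qed

lemma tableau_of_image:
  "tableau_of ` (SIGMA \<pi>:families {..<n} id. hook_words \<pi> {..<n} m) = standard_F_tableaux n F \<mu>"
proof (intro Set.equalityI subsetI)
  fix t assume "t \<in> tableau_of ` (SIGMA \<pi>:families {..<n} id. hook_words \<pi> {..<n} m)"
  then obtain \<pi> xs where t: "t = tableau_of (\<pi>, xs)" and p: "\<pi> \<in> families {..<n} id"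
    and w: "xs \<in> hook_words \<pi> {..<n} m" by auto
  have xs: "xs \<in> permutations_of_set {..<n}" using w by (simp add: hook_words_def)
  note len = permutations_of_lessThan(1)[OF xs] and set = permutations_of_lessThan(2)[OF xs]
    and dist = permutations_of_lessThan(3)[OF xs]
  let ?K = "\<Sum>i<n. mset (\<pi> i)"
  have pf: "map \<pi> [0..<n] \<in> path_families n F ?K" by (rule path_families_map[OF p])
  have bij: "bij_betw (filling \<pi> xs) (young_diagram \<mu>) (set (map \<pi> [0..<n]))"
  proof -
    have 1: "bij_betw position (young_diagram \<mu>) {..<n}"
      by (rule bij_betw_byWitness[where f' = box])
        (auto simp: box_position position_box position_less box_in)
    have 2: "bij_betw ((!) xs) {..<n} {..<n}"
      by (rule bij_betw_nth[OF dist]) (simp_all only: len set)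
    have 3: "bij_betw \<pi> {..<n} (set (map \<pi> [0..<n]))"
      using family_inj[OF p] by (auto simp: bij_betw_def)
    have "bij_betw (\<pi> \<circ> ((!) xs \<circ> position)) (young_diagram \<mu>) (set (map \<pi> [0..<n]))"
      using bij_betw_trans[OF bij_betw_trans[OF 1 2] 3] .
    then show ?thesis
      unfolding filling_def by (rule bij_betw_cong[THEN iffD1, rotated]) simp
  qed
  show "t \<in> standard_F_tableaux n F \<mu>"
    unfolding t tableau_of_def standard_F_tableaux_def
    using pf bij standard_iff[OF p xs] w
    by (auto simp: bijective_skeleton_def poset_tableaux_def filling_def)
next
  fix t assume "t \<in> standard_F_tableaux n F \<mu>"
  then obtain K \<pi>' U where t: "t = (K, \<pi>', U)" and pf: "\<pi>' \<in> path_families n F K"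
    and U: "U \<in> extensional (young_diagram \<mu>)" "bij_betw U (young_diagram \<mu>) (set \<pi>')"
    and st: "standard_tableau (path_less F \<pi>') \<mu> U"
    by (auto simp: standard_F_tableaux_def poset_tableaux_def)
  define \<pi> where "\<pi> = restrict (\<lambda>i. \<pi>' ! i) {..<n}"
  have len: "length \<pi>' = n" and K: "K = (\<Sum>i<n. mset (\<pi>' ! i))" and nth: "\<And>i. i < n \<Longrightarrow> \<pi>' ! i \<in> network_paths F i i"
    using pf by (auto simp: path_families_def)
  have p: "\<pi> \<in> families {..<n} id" using nth by (auto simp: \<pi>_def families_def)
  have map: "map \<pi> [0..<n] = \<pi>'" using len by (intro nth_equalityI) (auto simp: \<pi>_def)
  have K': "K = (\<Sum>i<n. mset (\<pi> i))" unfolding K by (intro sum.cong) (auto simp: \<pi>_def)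
  have inj: "inj_on \<pi> {..<n}" by (rule family_inj[OF p])
  have set': "set \<pi>' = \<pi> ` {..<n}" unfolding map[symmetric] by auto
  define f where "f q = inv_into {..<n} \<pi> (U (box q))" for q
  define xs where "xs = map f [0..<n]"
  have f: "f q \<in> {..<n}" "\<pi> (f q) = U (box q)" if "q < n" for q
  proof -
    have "U (box q) \<in> \<pi> ` {..<n}" using U(2) box_in[OF that] set' by (auto simp: bij_betw_def)
    then show "f q \<in> {..<n}" "\<pi> (f q) = U (box q)"
      unfolding f_def by (rule inv_into_into, rule f_inv_into_f)
  qed
  have injf: "inj_on f {..<n}"
  proof (rule inj_onI)
    fix q r assume qr: "q \<in> {..<n}" "r \<in> {..<n}" "f q = f r"
    then have "U (box q) = U (box r)" using f(2)[of q] f(2)[of r] by simp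
    then have "box q = box r"
      using inj_onD[OF bij_betw_imp_inj_on[OF U(2)]] box_in qr by simp
    then show "q = r" using position_box qr by (metis lessThan_iff)
  qed
  have "f ` {..<n} = {..<n}"
    by (rule endo_inj_surj) (use f(1) injf in auto)
  then have xs: "xs \<in> permutations_of_set {..<n}"
    using injf by (auto simp: permutations_of_set_def xs_def distinct_map atLeast0LessThan)
  have fill: "filling \<pi> xs = U"
  proof
    fix b show "filling \<pi> xs b = U b"
    proof (cases "b \<in> young_diagram \<mu>")
      case True
      then have q: "position b < n" by (rule position_less)
      then show ?thesis using True f(2)[OF q] box_position[OF True] by (simp add: filling_def xs_def)
    next
      case False
      then show ?thesis using extensional_arb[OF U(1)] by (simp add: filling_def)
    qed
  qed
  have "xs \<in> hook_words \<pi> {..<n} m"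
    using standard_iff[OF p xs] st unfolding fill map by simp
  then have "(\<pi>, xs) \<in> (SIGMA \<pi>:families {..<n} id. hook_words \<pi> {..<n} m)" using p by simp
  moreover have "tableau_of (\<pi>, xs) = t" by (simp add: tableau_of_def t K' map fill)
  ultimately show "t \<in> tableau_of ` (SIGMA \<pi>:families {..<n} id. hook_words \<pi> {..<n} m)" by blast
qed

lemma sum_tableau_weight:
  "(\<Sum>U\<in>standard_F_tableaux n F \<mu>. tableau_weight F U) = hook_sum {..<n} m"
proof -
  have "(\<Sum>U\<in>standard_F_tableaux n F \<mu>. tableau_weight F U) =
      (\<Sum>(\<pi>, xs)\<in>(SIGMA \<pi>:families {..<n} id. hook_words \<pi> {..<n} m). family_weight {..<n} \<pi>)"
    unfolding tableau_of_image[symmetric] sum.reindex[OF tableau_of_inj]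
    by (intro sum.cong refl)
      (auto simp: tableau_of_def tableau_weight_def skeleton_weight_sum family_weight_def path_weight_def)
  also have "\<dots> = (\<Sum>\<pi>\<in>families {..<n} id. \<Sum>xs\<in>hook_words \<pi> {..<n} m. family_weight {..<n} \<pi>)"
    by (rule sum.Sigma[symmetric]) (auto simp: finite_families)
  finally show ?thesis by (simp add: hook_sum_def mult.commute)
qed

theorem immanant_path_matrix:
  "immanant n (irreducible_character \<mu>) (path_matrix n F) = (\<Sum>U\<in>standard_F_tableaux n F \<mu>. tableau_weight F U)"
proof -
  have "(\<Prod>i<n. path_matrix n F $$ (i, w i)) = (\<Prod>i<n. path_sum i (w i))" if "w permutes {..<n}" for w
    using permutes_in_image[OF that]
    by (intro prod.cong) (auto simp: path_matrix_def path_sum_def path_weight_def)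
  then have "immanant n (irreducible_character \<mu>) (path_matrix n F) = hook_sum {..<n} m"
    unfolding immanant_def hook_sum_eq[OF leg_less]
    by (intro sum.cong refl) (simp add: irreducible_character_hook)
  then show ?thesis by (simp add: sum_tableau_weight)
qed

lemma immanant_path_matrix_nonneg:
  assumes "\<And>e. e \<in> arcs (graph F) \<Longrightarrow> 0 \<le> weight F e"
  shows "0 \<le> immanant n (irreducible_character \<mu>) (path_matrix n F)"
proof -
  have "0 \<le> path_weight p" if "p \<in> network_paths F i j" for p i j
  proof -
    have "set p \<subseteq> arcs (graph F)" using that by (auto simp: paths_iff)
    then show ?thesis unfolding path_weight_def using assms by (intro prod_list_nonneg) auto
  qed
  then have "0 \<le> hook_sum {..<n} m"
    unfolding hook_sum_def family_weight_def
    by (intro sum_nonneg mult_nonneg_nonneg prod_nonneg) (auto simp: families_def PiE_iff)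
  then show ?thesis unfolding immanant_path_matrix sum_tableau_weight .
qed

end

section \<open>Planarity\<close>

text \<open>While \<open>s\<close> runs from 0 to 1, the radius grows from 1 to 2 and the angle
  moves linearly from \<open>\<phi>\<close> to \<open>\<psi>\<close>. The radius determines
  \<open>s\<close>, so two spirals can meet only at equal parameters.\<close>

definition spiral :: "real \<Rightarrow> real \<Rightarrow> real \<Rightarrow> complex" where
  "spiral \<phi> \<psi> s = of_real (1 + s) * cis ((1 - s) * \<phi> + s * \<psi>)"

lemma path_spiral: "path (spiral \<phi> \<psi>)"
  unfolding path_def spiral_def by (intro continuous_intros)

lemma pathstart_spiral [simp]: "pathstart (spiral \<phi> \<psi>) = cis \<phi>"
  by (simp add: pathstart_def spiral_def)

lemma pathfinish_spiral [simp]: "pathfinish (spiral \<phi> \<psi>) = 2 * cis \<psi>"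
  by (simp add: pathfinish_def spiral_def)

lemma path_image_spiral:
  assumes "z \<in> path_image (spiral \<phi> \<psi>)"
  obtains s where "0 \<le> s" "s \<le> 1" "z = spiral \<phi> \<psi> s" "norm z = 1 + s"
proof -
  obtain s where s: "0 \<le> s" "s \<le> 1" "z = spiral \<phi> \<psi> s"
    using assms by (auto simp: path_image_def)
  have "norm (of_real (1 + s) :: complex) = 1 + s" using s(1) unfolding norm_of_real by simp
  then show ?thesis using s by (intro that[of s]) (simp_all add: spiral_def norm_mult)
qed

lemma cis_neq:
  assumes "y < x" "x < y + 2 * pi"
  shows "cis x \<noteq> cis y"
proof
  assume "cis x = cis y"
  then have "cis (x - y) = 1" by (simp add: cis_divide[symmetric])
  then have "cos (x - y) = 1" by (simp add: complex_eq_iff)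
  then obtain k :: int where k: "x - y = real_of_int k * 2 * pi"
    by (auto simp: cos_one_2pi_int)
  have "x - y = real_of_int k * (2 * pi)" using k by (simp only: mult.assoc)
  then have "0 < real_of_int k * (2 * pi)" "real_of_int k * (2 * pi) < 1 * (2 * pi)"
    using assms by linarith+
  then have "0 < real_of_int k" "real_of_int k < 1"
    using zero_less_mult_pos2[of "real_of_int k" "2 * pi"] mult_less_cancel_right_pos[of "2 * pi" "real_of_int k" 1]
    by simp_all
  then show False by simp
qed

text \<open>At a common point the parameters agree, and the difference of the angles is a convex
  combination of two numbers strictly between 0 and \<open>2 * pi\<close>.\<close>

lemma spiral_disjoint:
  assumes "\<phi>' < \<phi>" "\<phi> < \<phi>' + 2 * pi" "\<psi>' < \<psi>" "\<psi> < \<psi>' + 2 * pi"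
  shows "path_image (spiral \<phi> \<psi>) \<inter> path_image (spiral \<phi>' \<psi>') = {}"
proof (rule ccontr)
  assume "path_image (spiral \<phi> \<psi>) \<inter> path_image (spiral \<phi>' \<psi>') \<noteq> {}"
  then obtain z where z: "z \<in> path_image (spiral \<phi> \<psi>)" "z \<in> path_image (spiral \<phi>' \<psi>')" by blast
  obtain s where s: "0 \<le> s" "s \<le> 1" "z = spiral \<phi> \<psi> s" "norm z = 1 + s"
    using path_image_spiral[OF z(1)] .
  obtain s' where s': "z = spiral \<phi>' \<psi>' s'" "norm z = 1 + s'"
    using path_image_spiral[OF z(2)] by metis
  have "of_real (1 + s) \<noteq> (0::complex)" using s(1) unfolding of_real_eq_0_iff by linarith
  then have "cis ((1 - s) * \<phi> + s * \<psi>) = cis ((1 - s) * \<phi>' + s * \<psi>')"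
    using s s' by (simp add: spiral_def)
  moreover have lt: "(1 - s) * a + s * b < (1 - s) * a' + s * b'" if "a < a'" "b < b'" for a b a' b'
  proof (cases "s = 0")
    case False
    then have "s * b < s * b'" using s that by simp
    moreover have "(1 - s) * a \<le> (1 - s) * a'" using s that by (intro mult_left_mono) auto
    ultimately show ?thesis by linarith
  qed (use that in simp)
  have "(1 - s) * \<phi> + s * \<psi> < (1 - s) * (\<phi>' + 2 * pi) + s * (\<psi>' + 2 * pi)"
    by (rule lt) (use assms in auto)
  then have "(1 - s) * \<phi> + s * \<psi> < (1 - s) * \<phi>' + s * \<psi>' + 2 * pi"
    by (simp add: algebra_simps)
  ultimately show False using cis_neq[OF lt[OF assms(1,3)]] by blast
qed

lemma spiral_meets_disc:
  assumes "z \<in> path_image (spiral \<phi> \<psi>)" "norm z \<le> 1"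
  shows "z = cis \<phi>"
proof -
  obtain s where "0 \<le> s" "z = spiral \<phi> \<psi> s" "norm z = 1 + s" using path_image_spiral[OF assms(1)] .
  moreover from this have "s = 0" using assms(2) by simp
  ultimately show ?thesis by (simp add: spiral_def)
qed

text \<open>The curves are prolonged by spirals outside the disc, which move the four endpoints to the
  middles of the sides of a square, so that the Fashoda meet theorem applies.\<close>

lemma crossing_in_disc:
  assumes f: "path f" "path_image f \<subseteq> cball 0 1" "pathstart f = cis a" "pathfinish f = cis c"
    and g: "path g" "path_image g \<subseteq> cball 0 1" "pathstart g = cis b" "pathfinish g = cis d"
    and ord: "b < a" "c < b" "d < c" "a < d + 2 * pi"
  shows "path_image f \<inter> path_image g \<noteq> {}"
proof -
  \<comment> \<open>The Fashoda meet theorem is stated in \<open>real^2\<close>; \<open>T\<close> is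
    the coordinate identification.\<close>
  define T :: "complex \<Rightarrow> real^2" where "T z = Re z *\<^sub>R axis 1 1 + Im z *\<^sub>R axis 2 1" for z
  have T1: "T z $ 1 = Re z" and T2: "T z $ 2 = Im z" for z
    by (simp_all add: T_def axis_def)
  have injT: "inj T" by (rule injI) (metis T1 T2 complex_eqI)
  have contT: "continuous_on S T" for S unfolding T_def by (intro continuous_intros)
  \<comment> \<open>The target angles \<open>pi\<close>, \<open>pi / 2\<close>, \<open>0\<close>,
    \<open>- pi / 2\<close> have the same cyclic order as \<open>a\<close>, \<open>b\<close>,
    \<open>c\<close>, \<open>d\<close>. Thus \<open>f'\<close> runs from the left side to the right
    side of the square and \<open>g'\<close>, in which \<open>g\<close> is reversed, from bottom to
    top.\<close>
  define f' where "f' = reversepath (spiral a pi) +++ f +++ spiral c 0"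
  define g' where "g' = reversepath (spiral d (- pi / 2)) +++ reversepath g +++ spiral b (pi / 2)"
  have pf: "path f'" unfolding f'_def using f by (simp add: path_spiral)
  have pg: "path g'" unfolding g'_def using g by (simp add: path_spiral)
  have imf: "path_image f' = path_image (spiral a pi) \<union> (path_image f \<union> path_image (spiral c 0))"
    unfolding f'_def using f by (simp add: path_image_join)
  have img: "path_image g' = path_image (spiral d (- pi / 2)) \<union> (path_image g \<union> path_image (spiral b (pi / 2)))"
    unfolding g'_def using g by (simp add: path_image_join)
  have sp2: "norm z \<le> 2" if "z \<in> path_image (spiral x y)" for z x y
    using path_image_spiral[OF that] by (metis add_left_mono one_add_one)
  have nf: "norm z \<le> 2" if "z \<in> path_image f'" for z
    using that sp2 f(2) unfolding imf by (fastforce simp: subset_iff)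
  have ng: "norm z \<le> 2" if "z \<in> path_image g'" for z
    using that sp2 g(2) unfolding img by (fastforce simp: subset_iff)
  have box: "T z \<in> cbox (vector [-2, -2]) (vector [2, 2])" if "norm z \<le> 2" for z
    using that abs_Re_le_cmod[of z] abs_Im_le_cmod[of z]
    by (auto simp: mem_box_cart forall_2 T1 T2)
  have "\<exists>z. z \<in> path_image (T \<circ> f') \<and> z \<in> path_image (T \<circ> g')"
  proof (rule fashoda[of "T \<circ> f'" "T \<circ> g'" "vector [-2, -2]" "vector [2, 2]"])
    show "path (T \<circ> f')" "path (T \<circ> g')" using pf pg contT path_continuous_image by blast+
    show "path_image (T \<circ> f') \<subseteq> cbox (vector [-2, -2]) (vector [2, 2])"
      using nf box by (auto simp: path_image_compose)
    show "path_image (T \<circ> g') \<subseteq> cbox (vector [-2, -2]) (vector [2, 2])"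
      using ng box by (auto simp: path_image_compose)
  qed (auto simp: pathstart_compose pathfinish_compose f'_def g'_def T1 T2)
  then obtain z where z: "z \<in> path_image f'" "z \<in> path_image g'"
    using injT by (auto simp: path_image_compose dest: injD)
  have pi: "0 < pi" by simp
  have "path_image (spiral a pi) \<inter> path_image (spiral d (- pi / 2)) = {}"
    by (rule spiral_disjoint) (use ord pi in linarith)+
  moreover have "path_image (spiral a pi) \<inter> path_image (spiral b (pi / 2)) = {}"
    by (rule spiral_disjoint) (use ord pi in linarith)+
  moreover have "path_image (spiral c 0) \<inter> path_image (spiral d (- pi / 2)) = {}"
    by (rule spiral_disjoint) (use ord pi in linarith)+
  moreover have "path_image (spiral b (pi / 2)) \<inter> path_image (spiral c 0) = {}"
    by (rule spiral_disjoint) (use ord pi in linarith)+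
  \<comment> \<open>Spirals belonging to different curves are disjoint, so a common point lies on
    \<open>f\<close> or on \<open>g\<close>, hence in the disc. There a spiral has only its initial
    point, which is an endpoint of \<open>f\<close> or \<open>g\<close>, so the point lies on both
    original curves.\<close>
  ultimately consider "z \<in> path_image f" | "z \<in> path_image g"
    using z unfolding imf img by blast
  then have nz: "norm z \<le> 1" using f(2) g(2) by cases auto
  have "z \<in> path_image f"
    using z(1) unfolding imf using spiral_meets_disc[OF _ nz] f(3,4) pathstart_in_path_image[of f]
      pathfinish_in_path_image[of f] by fastforce
  moreover have "z \<in> path_image g"
    using z(2) unfolding img using spiral_meets_disc[OF _ nz] g(3,4) pathstart_in_path_image[of g]
      pathfinish_in_path_image[of g] by fastforce
  ultimately show ?thesis by blast
qed

text \<open>The curves of the edges are joined. The point \<open>pos u\<close> in the last inclusion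
  accounts for the empty walk, whose curve is constant.\<close>

lemma awalk_curve:
  assumes G: "wf_digraph G" and emb: "disc_embedding G pos \<gamma>" and p: "pre_digraph.awalk G u p v"
  shows "\<exists>g. path g \<and> pathstart g = pos u \<and> pathfinish g = pos v \<and> path_image g \<subseteq> cball 0 1 \<and>
    path_image g \<subseteq> insert (pos u) (\<Union>e\<in>set p. path_image (\<gamma> e))"
  using p
proof (induction p arbitrary: u)
  case Nil
  then have "u = v" "u \<in> verts G" by (auto simp: wf_digraph.awalk_Nil_iff[OF G])
  then show ?case using emb
    by (intro exI[of _ "\<lambda>_. pos u"])
      (auto simp: disc_embedding_def path_def pathstart_def pathfinish_def path_image_def)
next
  case (Cons e p)
  then have e: "e \<in> arcs G" "u = tail G e" and w: "pre_digraph.awalk G (head G e) p v"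
    by (auto simp: wf_digraph.awalk_Cons_iff[OF G])
  obtain g where g: "path g" "pathstart g = pos (head G e)" "pathfinish g = pos v" "path_image g \<subseteq> cball 0 1"
    "path_image g \<subseteq> insert (pos (head G e)) (\<Union>e\<in>set p. path_image (\<gamma> e))"
    using Cons(1)[OF w] by blast
  have \<gamma>: "path (\<gamma> e)" "path_image (\<gamma> e) \<subseteq> cball 0 1" "pathstart (\<gamma> e) = pos u" "pathfinish (\<gamma> e) = pos (head G e)"
    using emb e by (auto simp: disc_embedding_def arc_def)
  have "pos (head G e) \<in> path_image (\<gamma> e)" using \<gamma>(4) pathfinish_in_path_image by metis
  then show ?case
    using g \<gamma> by (intro exI[of _ "\<gamma> e +++ g"]) (auto simp: path_image_join)
qed

text \<open>The curves of the walks meet in some point. If it is the position of a vertex, the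
  embedding puts that vertex on both walks; otherwise it is interior to an edge, and since distinct
  edges meet only in vertices, both walks use the same edge.\<close>

lemma planar_walks_meet:
  assumes G: "wf_digraph G" and emb: "disc_embedding G pos \<gamma>"
    and p: "pre_digraph.awalk G u p v" and q: "pre_digraph.awalk G u' q v'"
    and ends: "pos u = cis a" "pos u' = cis b" "pos v = cis c" "pos v' = cis d"
    and ord: "b < a" "c < b" "d < c" "a < d + 2 * pi"
  shows "set (pre_digraph.awalk_verts G u p) \<inter> set (pre_digraph.awalk_verts G u' q) \<noteq> {}"
proof -
  interpret wf_digraph G by (rule G)
  obtain f where f: "path f" "pathstart f = pos u" "pathfinish f = pos v" "path_image f \<subseteq> cball 0 1"
    "path_image f \<subseteq> insert (pos u) (\<Union>e\<in>set p. path_image (\<gamma> e))"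
    using awalk_curve[OF G emb p] by blast
  obtain g where g: "path g" "pathstart g = pos u'" "pathfinish g = pos v'" "path_image g \<subseteq> cball 0 1"
    "path_image g \<subseteq> insert (pos u') (\<Union>e\<in>set q. path_image (\<gamma> e))"
    using awalk_curve[OF G emb q] by blast
  have "path_image f \<inter> path_image g \<noteq> {}"
    by (rule crossing_in_disc[of f a c g b d]) (use f g ends ord in auto)
  then obtain z where z: "z \<in> path_image f" "z \<in> path_image g" by blast
  have inj: "inj_on pos (verts G)" using emb by (simp add: disc_embedding_def)
  have on: "y \<in> set (awalk_verts x r)"
    if r: "awalk x r w" and y: "y \<in> verts G" and z: "pos y \<in> insert (pos x) (\<Union>e\<in>set r. path_image (\<gamma> e))" for x r w y
  proof (cases "pos y = pos x")
    case True
    have "x \<in> verts G" using r by auto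
    then have "y = x" using inj_onD[OF inj True y] by blast
    then show ?thesis using hd_in_awalk_verts(1)[OF r] by simp
  next
    case False
    then obtain e where e: "e \<in> set r" "pos y \<in> path_image (\<gamma> e)" using z by blast
    have ea: "e \<in> arcs G" using r e by auto
    then have "pos y \<in> {pos (tail G e), pos (head G e)}" using emb e y by (auto simp: disc_embedding_def)
    then have "y = tail G e \<or> y = head G e"
      using inj_onD[OF inj _ y tail_in_verts[OF ea]] inj_onD[OF inj _ y head_in_verts[OF ea]] by blast
    then show ?thesis using set_awalk_verts[OF r] e by auto
  qed
  show ?thesis
  proof (cases "z \<in> pos ` verts G")
    case True
    then obtain y where "y \<in> verts G" "z = pos y" by blast
    then have "y \<in> set (awalk_verts u p)" "y \<in> set (awalk_verts u' q)"
      using on[OF p] on[OF q] subsetD[OF f(5) z(1)] subsetD[OF g(5) z(2)] by blast+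
    then show ?thesis by blast
  next
    case False
    have "u \<in> verts G" "u' \<in> verts G" using p q by auto
    then have "z \<noteq> pos u" "z \<noteq> pos u'" using False by auto
    then obtain e e' where e: "e \<in> set p" "z \<in> path_image (\<gamma> e)" "e' \<in> set q" "z \<in> path_image (\<gamma> e')"
      using z f(5) g(5) by blast
    have "e \<in> arcs G" "e' \<in> arcs G" using p q e by auto
    then have "path_image (\<gamma> e) \<inter> path_image (\<gamma> e') \<subseteq> pos ` verts G" if "e \<noteq> e'"
      using emb that by (simp add: disc_embedding_def)
    then have "e = e'" using e False by blast
    then have "tail G e \<in> set (awalk_verts u p)" "tail G e \<in> set (awalk_verts u' q)"
      using set_awalk_verts[OF p] set_awalk_verts[OF q] e by auto
    then show ?thesis by blast
  qed
qed

lemma planar_path_network: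
  assumes F: "nonneg_planar_network n F"
  shows "path_network F n"
proof -
  interpret fin_digraph "graph F" using F by (simp add: nonneg_planar_network_def)
  obtain pos \<gamma> where emb: "disc_embedding (graph F) pos \<gamma>"
    and cw: "clockwise_on_circle (map pos (map (source F) [0..<n] @ map (sink F) (rev [0..<n])))"
    using F by (auto simp: nonneg_planar_network_def)
  let ?ps = "map pos (map (source F) [0..<n] @ map (sink F) (rev [0..<n]))"
  obtain \<phi> :: "nat \<Rightarrow> real" where \<phi>: "\<And>m. m < 2 * n \<Longrightarrow> ?ps ! m = cis (\<phi> m)"
    and dec: "\<And>l m. l < m \<Longrightarrow> m < 2 * n \<Longrightarrow> \<phi> m < \<phi> l \<and> \<phi> l < \<phi> m + 2 * pi"
    using cw by (auto simp: clockwise_on_circle_def)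
  have src: "pos (source F i) = cis (\<phi> i)" if "i < n" for i
    using \<phi>[of i] that by (simp add: nth_append)
  \<comment> \<open>The boundary list contains the sinks in reverse order after the \<open>n\<close>
    sources, so sink \<open>j\<close> has index \<open>2 * n - 1 - j\<close>.\<close>
  have snk: "pos (sink F j) = cis (\<phi> (2 * n - 1 - j))" if "j < n" for j
  proof -
    have "2 * n - 1 - j - n = n - 1 - j" "\<not> 2 * n - 1 - j < n" using that by linarith+
    moreover have "rev [0..<n] ! (n - 1 - j) = j" using that by (simp add: rev_nth)
    ultimately show ?thesis using \<phi>[of "2 * n - 1 - j"] that by (simp add: nth_append)
  qed
  show ?thesis
  proof unfold_locales
    show "\<nexists>c. cycle c" using F by (simp add: nonneg_planar_network_def)
  next
    fix i j assume ij: "i < n" "j < n" "source F i = source F j"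
    then have eq: "cis (\<phi> i) = cis (\<phi> j)" using src by metis
    show "i = j"
    proof (rule ccontr)
      assume "i \<noteq> j"
      then consider "i < j" | "j < i" by linarith
      then show False
        by cases (use eq dec[of i j] dec[of j i] ij cis_neq[of "\<phi> j" "\<phi> i"] cis_neq[of "\<phi> i" "\<phi> j"] in auto)
    qed
  next
    fix i j assume ij: "i < n" "j < n"
    show "source F i \<noteq> sink F j"
      using src[OF ij(1)] snk[OF ij(2)] dec[of i "2 * n - 1 - j"] ij
        cis_neq[of "\<phi> (2 * n - 1 - j)" "\<phi> i"] by auto
  next
    fix i i' j j' p q
    assume *: "i < i'" "i' < n" "j < j'" "j' < n" "awalk (source F i) p (sink F j')" "awalk (source F i') q (sink F j)"
    show "set (awalk_verts (source F i) p) \<inter> set (awalk_verts (source F i') q) \<noteq> {}"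
    proof (rule planar_walks_meet[OF _ emb *(5,6)])
      show "wf_digraph (graph F)" by unfold_locales
      show "pos (source F i) = cis (\<phi> i)" "pos (source F i') = cis (\<phi> i')" using src * by auto
      show "pos (sink F j') = cis (\<phi> (2 * n - 1 - j'))" "pos (sink F j) = cis (\<phi> (2 * n - 1 - j))"
        using snk * by auto
    qed (use * dec[of i i'] dec[of i' "2 * n - 1 - j'"] dec[of "2 * n - 1 - j'" "2 * n - 1 - j"]
        dec[of i "2 * n - 1 - j"] in auto)
  qed
qed

section \<open>Factorization of totally nonnegative matrices\<close>

text \<open>Weakly monotone selections of rows and columns are allowed; the additional minors vanish.\<close>

definition totnn :: "nat \<Rightarrow> nat \<Rightarrow> (nat \<Rightarrow> nat \<Rightarrow> real) \<Rightarrow> bool" where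
  "totnn p q N \<longleftrightarrow> (\<forall>(s::nat) r c. mono_on {..<s} r \<and> mono_on {..<s} c \<and> r ` {..<s} \<subseteq> {..<p} \<and> c ` {..<s} \<subseteq> {..<q} \<longrightarrow>
     0 \<le> det_on {..<s} (\<lambda>a b. N (r a) (c b)))"

lemma totnnD:
  fixes s :: nat
  assumes "totnn p q N" "mono_on {..<s} r" "mono_on {..<s} c"
    "\<And>a. a < s \<Longrightarrow> r a < p" "\<And>b. b < s \<Longrightarrow> c b < q"
  shows "0 \<le> det_on {..<s} (\<lambda>a b. N (r a) (c b))"
proof -
  have "r ` {..<s} \<subseteq> {..<p}" "c ` {..<s} \<subseteq> {..<q}" using assms(4,5) by auto
  then show ?thesis using assms(1-3) unfolding totnn_def by blast
qed

lemma totnnI: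
  assumes "\<And>(s::nat) r c. mono_on {..<s} r \<Longrightarrow> mono_on {..<s} c \<Longrightarrow>
    (\<And>a. a < s \<Longrightarrow> r a < p) \<Longrightarrow> (\<And>b. b < s \<Longrightarrow> c b < q) \<Longrightarrow> 0 \<le> det_on {..<s} (\<lambda>a b. N (r a) (c b))"
  shows "totnn p q N"
  unfolding totnn_def by (intro allI impI assms) auto

lemma mono_on_comp:
  fixes s p' :: nat
  assumes "mono_on {..<s} r" "mono_on {..<p'} f" "\<And>a. a < s \<Longrightarrow> r a < p'"
  shows "mono_on {..<s} (\<lambda>a. f (r a))"
  using assms(3) by (intro mono_onI mono_onD[OF assms(2)] mono_onD[OF assms(1)]) auto

lemma totnn_submatrix:
  assumes "totnn p q N" "mono_on {..<p'} f" "mono_on {..<q'} g"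
    "\<And>a. a < p' \<Longrightarrow> f a < p" "\<And>b. b < q' \<Longrightarrow> g b < q"
  shows "totnn p' q' (\<lambda>a b. N (f a) (g b))"
proof (rule totnnI)
  fix s :: nat and r c assume rc: "mono_on {..<s} r" "mono_on {..<s} c" "\<And>a. a < s \<Longrightarrow> r a < p'" "\<And>b. b < s \<Longrightarrow> c b < q'"
  show "0 \<le> det_on {..<s} (\<lambda>a b. N (f (r a)) (g (c b)))"
    by (rule totnnD[OF assms(1) mono_on_comp[OF rc(1) assms(2) rc(3)] mono_on_comp[OF rc(2) assms(3) rc(4)]])
      (use assms(4,5) rc(3,4) in auto)
qed

lemma totnn_transpose:
  assumes "totnn p q N" shows "totnn q p (\<lambda>a b. N b a)"
proof (rule totnnI)
  fix s :: nat and r c assume "mono_on {..<s} r" "mono_on {..<s} c" "\<And>a. a < s \<Longrightarrow> r a < q" "\<And>b. b < s \<Longrightarrow> c b < p"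
  then show "0 \<le> det_on {..<s} (\<lambda>a b. N (c b) (r a))"
    using totnnD[OF assms, of s c r] det_on_transpose[of "{..<s}" "\<lambda>a b. N (c a) (r b)"] by simp
qed

lemma totnn_entry:
  assumes "totnn p q N" "i < p" "j < q" shows "0 \<le> N i j"
proof -
  have "0 \<le> det_on {..<Suc 0} (\<lambda>a b. N i j)"
    by (rule totnnD[OF assms(1), of "Suc 0" "\<lambda>_. i" "\<lambda>_. j"]) (use assms in \<open>auto simp: mono_on_def\<close>)
  then show ?thesis using det_on_insert_zero_col[of "{}" "0::nat" "\<lambda>a b. N i j"] by (simp add: lessThan_Suc)
qed

lemma totnn_minor2:
  assumes "totnn p q N" "i < i'" "i' < p" "j < j'" "j' < q"
  shows "N i j' * N i' j \<le> N i j * N i' j'"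
proof -
  let ?r = "\<lambda>a::nat. if a = 0 then i else i'" and ?c = "\<lambda>a::nat. if a = 0 then j else j'"
  have "0 \<le> det_on {..<2} (\<lambda>a b. N (?r a) (?c b))"
    by (rule totnnD[OF assms(1)]) (use assms in \<open>auto intro!: mono_onI\<close>)
  also have "det_on {..<2} (\<lambda>a b. N (?r a) (?c b)) = N i j * N i' j' - N i j' * N i' j"
    unfolding det_on_def numeral_2_eq_2 lessThan_Suc lessThan_0
    by (subst sum_over_permutations_insert) (simp_all add: sign_swap_id permutes_sing)
  finally show ?thesis by simp
qed

text \<open>If row \<open>i\<close> and column \<open>j\<close> both had a positive entry, the 2 by
  2 minor spanned by them and the corner would be negative. The condition \<open>side\<close>
  restricts to the top left and bottom right corners, which lie on the main diagonal of every such
  minor.\<close>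

lemma totnn_corner_zero:
  assumes N: "totnn p q N" and ij: "i < p" "j < q"
    and side: "(\<forall>a<p. a \<noteq> i \<longrightarrow> i < a) \<and> (\<forall>b<q. b \<noteq> j \<longrightarrow> j < b) \<or>
      (\<forall>a<p. a \<noteq> i \<longrightarrow> a < i) \<and> (\<forall>b<q. b \<noteq> j \<longrightarrow> b < j)"
    and z: "N i j = 0"
  shows "(\<forall>b<q. N i b = 0) \<or> (\<forall>a<p. N a j = 0)"
proof (rule ccontr)
  assume "\<not> ?thesis"
  then obtain a b where ab: "a < p" "b < q" "N i b \<noteq> 0" "N a j \<noteq> 0" by blast
  then have ne: "a \<noteq> i" "b \<noteq> j" using z by auto
  have "N i b * N a j \<le> N i j * N a b"
    using side
  proof
    assume "(\<forall>a<p. a \<noteq> i \<longrightarrow> i < a) \<and> (\<forall>b<q. b \<noteq> j \<longrightarrow> j < b)"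
    then show ?thesis using totnn_minor2[OF N, of i a j b] ab ne by auto
  next
    assume "(\<forall>a<p. a \<noteq> i \<longrightarrow> a < i) \<and> (\<forall>b<q. b \<noteq> j \<longrightarrow> b < j)"
    then show ?thesis using totnn_minor2[OF N, of a i b j] ab ne ij by (auto simp: mult.commute)
  qed
  moreover have "0 < N i b" "0 < N a j"
    using totnn_entry[OF N ij(1) ab(2)] totnn_entry[OF N ab(1) ij(2)] ab by auto
  ultimately show False using z by (simp add: mult_le_0_iff)
qed

section \<open>Schur complements of totally nonnegative matrices\<close>

lemma det_schur_first:
  assumes "M 0 0 \<noteq> 0"
  shows "det_on {..<Suc s} M = M 0 0 * det_on {..<s} (\<lambda>a b. M (Suc a) (Suc b) - M (Suc a) 0 * M 0 (Suc b) / M 0 0)"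
proof -
  have "det_on {..<Suc s} M = M 0 0 * det_on (Suc ` {..<s}) (\<lambda>a b. M a b - M a 0 * M 0 b / M 0 0)"
    unfolding lessThan_Suc_eq_insert_0 by (rule det_on_schur) (use assms in auto)
  also have "det_on (Suc ` {..<s}) (\<lambda>a b. M a b - M a 0 * M 0 b / M 0 0) =
      det_on {..<s} (\<lambda>a b. M (Suc a) (Suc b) - M (Suc a) 0 * M 0 (Suc b) / M 0 0)"
    by (rule det_on_reindex) (auto simp: bij_betw_def)
  finally show ?thesis .
qed

lemma det_schur_last:
  assumes "M s s \<noteq> 0"
  shows "det_on {..<Suc s} M = M s s * det_on {..<s} (\<lambda>a b. M a b - M a s * M s b / M s s)"
  unfolding lessThan_Suc by (rule det_on_schur) (use assms in auto)

text \<open>The pivot times a minor of the Schur complement is the minor of \<open>N\<close> with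
  the pivot row and column added; \<open>?e\<close> prepends index 0 to a selection.\<close>

lemma totnn_schur_first:
  assumes N: "totnn (Suc p) (Suc q) N" and pos: "0 < N 0 0"
  shows "totnn p q (\<lambda>a b. N (Suc a) (Suc b) - N (Suc a) 0 * N 0 (Suc b) / N 0 0)"
proof (rule totnnI)
  fix s :: nat and r c assume r: "mono_on {..<s} r" "\<And>a. a < s \<Longrightarrow> r a < p" and c: "mono_on {..<s} c" "\<And>b. b < s \<Longrightarrow> c b < q"
  let ?e = "\<lambda>r. case_nat 0 (\<lambda>a. Suc (r a))"
  have mono: "mono_on {..<Suc s} (?e r)" if "mono_on {..<s} r" for r
    using mono_onD[OF that] by (intro mono_onI) (auto split: nat.splits)
  have "0 \<le> det_on {..<Suc s} (\<lambda>a b. N (?e r a) (?e c b))"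
    by (rule totnnD[OF N mono[OF r(1)] mono[OF c(1)]]) (use r c in \<open>auto split: nat.splits\<close>)
  also have "\<dots> = N 0 0 * det_on {..<s} (\<lambda>a b. N (Suc (r a)) (Suc (c b)) - N (Suc (r a)) 0 * N 0 (Suc (c b)) / N 0 0)"
    by (subst det_schur_first) (use pos in auto)
  finally show "0 \<le> det_on {..<s} (\<lambda>a b. N (Suc (r a)) (Suc (c b)) - N (Suc (r a)) 0 * N 0 (Suc (c b)) / N 0 0)"
    using pos by (simp add: zero_le_mult_iff)
qed

lemma totnn_schur_last:
  assumes N: "totnn (Suc p) (Suc q) N" and pos: "0 < N p q"
  shows "totnn p q (\<lambda>a b. N a b - N a q * N p b / N p q)"
proof (rule totnnI)
  fix s :: nat and r c assume r: "mono_on {..<s} r" "\<And>a. a < s \<Longrightarrow> r a < p" and c: "mono_on {..<s} c" "\<And>b. b < s \<Longrightarrow> c b < q"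
  let ?e = "\<lambda>r p a. if a = s then p else r a"
  have mono: "mono_on {..<Suc s} (?e r p)" if "mono_on {..<s} r" "\<And>a. a < s \<Longrightarrow> r a < p" for r and p :: nat
  proof (rule mono_onI)
    fix a b assume ab: "a \<in> {..<Suc s}" "b \<in> {..<Suc s}" "a \<le> b"
    then consider "b = s" "a = s" | "b = s" "a < s" | "b < s" "a < s" by fastforce
    then show "?e r p a \<le> ?e r p b"
      using that(2) mono_onD[OF that(1)] ab by cases (auto intro: less_imp_le)
  qed
  have "0 \<le> det_on {..<Suc s} (\<lambda>a b. N (?e r p a) (?e c q b))"
    by (rule totnnD[OF N mono[OF r] mono[OF c]]) (use r c in \<open>auto simp: less_Suc_eq\<close>)
  also have "\<dots> = N p q * det_on {..<s} (\<lambda>a b. N (?e r p a) (?e c q b) -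
      N (?e r p a) q * N p (?e c q b) / N p q)"
    by (subst det_schur_last) (use pos in auto)
  also have "det_on {..<s} (\<lambda>a b. N (?e r p a) (?e c q b) - N (?e r p a) q * N p (?e c q b) / N p q) =
      det_on {..<s} (\<lambda>a b. N (r a) (c b) - N (r a) q * N p (c b) / N p q)"
    by (rule det_on_cong) auto
  finally show "0 \<le> det_on {..<s} (\<lambda>a b. N (r a) (c b) - N (r a) q * N p (c b) / N p q)"
    using pos by (simp add: zero_le_mult_iff)
qed

text \<open>A lower bound for the entrywise ratio of the last two rows also bounds the ratio of the two
  maximal minors that use only one of them; induction via the Schur complement of the corner.\<close>

lemma totnn_last_rows_ratio:
  assumes "totnn (Suc (Suc p)) (Suc p) N" and ab: "0 \<le> a" "0 \<le> b"
    and "\<And>j. j \<le> p \<Longrightarrow> b * N p j \<le> a * N (Suc p) j"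
  shows "b * det_on {..<Suc p} N \<le> a * det_on {..<Suc p} (\<lambda>i j. N (if i = p then Suc p else i) j)"
  using assms(1,4)
proof (induction p arbitrary: N)
  case 0
  have "det_on {..<Suc 0} f = f 0 0" for f
    using det_on_insert_zero_col[of "{}" 0 f] by (simp add: lessThan_Suc)
  then show ?case using 0(2)[of 0] by simp
next
  case (Suc p)
  let ?M = "\<lambda>i j. N (if i = Suc p then Suc (Suc p) else i) j"
  have nn: "0 \<le> N i j" if "i < Suc (Suc (Suc p))" "j < Suc (Suc p)" for i j
    using totnn_entry[OF Suc.prems(1)] that by blast
  show ?case
  proof (cases "N 0 0 = 0")
    case True
    have "(\<forall>b<Suc (Suc p). N 0 b = 0) \<or> (\<forall>a<Suc (Suc (Suc p)). N a 0 = 0)"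
      by (rule totnn_corner_zero[OF Suc.prems(1)]) (use True in auto)
    then have "det_on {..<Suc (Suc p)} N = 0 \<and> det_on {..<Suc (Suc p)} ?M = 0"
    proof
      assume "\<forall>b<Suc (Suc p). N 0 b = 0"
      then show ?thesis by (intro conjI det_on_zero_row[of _ 0]) auto
    next
      assume "\<forall>a<Suc (Suc (Suc p)). N a 0 = 0"
      then show ?thesis by (intro conjI det_on_zero_col[of _ 0]) auto
    qed
    then show ?thesis by simp
  next
    case False
    then have d: "0 < N 0 0" using nn[of 0 0] by simp
    let ?X = "\<lambda>i j. N (Suc i) (Suc j) - N (Suc i) 0 * N 0 (Suc j) / N 0 0"
    have X: "totnn (Suc (Suc p)) (Suc p) ?X" by (rule totnn_schur_first[OF Suc.prems(1) d])
    \<comment> \<open>The ratio bound passes to the Schur complement. With denominators cleared and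
      both sides multiplied by \<open>?u\<close>, it follows from the bound in column 0 and from the
      minors \<open>m1\<close> and \<open>m2\<close>. If \<open>?u = 0\<close> this multiplication
      is void, and \<open>m1\<close> or the bound in column \<open>Suc j\<close> is used
      directly.\<close>
    have cond: "b * ?X p j \<le> a * ?X (Suc p) j" if j: "j \<le> p" for j
    proof -
      let ?u = "N (Suc p) 0" and ?u' = "N (Suc (Suc p)) 0" and ?x = "N (Suc p) (Suc j)"
        and ?x' = "N (Suc (Suc p)) (Suc j)" and ?e = "N 0 (Suc j)" and ?d = "N 0 0"
      have n: "0 \<le> ?u" "0 \<le> ?u'" "0 \<le> ?x" "0 \<le> ?x'" "0 \<le> ?e" using nn j by auto
      have c1: "b * ?u \<le> a * ?u'" and c2: "b * ?x \<le> a * ?x'" using Suc.prems(2)[of 0] Suc.prems(2)[of "Suc j"] j by auto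
      have m1: "?x * ?u' \<le> ?u * ?x'" by (rule totnn_minor2[OF Suc.prems(1)]) (use j in auto)
      have m2: "?e * ?u \<le> ?d * ?x" by (rule totnn_minor2[OF Suc.prems(1)]) (use j in auto)
      have m3: "?e * ?u' \<le> ?d * ?x'" by (rule totnn_minor2[OF Suc.prems(1)]) (use j in auto)
      have "b * (?d * ?x - ?e * ?u) \<le> a * (?d * ?x' - ?e * ?u')"
      proof (cases "?u = 0")
        case True
        show ?thesis
        proof (cases "?u' = 0")
          case False
          then have "?x = 0" using m1 True n by (simp add: mult_le_0_iff)
          then show ?thesis using True m3 ab by simp
        next
          case True2: True
          have "?d * (b * ?x) \<le> ?d * (a * ?x')" using c2 d by (intro mult_left_mono) auto
          then show ?thesis using True True2 by (simp add: algebra_simps)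
        qed
      next
        case False
        then have u: "0 < ?u" using n by simp
        have "(?d * ?x - ?e * ?u) * ?u' \<le> (?d * ?x' - ?e * ?u') * ?u"
          using mult_left_mono[OF m1, of ?d] d by (simp add: algebra_simps)
        then have "a * ((?d * ?x - ?e * ?u) * ?u') \<le> a * ((?d * ?x' - ?e * ?u') * ?u)"
          using ab by (intro mult_left_mono)
        moreover have "(?d * ?x - ?e * ?u) * (b * ?u) \<le> (?d * ?x - ?e * ?u) * (a * ?u')"
          using c1 m2 by (intro mult_left_mono) auto
        ultimately have "(b * (?d * ?x - ?e * ?u)) * ?u \<le> (a * (?d * ?x' - ?e * ?u')) * ?u"
          by (simp add: mult.assoc mult.left_commute)
        then show ?thesis using u by simp
      qed
      then have "b * (?d * ?x - ?e * ?u) / ?d \<le> a * (?d * ?x' - ?e * ?u') / ?d"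
        using d by (intro divide_right_mono) auto
      then show ?thesis using d by (simp add: field_simps)
    qed
    have IH: "b * det_on {..<Suc p} ?X \<le> a * det_on {..<Suc p} (\<lambda>i j. ?X (if i = p then Suc p else i) j)"
      by (rule Suc.IH[OF X cond])
    have "det_on {..<Suc (Suc p)} N = N 0 0 * det_on {..<Suc p} ?X"
      by (rule det_schur_first) (use d in auto)
    moreover have "det_on {..<Suc (Suc p)} ?M = N 0 0 * det_on {..<Suc p} (\<lambda>i j. ?X (if i = p then Suc p else i) j)"
    proof -
      have "det_on {..<Suc (Suc p)} ?M = ?M 0 0 * det_on {..<Suc p} (\<lambda>i j. ?M (Suc i) (Suc j) - ?M (Suc i) 0 * ?M 0 (Suc j) / ?M 0 0)"
        by (rule det_schur_first) (use d in auto)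
      also have "\<dots> = N 0 0 * det_on {..<Suc p} (\<lambda>i j. ?X (if i = p then Suc p else i) j)"
        by (intro arg_cong2[where f=times] det_on_cong) auto
      finally show ?thesis .
    qed
    ultimately show ?thesis using mult_left_mono[OF IH, of "N 0 0"] d by (simp add: mult.left_commute)
  qed
qed

text \<open>The inequality on which an elimination step depends: the two determinants omit column 0
  and one of the rows \<open>Suc s\<close> and \<open>s\<close>. If these are the last two rows, the
  2 by 2 minors with column 0 supply the entrywise bounds for \<open>totnn_last_rows_ratio\<close>.
  Otherwise the last row and column are removed by a Schur complement.\<close>

lemma totnn_rows_ratio:
  assumes "totnn (Suc P) (Suc P) N" and "s < P" and "\<And>i. Suc s < i \<Longrightarrow> i \<le> P \<Longrightarrow> N i 0 = 0"
  shows "N (Suc s) 0 * det_on {..<P} (\<lambda>i j. N (if i < Suc s then i else Suc i) (Suc j)) \<le>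
    N s 0 * det_on {..<P} (\<lambda>i j. N (if i < s then i else Suc i) (Suc j))"
  using assms
proof (induction P arbitrary: N)
  case 0
  then show ?case by simp
next
  case (Suc P)
  note N = Suc.prems(1)
  show ?case
  proof (cases "s = P")
    case True
    let ?N = "\<lambda>i j. N i (Suc j)"
    have totnn: "totnn (Suc (Suc P)) (Suc P) ?N"
      by (rule totnn_submatrix[OF N]) (auto intro: mono_onI)
    have "N (Suc P) 0 * det_on {..<Suc P} ?N \<le> N P 0 * det_on {..<Suc P} (\<lambda>i j. ?N (if i = P then Suc P else i) j)"
    proof (rule totnn_last_rows_ratio[OF totnn])
      fix j assume "j \<le> P"
      then show "N (Suc P) 0 * N P (Suc j) \<le> N P 0 * N (Suc P) (Suc j)"
        using totnn_minor2[OF N, of P "Suc P" 0 "Suc j"] by (simp add: mult.commute)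
    qed (auto intro!: totnn_entry[OF N])
    moreover have "det_on {..<Suc P} (\<lambda>i j. N (if i < Suc P then i else Suc i) (Suc j)) = det_on {..<Suc P} ?N"
      by (rule det_on_cong) auto
    moreover have "det_on {..<Suc P} (\<lambda>i j. N (if i < P then i else Suc i) (Suc j)) =
        det_on {..<Suc P} (\<lambda>i j. ?N (if i = P then Suc P else i) j)"
      by (rule det_on_cong) auto
    ultimately show ?thesis using True by simp
  next
    case False
    then have s: "s < P" using Suc.prems(2) by simp
    let ?Q = "Suc P"
    let ?M = "\<lambda>t i j. N (if i < t then i else Suc i) (Suc j)"
    show ?thesis
    proof (cases "N ?Q ?Q = 0")
      case True
      have "(\<forall>b<Suc ?Q. N ?Q b = 0) \<or> (\<forall>a<Suc ?Q. N a ?Q = 0)"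
        by (rule totnn_corner_zero[OF N]) (use True in auto)
      then have "det_on {..<?Q} (?M t) = 0" if "t \<le> P" for t
      proof
        assume "\<forall>b<Suc ?Q. N ?Q b = 0"
        then show ?thesis using that by (intro det_on_zero_row[of _ P]) auto
      next
        assume "\<forall>a<Suc ?Q. N a ?Q = 0"
        then show ?thesis using that by (intro det_on_zero_col[of _ P]) auto
      qed
      from this[of s] this[of "Suc s"] show ?thesis using s by simp
    next
      case False
      then have pos: "0 < N ?Q ?Q" using totnn_entry[OF N, of ?Q ?Q] by simp
      let ?X = "\<lambda>a b. N a b - N a ?Q * N ?Q b / N ?Q ?Q"
      have X: "totnn ?Q ?Q ?X" by (rule totnn_schur_last[OF N pos])
      \<comment> \<open>Because of this zero the Schur complement at the bottom right corner leaves
        column 0 unchanged, so the coefficients and the zero pattern are inherited.\<close>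
      have last0: "N ?Q 0 = 0" using Suc.prems(3)[of ?Q] s by simp
      have det: "det_on {..<?Q} (?M t) = N ?Q ?Q * det_on {..<P} (\<lambda>i j. ?X (if i < t then i else Suc i) (Suc j))"
        if "t \<le> P" for t
        using det_schur_last[of "?M t" P] pos that by simp
      have "?X (Suc s) 0 * det_on {..<P} (\<lambda>i j. ?X (if i < Suc s then i else Suc i) (Suc j)) \<le>
          ?X s 0 * det_on {..<P} (\<lambda>i j. ?X (if i < s then i else Suc i) (Suc j))"
        by (rule Suc.IH[OF X s]) (use Suc.prems(3) last0 in auto)
      then have "N ?Q ?Q * (N (Suc s) 0 * det_on {..<P} (\<lambda>i j. ?X (if i < Suc s then i else Suc i) (Suc j))) \<le>
          N ?Q ?Q * (N s 0 * det_on {..<P} (\<lambda>i j. ?X (if i < s then i else Suc i) (Suc j)))"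
        using pos last0 by (intro mult_left_mono) auto
      then show ?thesis
        using det[of s] det[of "Suc s"] s by (simp add: mult.left_commute)
    qed
  qed
qed

text \<open>One step of Neville elimination in the first column, from the bottom upwards.\<close>

lemma totnn_eliminate:
  assumes A: "totnn p q A" and r: "Suc r < p" and q: "0 < q" and pos: "0 < A r 0"
    and zero: "\<And>i. Suc r < i \<Longrightarrow> i < p \<Longrightarrow> A i 0 = 0"
  shows "totnn p q (\<lambda>i j. if i = Suc r then A (Suc r) j - A (Suc r) 0 / A r 0 * A r j else A i j)"
    (is "totnn p q ?A")
proof (rule totnnI)
  fix s :: nat and \<rho> \<kappa> assume \<rho>: "mono_on {..<s} \<rho>" "\<And>a. a < s \<Longrightarrow> \<rho> a < p"
    and \<kappa>: "mono_on {..<s} \<kappa>" "\<And>b. b < s \<Longrightarrow> \<kappa> b < q"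
  let ?D = "det_on {..<s} (\<lambda>a b. A (\<rho> a) (\<kappa> b))"
  have D: "0 \<le> ?D" by (rule totnnD[OF A \<rho>(1) \<kappa>(1) \<rho>(2) \<kappa>(2)])
  show "0 \<le> det_on {..<s} (\<lambda>a b. ?A (\<rho> a) (\<kappa> b))"
  proof (cases "inj_on \<rho> {..<s}")
    case False
    then obtain a b where "a < s" "b < s" "a \<noteq> b" "\<rho> a = \<rho> b" by (auto simp: inj_on_def)
    then have "det_on {..<s} (\<lambda>a b. ?A (\<rho> a) (\<kappa> b)) = 0"
      by (intro det_on_eq_rows[of _ a b]) auto
    then show ?thesis by simp
  next
    case inj: True
    have less: "\<rho> a < \<rho> b" if "a < b" "b < s" for a b
      using mono_onD[OF \<rho>(1), of a b] inj_onD[OF inj, of a b] that by (auto simp: le_less)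
    show ?thesis
    proof (cases "\<exists>t<s. \<rho> t = Suc r")
      case False
      then have "det_on {..<s} (\<lambda>a b. ?A (\<rho> a) (\<kappa> b)) = ?D" by (intro det_on_cong) auto
      then show ?thesis using D by simp
    next
      case True
      then obtain t where t: "t < s" "\<rho> t = Suc r" by blast
      have t_iff: "\<rho> a = Suc r \<longleftrightarrow> a = t" if "a < s" for a
        using inj_onD[OF inj, of a t] t that by auto
      let ?D' = "det_on {..<s} (\<lambda>a b. if a = t then A r (\<kappa> b) else A (\<rho> a) (\<kappa> b))"
      have "det_on {..<s} (\<lambda>a b. ?A (\<rho> a) (\<kappa> b)) = det_on {..<s} (\<lambda>a b. if a = t
          then A (Suc r) (\<kappa> b) + (- (A (Suc r) 0 / A r 0)) * A r (\<kappa> b) else A (\<rho> a) (\<kappa> b))"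
        by (rule det_on_cong) (auto simp: t_iff)
      also have "\<dots> = det_on {..<s} (\<lambda>a b. if a = t then A (Suc r) (\<kappa> b) else A (\<rho> a) (\<kappa> b)) +
          (- (A (Suc r) 0 / A r 0)) * ?D'"
        by (rule det_on_add_row) (use t in auto)
      also have "det_on {..<s} (\<lambda>a b. if a = t then A (Suc r) (\<kappa> b) else A (\<rho> a) (\<kappa> b)) = ?D"
        by (rule det_on_cong) (auto simp: t(2))
      finally have det: "det_on {..<s} (\<lambda>a b. ?A (\<rho> a) (\<kappa> b)) = ?D - A (Suc r) 0 / A r 0 * ?D'" by simp
      \<comment> \<open>By linearity in row \<open>t\<close> the new minor is \<open>?D\<close>
        minus a multiple of \<open>?D'\<close>, in which row \<open>r\<close> replaces row
        \<open>Suc r\<close>. If row \<open>r\<close> is selected as well, \<open>?D'\<close> has a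
        repeated row.\<close>
      have "A (Suc r) 0 * ?D' \<le> A r 0 * ?D"
      proof (cases "\<exists>u<s. \<rho> u = r")
        case True
        then obtain u where u: "u < s" "\<rho> u = r" by blast
        then have "?D' = 0" using t by (intro det_on_eq_rows[of _ t u]) auto
        then show ?thesis using D pos by simp
      next
        case False
        \<comment> \<open>The selection is enlarged by row \<open>r\<close>, placed just before
          \<open>Suc r\<close> at position \<open>t\<close>, and by column 0 in front. Column 0 may
          already be selected; weakly monotone selections allow the repetition. Omitting row
          \<open>Suc t\<close> or \<open>t\<close> of \<open>?N\<close> and its first column returns
          \<open>?D'\<close> and \<open>?D\<close>.\<close>
        let ?r = "\<lambda>i. if i < t then \<rho> i else if i = t then r else \<rho> (i - 1)"
        let ?c = "case_nat 0 \<kappa>"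
        let ?N = "\<lambda>i j. A (?r i) (?c j)"
        have below: "\<rho> a < r" if "a < t" for a
          using less[OF that t(1)] t False that by (metis less_Suc_eq order_less_trans)
        have above: "Suc r < \<rho> a" if "t < a" "a < s" for a
          using less[OF that] t by simp
        have monor: "mono_on {..<Suc s} ?r"
        proof (rule mono_onI)
          fix a b assume ab: "a \<in> {..<Suc s}" "b \<in> {..<Suc s}" "a \<le> b"
          consider "b < t" | "a < t" "b = t" | "a < t" "t < b" | "a = t" "b = t" | "a = t" "t < b" | "t < a"
            using ab(3) by linarith
          then show "?r a \<le> ?r b"
          proof cases
            case 1 then show ?thesis using mono_onD[OF \<rho>(1), of a b] ab t by auto
          next
            case 2 then show ?thesis using below[of a] by auto
          next
            case 3 then show ?thesis using mono_onD[OF \<rho>(1), of a "b - 1"] ab t by auto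
          next
            case 5
            then have "b - 1 \<in> {..<s}" "t \<in> {..<s}" "t \<le> b - 1" using ab t by auto
            then have "\<rho> t \<le> \<rho> (b - 1)" by (intro mono_onD[OF \<rho>(1)])
            then have "r \<le> \<rho> (b - 1)" using t by simp
            then show ?thesis using 5 by auto
          next
            case 6 then show ?thesis using mono_onD[OF \<rho>(1), of "a - 1" "b - 1"] ab t by auto
          qed auto
        qed
        have monoc: "mono_on {..<Suc s} ?c"
          using mono_onD[OF \<kappa>(1)] by (intro mono_onI) (auto split: nat.splits)
        have rp: "?r i < p" if "i < Suc s" for i
        proof -
          have "i - 1 < s \<or> i = 0" using that by linarith
          then show ?thesis using \<rho>(2)[of i] \<rho>(2)[of "i - 1"] t r by auto
        qed
        have N: "totnn (Suc s) (Suc s) ?N"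
          by (rule totnn_submatrix[OF A monor monoc rp]) (use \<kappa>(2) q in \<open>auto split: nat.splits\<close>)
        have "?N (Suc t) 0 * det_on {..<s} (\<lambda>i j. ?N (if i < Suc t then i else Suc i) (Suc j)) \<le>
            ?N t 0 * det_on {..<s} (\<lambda>i j. ?N (if i < t then i else Suc i) (Suc j))"
        proof (rule totnn_rows_ratio[OF N t(1)])
          fix i assume i: "Suc t < i" "i \<le> s"
          then have "t < i - 1" "i - 1 < s" by linarith+
          then show "?N i 0 = 0" using zero above[of "i - 1"] \<rho>(2)[of "i - 1"] i by auto
        qed
        moreover have "det_on {..<s} (\<lambda>i j. ?N (if i < Suc t then i else Suc i) (Suc j)) = ?D'"
          by (rule det_on_cong) auto
        moreover have "det_on {..<s} (\<lambda>i j. ?N (if i < t then i else Suc i) (Suc j)) = ?D"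
          by (rule det_on_cong) auto
        ultimately show ?thesis using t by simp
      qed
      then show ?thesis unfolding det using pos by (simp add: field_simps)
    qed
  qed
qed

text \<open>A matrix is recorded as the transfer matrix of one layer of a planar network: its nonzero
  entries are edges that do not cross.\<close>

definition noncrossing :: "nat \<Rightarrow> nat \<Rightarrow> (nat \<Rightarrow> nat \<Rightarrow> real) \<Rightarrow> bool" where
  "noncrossing p q B \<longleftrightarrow> (\<forall>i<p. \<forall>j<q. 0 \<le> B i j) \<and>
     (\<forall>i i' j j'. i < i' \<and> i' < p \<and> j < q \<and> j' < q \<and> B i j \<noteq> 0 \<and> B i' j' \<noteq> 0 \<longrightarrow> j \<le> j')"

lemma noncrossingD:
  assumes "noncrossing p q B" "i < i'" "i' < p" "j < q" "j' < q" "B i j \<noteq> 0" "B i' j' \<noteq> 0"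
  shows "j \<le> j'"
  using assms unfolding noncrossing_def by blast

lemma noncrossing_transpose:
  assumes "noncrossing p q B" shows "noncrossing q p (\<lambda>i j. B j i)"
  unfolding noncrossing_def
proof (intro conjI allI impI)
  show "0 \<le> B j i" if "i < q" "j < p" for i j using assms that by (auto simp: noncrossing_def)
  fix i i' j j' assume *: "i < i' \<and> i' < q \<and> j < p \<and> j' < p \<and> B j i \<noteq> 0 \<and> B j' i' \<noteq> 0"
  show "j \<le> j'"
  proof (rule ccontr)
    assume "\<not> j \<le> j'"
    then have "i' \<le> i" using * noncrossingD[OF assms, of j' j i' i] by simp
    then show False using * by simp
  qed
qed

text \<open>The factors may be rectangular of varying inner size, so that inserting a zero row or
  column is also a factor.\<close>

inductive factors :: "nat \<Rightarrow> nat \<Rightarrow> (nat \<Rightarrow> nat \<Rightarrow> real) \<Rightarrow> bool" where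
  single: "noncrossing p q B \<Longrightarrow> factors p q B"
| mult: "noncrossing p q B \<Longrightarrow> factors q r A \<Longrightarrow>
    (\<And>i j. i < p \<Longrightarrow> j < r \<Longrightarrow> C i j = (\<Sum>l<q. B i l * A l j)) \<Longrightarrow> factors p r C"

lemma noncrossing_cong:
  assumes "\<And>i j. i < p \<Longrightarrow> j < q \<Longrightarrow> A i j = A' i j"
  shows "noncrossing p q A \<longleftrightarrow> noncrossing p q A'"
proof -
  have "noncrossing p q A'"
    if A: "noncrossing p q A" and eq: "\<And>i j. i < p \<Longrightarrow> j < q \<Longrightarrow> A' i j = A i j" for A A' :: "nat \<Rightarrow> nat \<Rightarrow> real"
    unfolding noncrossing_def
  proof (intro conjI allI impI)
    show "0 \<le> A' i j" if "i < p" "j < q" for i j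
      using A eq[OF that] that by (simp add: noncrossing_def)
    fix i i' j j' assume "i < i' \<and> i' < p \<and> j < q \<and> j' < q \<and> A' i j \<noteq> 0 \<and> A' i' j' \<noteq> 0"
    then show "j \<le> j'" using noncrossingD[OF A, of i i' j j'] eq[of i j] eq[of i' j'] by simp
  qed
  from this[of A A'] this[of A' A] show ?thesis using assms by auto
qed

lemma factors_cong:
  assumes "factors p q A" "\<And>i j. i < p \<Longrightarrow> j < q \<Longrightarrow> A i j = A' i j"
  shows "factors p q A'"
  using assms
proof (induction arbitrary: A' rule: factors.induct)
  case (single p q B)
  then show ?case using noncrossing_cong[of p q B A'] factors.single by blast
next
  case (mult p q B r A C)
  show ?case
  proof (rule factors.mult[OF mult.hyps(1,2)])
    fix i j assume "i < p" "j < r"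
    then show "A' i j = (\<Sum>l<q. B i l * A l j)" using mult.hyps(3)[of i j] mult.prems[of i j] by simp
  qed
qed

lemma factors_mult:
  assumes "factors p q A" "factors q r A'"
    "\<And>i j. i < p \<Longrightarrow> j < r \<Longrightarrow> C i j = (\<Sum>l<q. A i l * A' l j)"
  shows "factors p r C"
  using assms
proof (induction arbitrary: C rule: factors.induct)
  case (single p q B)
  show ?case by (rule factors.mult[OF single]) auto
next
  case (mult p q' B q A0 C0)
  let ?D = "\<lambda>i j. \<Sum>l<q. A0 i l * A' l j"
  have D: "factors q' r ?D" by (rule mult.IH[OF mult.prems(1)]) simp
  show ?case
  proof (rule factors.mult[OF mult.hyps(1) D])
    fix i j assume ij: "i < p" "j < r"
    have "C i j = (\<Sum>l<q. (\<Sum>h<q'. B i h * A0 h l) * A' l j)"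
      using mult.prems(2)[OF ij] mult.hyps(3)[OF ij(1)] by simp
    also have "\<dots> = (\<Sum>h<q'. B i h * ?D h j)"
      by (simp add: sum_distrib_left sum_distrib_right mult.assoc) (rule sum.swap)
    finally show "C i j = (\<Sum>h<q'. B i h * ?D h j)" .
  qed
qed

lemma factors_transpose:
  assumes "factors p q A" shows "factors q p (\<lambda>i j. A j i)"
  using assms
proof (induction rule: factors.induct)
  case (single p q B)
  then show ?case by (rule factors.single[OF noncrossing_transpose])
next
  case (mult p q B r A C)
  show ?case
  proof (rule factors_mult[OF mult.IH factors.single[OF noncrossing_transpose[OF mult.hyps(1)]]])
    fix i j assume "i < r" "j < p"
    then have "C j i = (\<Sum>l<q. B j l * A l i)" by (rule mult.hyps(3)[rotated])
    also have "\<dots> = (\<Sum>l<q. A l i * B j l)" by (intro sum.cong refl mult.commute)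
    finally show "C j i = (\<Sum>l<q. A l i * B j l)" .
  qed
qed

definition block_sum :: "real \<Rightarrow> (nat \<Rightarrow> nat \<Rightarrow> real) \<Rightarrow> nat \<Rightarrow> nat \<Rightarrow> real" where
  "block_sum a A i j = (if i = 0 \<and> j = 0 then a else if i = 0 \<or> j = 0 then 0 else A (i - 1) (j - 1))"

lemma noncrossing_block_sum:
  assumes "noncrossing p q B" "0 \<le> a"
  shows "noncrossing (Suc p) (Suc q) (block_sum a B)"
  unfolding noncrossing_def
proof (intro conjI allI impI)
  show "0 \<le> block_sum a B i j" if "i < Suc p" "j < Suc q" for i j
    using assms that by (auto simp: noncrossing_def block_sum_def)
  fix i i' j j'
  assume *: "i < i' \<and> i' < Suc p \<and> j < Suc q \<and> j' < Suc q \<and> block_sum a B i j \<noteq> 0 \<and> block_sum a B i' j' \<noteq> 0"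
  show "j \<le> j'"
  proof (cases "j = 0")
    case False
    then have f: "i - 1 < i' - 1" "i' - 1 < p" "j - 1 < q" "j' - 1 < q" "B (i - 1) (j - 1) \<noteq> 0" "B (i' - 1) (j' - 1) \<noteq> 0" "j' \<noteq> 0"
      using * by (auto simp: block_sum_def split: if_splits)
    have "j - 1 \<le> j' - 1" by (rule noncrossingD[OF assms(1) f(1-6)])
    then show ?thesis using f(7) by linarith
  qed simp
qed

text \<open>The scalar \<open>a\<close> is placed in the first factor and 1 in all later
  ones.\<close>

lemma factors_block_sum:
  assumes "factors p q A" "0 \<le> a"
  shows "factors (Suc p) (Suc q) (block_sum a A)"
  using assms
proof (induction arbitrary: a rule: factors.induct)
  case (single p q B)
  show ?case by (rule factors.single[OF noncrossing_block_sum[OF single]])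
next
  case (mult p q B r A C)
  have A: "factors (Suc q) (Suc r) (block_sum 1 A)" by (rule mult.IH) simp
  show ?case
  proof (rule factors.mult[OF noncrossing_block_sum[OF mult.hyps(1) mult.prems] A])
    fix i j assume "i < Suc p" "j < Suc r"
    then show "block_sum a C i j = (\<Sum>l<Suc q. block_sum a B i l * block_sum 1 A l j)"
      unfolding sum.lessThan_Suc_shift
      by (cases i; cases j) (auto simp: block_sum_def mult.hyps(3))
  qed
qed

text \<open>\<open>?e\<close> is the increasing enumeration of the rows other than \<open>i\<close>;
  its incidence matrix \<open>?Z\<close> is noncrossing and puts the zero row back.\<close>

lemma factors_remove_row:
  assumes A: "totnn p q A" and i: "i < p" and zero: "\<And>j. j < q \<Longrightarrow> A i j = 0"
    and rest: "\<And>A'. totnn (p - 1) q A' \<Longrightarrow> factors (p - 1) q A'"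
  shows "factors p q A"
proof -
  let ?e = "\<lambda>a. if a < i then a else Suc a"
  let ?Z = "\<lambda>a b. of_bool (a = ?e b) :: real"
  have e: "?e a < p" if "a < p - 1" for a using that i by auto
  have "totnn (p - 1) q (\<lambda>a b. A (?e a) b)"
    by (rule totnn_submatrix[OF A]) (use e in \<open>auto intro!: mono_onI\<close>)
  then have A': "factors (p - 1) q (\<lambda>a b. A (?e a) b)" by (rule rest)
  have Z: "noncrossing p (p - 1) ?Z"
    unfolding noncrossing_def by (auto split: if_splits)
  show ?thesis
  proof (rule factors.mult[OF Z A'])
    fix a j assume a: "a < p" and j: "j < q"
    show "A a j = (\<Sum>l<p - 1. ?Z a l * A (?e l) j)"
    proof (cases "a = i")
      case True
      then show ?thesis using zero[OF j] by (auto intro!: sum.neutral[symmetric])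
    next
      case False
      define b where "b = (if a < i then a else a - 1)"
      have b: "b < p - 1" "?e b = a" using a i False by (auto simp: b_def)
      have "(\<Sum>l<p - 1. ?Z a l * A (?e l) j) = (\<Sum>l<p - 1. if l = b then A (?e l) j else 0)"
      proof (rule sum.cong[OF refl])
        fix l
        have "a = ?e l \<longleftrightarrow> l = b" unfolding b(2)[symmetric] by auto
        then show "?Z a l * A (?e l) j = (if l = b then A (?e l) j else 0)" by simp
      qed
      also have "\<dots> = A (?e b) j" using b(1) by simp
      finally show ?thesis using b(2) by simp
    qed
  qed
qed

text \<open>Termination measure for the elimination in the first column and, after transposition, in
  the first row.\<close>

definition border_support :: "nat \<Rightarrow> nat \<Rightarrow> (nat \<Rightarrow> nat \<Rightarrow> real) \<Rightarrow> nat" where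
  "border_support p q A = card {i. i < p \<and> A i 0 \<noteq> 0} + card {j. j < q \<and> A 0 j \<noteq> 0}"

text \<open>The lowest nonzero entry of column 0 is removed by subtracting \<open>c\<close> times
  the row above. The inverse operation \<open>?B\<close> is an identity matrix with one extra entry
  just below the diagonal, hence noncrossing. Only row \<open>Suc r\<close> changes, so the support
  of row 0 is kept.\<close>

lemma factors_eliminate:
  assumes A: "totnn p q A" and q: "0 < q" and rows: "\<And>i. i < p \<Longrightarrow> \<exists>j<q. A i j \<noteq> 0"
    and i0: "0 < i0" "i0 < p" "A i0 0 \<noteq> 0"
  shows "\<exists>A'. totnn p q A' \<and> (factors p q A' \<longrightarrow> factors p q A) \<and> border_support p q A' < border_support p q A"
proof -
  let ?S = "{i. i < p \<and> A i 0 \<noteq> 0}"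
  have S: "finite ?S" "i0 \<in> ?S" using i0 by auto
  define t where "t = Max ?S"
  have tS: "t \<in> ?S" unfolding t_def using S by (intro Max_in) auto
  have "i0 \<le> t" unfolding t_def using S by (intro Max_ge)
  then obtain r where r: "t = Suc r" using i0(1) by (cases t) auto
  have zero: "A i 0 = 0" if "Suc r < i" "i < p" for i
    using that Max_ge[OF S(1), of i] r t_def by fastforce
  have tp: "Suc r < p" and t0: "A (Suc r) 0 \<noteq> 0" using tS r by auto
  then have tpos: "0 < A (Suc r) 0" using totnn_entry[OF A tp q] by simp
  \<comment> \<open>Row \<open>r\<close> is not zero. If its first entry vanished, a nonzero entry
    further right together with \<open>A (Suc r) 0\<close> would give a negative 2 by 2
    minor.\<close>
  have r0: "A r 0 \<noteq> 0"
  proof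
    assume z: "A r 0 = 0"
    obtain j where j: "j < q" "A r j \<noteq> 0" using rows[of r] tp by auto
    then have "0 < j" using z by (cases j) auto
    then have "A r j * A (Suc r) 0 \<le> A r 0 * A (Suc r) j"
      using j tp by (intro totnn_minor2[OF A]) auto
    moreover have "0 < A r j" using totnn_entry[OF A _ j(1), of r] j(2) tp by simp
    ultimately show False using z tpos by (simp add: mult_le_0_iff)
  qed
  have rpos: "0 < A r 0" using totnn_entry[OF A _ q, of r] r0 tp by simp
  define c where "c = A (Suc r) 0 / A r 0"
  define A' where "A' = (\<lambda>i j. if i = Suc r then A (Suc r) j - c * A r j else A i j)"
  have tnA': "totnn p q A'"
    unfolding A'_def c_def by (rule totnn_eliminate[OF A tp q rpos zero])
  let ?B = "\<lambda>i j. of_bool (i = j) + of_bool (i = Suc r \<and> j = r) * c"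
  have B: "noncrossing p p ?B"
    unfolding noncrossing_def using tpos rpos by (auto simp: c_def)
  have "factors p q A" if F: "factors p q A'"
  proof (rule factors.mult[OF B F])
    fix i j assume i: "i < p"
    have "(\<Sum>l<p. ?B i l * A' l j) = (\<Sum>l<p. (if l = i then A' l j else 0) + (if l = r then of_bool (i = Suc r) * c * A' l j else 0))"
      by (rule sum.cong) auto
    also have "\<dots> = A' i j + of_bool (i = Suc r) * c * A' r j"
      using i tp by (simp add: sum.distrib)
    also have "\<dots> = A i j" by (simp add: A'_def)
    finally show "A i j = (\<Sum>l<p. ?B i l * A' l j)" ..
  qed
  moreover have "border_support p q A' < border_support p q A"
  proof -
    have "{i. i < p \<and> A' i 0 \<noteq> 0} = ?S - {Suc r}"
      using rpos by (auto simp: A'_def c_def)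
    moreover have "card (?S - {Suc r}) < card ?S"
      using S tS r by (intro psubset_card_mono) auto
    ultimately show ?thesis by (simp add: border_support_def A'_def)
  qed
  ultimately show ?thesis using tnA' by blast
qed

text \<open>The inner induction, on \<open>border_support\<close>, at fixed \<open>p + q\<close>. A
  zero row or column reduces the size. Otherwise column 0 or, after transposition, row 0 is
  eliminated, until the corner splits off as a direct summand.\<close>

lemma totnn_factors_step:
  assumes smaller: "\<And>p q A. p + q < x \<Longrightarrow> totnn p q A \<Longrightarrow> factors p q A"
  shows "totnn p q A \<Longrightarrow> p + q = x \<Longrightarrow> factors p q A"
proof (induction "border_support p q A" arbitrary: p q A rule: less_induct)
  case less
  note A = less.prems(1)
  have At: "totnn q p (\<lambda>i j. A j i)" by (rule totnn_transpose[OF A])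
  consider "p = 0 \<or> q = 0"
    | i where "0 < p" "0 < q" "i < p" "\<forall>j<q. A i j = 0"
    | j where "0 < p" "0 < q" "j < q" "\<forall>i<p. A i j = 0"
    | "0 < p" "0 < q" "\<forall>i<p. \<exists>j<q. A i j \<noteq> 0" "\<forall>j<q. \<exists>i<p. A i j \<noteq> 0"
    by blast
  then show ?case
  proof cases
    case 1
    then show ?thesis by (intro factors.single) (auto simp: noncrossing_def)
  next
    case 2
    show ?thesis
      by (rule factors_remove_row[OF A 2(3)]) (use 2 less.prems(2) smaller in auto)
  next
    case 3
    have "factors q p (\<lambda>i j. A j i)"
      by (rule factors_remove_row[OF At 3(3)]) (use 3 less.prems(2) smaller in auto)
    then show ?thesis using factors_transpose by blast
  next
    case 4
    show ?thesis
    proof (cases "\<exists>i. 0 < i \<and> i < p \<and> A i 0 \<noteq> 0")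
      case True
      then obtain i where i: "0 < i" "i < p" "A i 0 \<noteq> 0" by blast
      have rows: "\<exists>j<q. A i j \<noteq> 0" if "i < p" for i using 4(3) that by blast
      obtain A' where "totnn p q A'" "factors p q A' \<longrightarrow> factors p q A" "border_support p q A' < border_support p q A"
        using factors_eliminate[OF A 4(2) rows i] by blast
      then show ?thesis using less.hyps less.prems(2) by blast
    next
      case col: False
      show ?thesis
      proof (cases "\<exists>j. 0 < j \<and> j < q \<and> A 0 j \<noteq> 0")
        case True
        then obtain j where j: "0 < j" "j < q" "A 0 j \<noteq> 0" by blast
        have cols: "\<exists>i<p. A i j \<noteq> 0" if "j < q" for j using 4(4) that by blast
        obtain A' where A': "totnn q p A'" "factors q p A' \<longrightarrow> factors q p (\<lambda>i j. A j i)"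
          "border_support q p A' < border_support q p (\<lambda>i j. A j i)"
          using factors_eliminate[OF At 4(1) cols j] by blast
        have "border_support q p (\<lambda>i j. A j i) = border_support p q A" by (simp add: border_support_def)
        then have "factors q p A'" using less.hyps[OF _ A'(1)] A'(3) less.prems(2) by (simp add: add.commute)
        then show ?thesis using A'(2) factors_transpose[of q p "\<lambda>i j. A j i"] by blast
      next
        case row: False
        obtain p' q' where pq: "p = Suc p'" "q = Suc q'" using 4(1,2) by (metis gr0_implies_Suc)
        have "totnn p' q' (\<lambda>i j. A (Suc i) (Suc j))"
          by (rule totnn_submatrix[OF A]) (use pq in \<open>auto intro!: mono_onI\<close>)
        then have "factors p' q' (\<lambda>i j. A (Suc i) (Suc j))" using smaller less.prems(2) pq by simp
        then have "factors p q (block_sum (A 0 0) (\<lambda>i j. A (Suc i) (Suc j)))"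
          unfolding pq by (rule factors_block_sum) (use totnn_entry[OF A 4(1,2)] in simp)
        then show ?thesis
        proof (rule factors_cong)
          fix i j assume "i < p" "j < q"
          then show "block_sum (A 0 0) (\<lambda>i j. A (Suc i) (Suc j)) i j = A i j"
            using row col by (cases i; cases j) (auto simp: block_sum_def)
        qed
      qed
    qed
  qed
qed

lemma totnn_factors: "totnn p q A \<Longrightarrow> factors p q A"
proof (induction "p + q" arbitrary: p q A rule: less_induct)
  case less
  show ?case by (rule totnn_factors_step[OF _ less.prems refl]) (rule less.hyps)
qed

section \<open>Layered networks\<close>

text \<open>Each layer stores the number of its output vertices with its matrix; the number of
  inputs is the output width of the layer before.\<close>

fun layers :: "nat \<Rightarrow> (nat \<times> (nat \<Rightarrow> nat \<Rightarrow> real)) list \<Rightarrow> nat \<Rightarrow> bool" where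
  "layers p [] q \<longleftrightarrow> p = q"
| "layers p ((w, B) # Ls) q \<longleftrightarrow> noncrossing p w B \<and> layers w Ls q"

fun layer_prod :: "(nat \<times> (nat \<Rightarrow> nat \<Rightarrow> real)) list \<Rightarrow> nat \<Rightarrow> nat \<Rightarrow> real" where
  "layer_prod [] i j = of_bool (i = j)"
| "layer_prod ((w, B) # Ls) i j = (\<Sum>l<w. B i l * layer_prod Ls l j)"

lemma factors_layers:
  assumes "factors p q A"
  shows "\<exists>Ls. Ls \<noteq> [] \<and> layers p Ls q \<and> (\<forall>i<p. \<forall>j<q. A i j = layer_prod Ls i j)"
  using assms
proof (induction rule: factors.induct)
  case (single p q B)
  have "B i j = (\<Sum>l<q. B i l * of_bool (l = j))" if "j < q" for i j
  proof -
    have "(\<Sum>l<q. B i l * of_bool (l = j)) = (\<Sum>l<q. if l = j then B i l else 0)"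
      by (rule sum.cong) auto
    then show ?thesis using that by simp
  qed
  then show ?case using single by (intro exI[of _ "[(q, B)]"]) auto
next
  case (mult p q B r A C)
  then obtain Ls where Ls: "layers q Ls r" "\<forall>i<q. \<forall>j<r. A i j = layer_prod Ls i j" by blast
  show ?case
    using mult.hyps Ls by (intro exI[of _ "(q, B) # Ls"]) (auto intro!: sum.cong)
qed

definition width :: "nat \<Rightarrow> (nat \<times> (nat \<Rightarrow> nat \<Rightarrow> real)) list \<Rightarrow> nat \<Rightarrow> nat" where
  "width p Ls l = (p # map fst Ls) ! l"

lemma layers_nth:
  "layers p Ls q \<Longrightarrow> l < length Ls \<Longrightarrow> noncrossing (width p Ls l) (width p Ls (Suc l)) (snd (Ls ! l))"
proof (induction Ls arbitrary: p l)
  case (Cons L Ls)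
  obtain w B where L: "L = (w, B)" by (cases L)
  have "width p (L # Ls) (Suc l) = width w Ls l" for l by (simp add: width_def L)
  then show ?case using Cons by (cases l) (auto simp: L width_def)
qed simp

text \<open>The vertex \<open>(l, i)\<close> is the point at height \<open>i\<close> of level \<open>l\<close>.\<close>

definition layered_network ::
    "nat \<Rightarrow> (nat \<times> (nat \<Rightarrow> nat \<Rightarrow> real)) list \<Rightarrow> (nat \<times> nat, (nat \<times> nat) \<times> (nat \<times> nat)) network" where
  "layered_network p Ls =
     \<lparr>graph = \<lparr>verts = {(l, i). l \<le> length Ls \<and> i < width p Ls l},
        arcs = {((l, i), (l', j)) | l i l' j. l' = Suc l \<and> l < length Ls \<and> i < width p Ls l \<and>
          j < width p Ls (Suc l) \<and> snd (Ls ! l) i j \<noteq> 0},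
        tail = fst, head = snd\<rparr>,
      source = (\<lambda>i. (0, i)), sink = (\<lambda>j. (length Ls, j)),
      weight = (\<lambda>e. snd (Ls ! fst (fst e)) (snd (fst e)) (snd (snd e)))\<rparr>"

context
  fixes n :: nat and Ls :: "(nat \<times> (nat \<Rightarrow> nat \<Rightarrow> real)) list"
  assumes layers: "layers n Ls n" and ne: "Ls \<noteq> []"
begin

abbreviation "LN \<equiv> layered_network n Ls"

lemma LN_simps:
  "tail (graph LN) = fst" "head (graph LN) = snd" "source LN i = (0, i)" "sink LN j = (length Ls, j)"
  "(l, i) \<in> verts (graph LN) \<longleftrightarrow> l \<le> length Ls \<and> i < width n Ls l"
  "((l, i), (l', j)) \<in> arcs (graph LN) \<longleftrightarrow> l' = Suc l \<and> l < length Ls \<and> i < width n Ls l \<and>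
     j < width n Ls (Suc l) \<and> snd (Ls ! l) i j \<noteq> 0"
  "weight LN ((l, i), v) = snd (Ls ! l) i (snd v)"
  by (auto simp: layered_network_def)

lemma fin_LN: "fin_digraph (graph LN)"
proof
  have v: "verts (graph LN) = (SIGMA l:{..length Ls}. {..<width n Ls l})"
    by (auto simp: layered_network_def)
  then show fv: "finite (verts (graph LN))" by simp
  show t: "tail (graph LN) e \<in> verts (graph LN)" if "e \<in> arcs (graph LN)" for e
    using that by (cases e) (auto simp: LN_simps)
  show h: "head (graph LN) e \<in> verts (graph LN)" if "e \<in> arcs (graph LN)" for e
    using that by (cases e) (auto simp: LN_simps)
  have "arcs (graph LN) \<subseteq> verts (graph LN) \<times> verts (graph LN)"
  proof
    fix e assume e: "e \<in> arcs (graph LN)"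
    show "e \<in> verts (graph LN) \<times> verts (graph LN)"
      using t[OF e] h[OF e] by (cases e) (auto simp: LN_simps)
  qed
  then show "finite (arcs (graph LN))" using fv finite_subset by blast
qed

interpretation LG: fin_digraph "graph LN" by (rule fin_LN)

text \<open>Every edge raises the level by one. This gives acyclicity, and it keeps two walks
  between the same levels in step.\<close>

lemma LN_walk_level: "LG.awalk u p v \<Longrightarrow> fst v = fst u + length p"
proof (induction p arbitrary: u)
  case (Cons e p)
  obtain l i l' j where e: "e = ((l, i), (l', j))" by (metis surj_pair)
  from Cons.prems have "e \<in> arcs (graph LN)" "u = fst e" "LG.awalk (snd e) p v"
    by (auto simp: LG.awalk_Cons_iff LN_simps)
  then show ?case using Cons.IH[of "snd e"] e by (simp add: LN_simps)
qed (simp add: LG.awalk_Nil_iff)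

lemma LN_Cons:
  assumes "LG.awalk (l, i) (e # p) v"
  obtains i' where "e = ((l, i), (Suc l, i'))" "l < length Ls" "i < width n Ls l" "i' < width n Ls (Suc l)"
    "snd (Ls ! l) i i' \<noteq> 0" "LG.awalk (Suc l, i') p v"
proof -
  have e: "e \<in> arcs (graph LN)" "fst e = (l, i)" "LG.awalk (snd e) p v"
    using assms by (auto simp: LG.awalk_Cons_iff LN_simps)
  obtain l' i' where s: "snd e = (l', i')" by (cases "snd e")
  have "e = ((l, i), (l', i'))" using e(2) s by (cases e) simp
  then show thesis using that[of i'] e by (simp add: LN_simps)
qed

text \<open>In one layer, edges leaving distinct heights do not reverse their order, since edges are
  nonzero entries of a noncrossing matrix. So the heights stay in order level by level until the
  walks meet, and the reversed order at the end forces a meeting.\<close>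

lemma LN_crossing:
  "LG.awalk (l, a) p (length Ls, j') \<Longrightarrow> LG.awalk (l, b) q (length Ls, j) \<Longrightarrow> a < b \<Longrightarrow> j < j' \<Longrightarrow>
    set (LG.awalk_verts (l, a) p) \<inter> set (LG.awalk_verts (l, b) q) \<noteq> {}"
proof (induction p arbitrary: l a b q)
  case Nil
  have "q = []" using LN_walk_level[OF Nil.prems(1)] LN_walk_level[OF Nil.prems(2)] by simp
  then show ?case using Nil by (simp add: LG.awalk_Nil_iff)
next
  case (Cons e p)
  have "length q = Suc (length p)"
    using LN_walk_level[OF Cons.prems(1)] LN_walk_level[OF Cons.prems(2)] by simp
  then obtain e' q' where q: "q = e' # q'" by (cases q) auto
  obtain a' where a: "e = ((l, a), (Suc l, a'))" "l < length Ls" "a < width n Ls l" "a' < width n Ls (Suc l)"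
    "snd (Ls ! l) a a' \<noteq> 0" "LG.awalk (Suc l, a') p (length Ls, j')"
    by (rule LN_Cons[OF Cons.prems(1)])
  obtain b' where b: "e' = ((l, b), (Suc l, b'))" "b < width n Ls l" "b' < width n Ls (Suc l)"
    "snd (Ls ! l) b b' \<noteq> 0" "LG.awalk (Suc l, b') q' (length Ls, j)"
    by (rule LN_Cons[OF Cons.prems(2)[unfolded q]])
  have le: "a' \<le> b'"
    by (rule noncrossingD[OF layers_nth[OF layers a(2)] Cons.prems(3) b(2) a(4) b(3) a(5) b(4)])
  have sub: "set (LG.awalk_verts (Suc l, a') p) \<subseteq> set (LG.awalk_verts (l, a) (e # p))"
    "set (LG.awalk_verts (Suc l, b') q') \<subseteq> set (LG.awalk_verts (l, b) (e' # q'))"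
    by (auto simp: a(1) b(1) LN_simps)
  have "set (LG.awalk_verts (Suc l, a') p) \<inter> set (LG.awalk_verts (Suc l, b') q') \<noteq> {}"
  proof (cases "a' = b'")
    case True
    then show ?thesis using LG.hd_in_awalk_verts(1)[OF a(6)] LG.hd_in_awalk_verts(1)[OF b(5)] by auto
  next
    case False
    then show ?thesis using Cons.IH[OF a(6) b(5) _ Cons.prems(4)] le by simp
  qed
  then show ?case using sub unfolding q by blast
qed

text \<open>No drawing in the disc is involved: the crossing property comes from the noncrossing
  layers. Nonemptiness of \<open>Ls\<close> separates the level of the sources from that of the
  sinks.\<close>

lemma path_network_LN: "path_network LN n"
proof -
  have "\<nexists>c. LG.cycle c"
  proof
    assume "\<exists>c. LG.cycle c"
    then obtain c u where "LG.awalk u c u" "c \<noteq> []" by (auto simp: LG.cycle_def)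
    then show False using LN_walk_level[of u c u] by simp
  qed
  then show ?thesis
    by unfold_locales (use ne LN_crossing in \<open>auto simp: LN_simps\<close>)
qed

text \<open>Transfer matrices: splitting off the first edge of a walk reproduces the recursion of
  \<open>layer_prod\<close>. Finiteness is carried along because the disjoint union over first edges
  requires it.\<close>

lemma LN_path_sum:
  assumes "l \<le> length Ls" "i < width n Ls l" "j < n"
  shows "finite {p. LG.awalk (l, i) p (length Ls, j)} \<and>
    (\<Sum>p | LG.awalk (l, i) p (length Ls, j). prod_list (map (weight LN) p)) = layer_prod (drop l Ls) i j"
  using assms
proof (induction "length Ls - l" arbitrary: l i)
  case 0
  then have l: "l = length Ls" by simp
  have "LG.awalk (l, i) p (length Ls, j) \<longleftrightarrow> p = [] \<and> i = j" for p
  proof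
    assume w: "LG.awalk (l, i) p (length Ls, j)"
    then have "p = []" using LN_walk_level[OF w] l by simp
    then show "p = [] \<and> i = j" using w by (simp add: LG.awalk_Nil_iff)
  next
    assume "p = [] \<and> i = j"
    then show "LG.awalk (l, i) p (length Ls, j)"
      using 0 l by (simp add: LG.awalk_Nil_iff LN_simps)
  qed
  then have "{p. LG.awalk (l, i) p (length Ls, j)} = (if i = j then {[]} else {})" by auto
  then show ?case using l by simp
next
  case (Suc k)
  then have l: "l < length Ls" by simp
  let ?B = "snd (Ls ! l)" and ?w = "width n Ls (Suc l)"
  let ?P = "\<lambda>l i. {p. LG.awalk (l, i) p (length Ls, j)}"
  let ?S = "{i'. i' < ?w \<and> ?B i i' \<noteq> 0}"
  let ?e = "\<lambda>i'. ((l, i), (Suc l, i'))"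
  have IH: "finite (?P (Suc l) i') \<and>
      (\<Sum>p\<in>?P (Suc l) i'. prod_list (map (weight LN) p)) = layer_prod (drop (Suc l) Ls) i' j"
    if "i' < ?w" for i'
    using Suc.hyps(1)[of "Suc l" i'] Suc.hyps(2) l that Suc.prems(3) by simp
  have P: "?P l i = (\<Union>i'\<in>?S. Cons (?e i') ` ?P (Suc l) i')"
  proof (intro Set.equalityI subsetI)
    fix p assume "p \<in> ?P l i"
    then have w: "LG.awalk (l, i) p (length Ls, j)" by simp
    then have "length p \<noteq> 0" using LN_walk_level[OF w] l by simp
    then obtain e p' where p: "p = e # p'" by (cases p) auto
    obtain i' where "e = ?e i'" "i' \<in> ?S" "LG.awalk (Suc l, i') p' (length Ls, j)"
      by (rule LN_Cons[OF w[unfolded p]]) auto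
    then show "p \<in> (\<Union>i'\<in>?S. Cons (?e i') ` ?P (Suc l) i')" using p by blast
  next
    fix p assume "p \<in> (\<Union>i'\<in>?S. Cons (?e i') ` ?P (Suc l) i')"
    then obtain i' p' where "p = ?e i' # p'" "i' \<in> ?S" "LG.awalk (Suc l, i') p' (length Ls, j)" by blast
    then show "p \<in> ?P l i"
      using l Suc.prems(2) by (simp add: LG.awalk_Cons_iff LN_simps)
  qed
  have fin: "finite (Cons (?e i') ` ?P (Suc l) i')" if "i' \<in> ?S" for i' using IH that by simp
  have "(\<Sum>p\<in>?P l i. prod_list (map (weight LN) p)) =
      (\<Sum>i'\<in>?S. \<Sum>p\<in>Cons (?e i') ` ?P (Suc l) i'. prod_list (map (weight LN) p))"
    unfolding P by (rule sum.UNION_disjoint) (use fin in auto)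
  also have "\<dots> = (\<Sum>i'\<in>?S. ?B i i' * layer_prod (drop (Suc l) Ls) i' j)"
  proof (rule sum.cong[OF refl])
    fix i' assume "i' \<in> ?S"
    then have i': "i' < ?w" by simp
    have "(\<Sum>p\<in>Cons (?e i') ` ?P (Suc l) i'. prod_list (map (weight LN) p)) =
        (\<Sum>p\<in>?P (Suc l) i'. ?B i i' * prod_list (map (weight LN) p))"
      by (subst sum.reindex) (auto simp: LN_simps)
    then show "(\<Sum>p\<in>Cons (?e i') ` ?P (Suc l) i'. prod_list (map (weight LN) p)) =
        ?B i i' * layer_prod (drop (Suc l) Ls) i' j"
      using IH[OF i'] by (simp add: sum_distrib_left[symmetric])
  qed
  also have "\<dots> = (\<Sum>i'<?w. ?B i i' * layer_prod (drop (Suc l) Ls) i' j)"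
    by (rule sum.mono_neutral_left) auto
  also have "\<dots> = layer_prod (drop l Ls) i j"
  proof -
    have "drop l Ls = (?w, ?B) # drop (Suc l) Ls"
      using Cons_nth_drop_Suc[OF l] l by (simp add: width_def)
    then show ?thesis by simp
  qed
  finally show ?case unfolding P using fin by simp
qed

lemma path_matrix_LN:
  assumes "i < n" "j < n"
  shows "path_matrix n LN $$ (i, j) = layer_prod Ls i j"
proof -
  interpret N: path_network LN n by (rule path_network_LN)
  have "network_paths LN i j = {p. LG.awalk (0, i) p (length Ls, j)}"
    using N.paths_iff[of _ i j] by (auto simp: LN_simps)
  then show ?thesis
    using LN_path_sum[of 0 i j] assms by (simp add: path_matrix_def width_def)
qed

lemma weight_LN_nonneg:
  assumes "e \<in> arcs (graph LN)" shows "0 \<le> weight LN e"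
proof -
  obtain l i l' j where e: "e = ((l, i), (l', j))" by (metis surj_pair)
  then have "l < length Ls" "i < width n Ls l" "j < width n Ls (Suc l)"
    using assms by (auto simp: LN_simps)
  then show ?thesis using layers_nth[OF layers, of l] by (simp add: e LN_simps noncrossing_def)
qed

end

section \<open>From total nonnegativity of a matrix to monotone selections\<close>

lemma pick_strict_mono:
  assumes "\<And>a b. a < b \<Longrightarrow> b < s \<Longrightarrow> r a < (r b :: nat)" and a: "a < s"
  shows "pick (r ` {..<s}) a = r a"
proof -
  have less: "r b < r a \<longleftrightarrow> b < a" if "b < s" for b
    using assms(1)[of b a] assms(1)[of a b] that a by (metis less_asym linorder_neqE_nat)
  have "{x \<in> r ` {..<s}. x < r a} = r ` {..<a}"
    using less a by auto
  moreover have "inj_on r {..<a}"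
  proof (rule inj_onI)
    fix b c assume "b \<in> {..<a}" "c \<in> {..<a}" "r b = r c"
    then show "b = c" using assms(1)[of b c] assms(1)[of c b] a by (cases b c rule: linorder_cases) auto
  qed
  ultimately have "card {x \<in> r ` {..<s}. x < r a} = a" by (simp add: card_image)
  then show ?thesis using pick_card_in_set[of "r a" "r ` {..<s}"] a by simp
qed

lemma totally_nonnegative_mat_totnn:
  assumes A: "totally_nonnegative_mat n A"
  shows "totnn n n (\<lambda>i j. A $$ (i, j))"
proof (rule totnnI)
  fix s :: nat and r c assume r: "mono_on {..<s} r" "\<And>a. a < s \<Longrightarrow> r a < n"
    and c: "mono_on {..<s} c" "\<And>b. b < s \<Longrightarrow> c b < n"
  let ?D = "det_on {..<s} (\<lambda>a b. A $$ (r a, c b))"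
  have dim: "dim_row A = n" "dim_col A = n" using A by (auto simp: totally_nonnegative_mat_def)
  show "0 \<le> ?D"
  proof (cases "inj_on r {..<s} \<and> inj_on c {..<s}")
    case False
    then consider a b where "a < s" "b < s" "a \<noteq> b" "r a = r b" | a b where "a < s" "b < s" "a \<noteq> b" "c a = c b"
      by (auto simp: inj_on_def)
    then have "?D = 0"
    proof cases
      case 1
      then show ?thesis by (intro det_on_eq_rows[of _ a b]) auto
    next
      case 2
      then have "det_on {..<s} (\<lambda>b a. A $$ (r a, c b)) = 0" by (intro det_on_eq_rows[of _ a b]) auto
      then show ?thesis using det_on_transpose[of "{..<s}" "\<lambda>a b. A $$ (r a, c b)"] by simp
    qed
    then show ?thesis by simp
  next
    case True
    let ?I = "r ` {..<s}" and ?J = "c ` {..<s}"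
    have sr: "r a < r b" if "a < b" "b < s" for a b
      using mono_onD[OF r(1), of a b] inj_onD[of r "{..<s}" a b] True that by (auto simp: le_less)
    have sc: "c a < c b" if "a < b" "b < s" for a b
      using mono_onD[OF c(1), of a b] inj_onD[of c "{..<s}" a b] True that by (auto simp: le_less)
    have I: "?I \<subseteq> {..<n}" "?J \<subseteq> {..<n}" and card: "card ?I = s" "card ?J = s"
      using r(2) c(2) True by (auto simp: card_image)
    have "{i. i < n \<and> i \<in> ?I} = ?I" "{j. j < n \<and> j \<in> ?J} = ?J" using I by auto
    then have "submatrix A ?I ?J = Matrix.mat s s (\<lambda>(i, j). A $$ (r i, c j))"
      unfolding submatrix_def dim using card pick_strict_mono[OF sr] pick_strict_mono[OF sc]
      by (auto intro!: eq_matI)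
    then have "?D = Determinant.det (submatrix A ?I ?J)" by (simp add: det_on_lessThan)
    then show ?thesis using A I card by (simp add: totally_nonnegative_mat_def)
  qed
qed

lemma hook_network_intro:
  assumes "path_network F n" "1 \<le> k" "k \<le> n"
  shows "hook_network F n k (n - k)"
proof -
  interpret path_network F n by (rule assms(1))
  show ?thesis by unfold_locales (use assms(2,3) in auto)
qed

theorem theorem4p6:
  fixes n k :: nat
  assumes "1 \<le> k" and "k \<le> n"
  shows "totally_nonnegative_poly n (immanant n (irreducible_character (hook n k))) \<and>
    (\<forall>F :: ('v, 'e) network. nonneg_planar_network n F \<longrightarrow>
       immanant n (irreducible_character (hook n k)) (path_matrix n F) =
         (\<Sum>U \<in> standard_F_tableaux n F (hook n k). tableau_weight F U))"
proof (intro conjI allI impI)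
  show "totally_nonnegative_poly n (immanant n (irreducible_character (hook n k)))"
    unfolding totally_nonnegative_poly_def
  proof (intro allI impI)
    fix A assume "totally_nonnegative_mat n A"
    then have "factors n n (\<lambda>i j. A $$ (i, j))"
      by (intro totnn_factors totally_nonnegative_mat_totnn)
    from factors_layers[OF this] obtain Ls where Ls: "Ls \<noteq> []" "layers n Ls n"
      and A: "\<forall>i<n. \<forall>j<n. A $$ (i, j) = layer_prod Ls i j" by blast
    let ?F = "layered_network n Ls"
    interpret hook_network ?F n k "n - k"
      by (rule hook_network_intro[OF path_network_LN[OF Ls(2,1)] assms])
    have "immanant n \<theta> A = immanant n \<theta> (path_matrix n ?F)" for \<theta>
      unfolding immanant_def
    proof (intro sum.cong refl arg_cong2[where f=times] prod.cong)
      fix w i assume "w \<in> {w. w permutes {..<n}}" "i \<in> {..<n}"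
      then have "i < n" "w i < n" using permutes_in_image[of w "{..<n}" i] by auto
      then show "A $$ (i, w i) = path_matrix n ?F $$ (i, w i)"
        using A path_matrix_LN[OF Ls(2,1)] by simp
    qed
    moreover have "0 \<le> immanant n (irreducible_character (hook n k)) (path_matrix n ?F)"
      by (rule immanant_path_matrix_nonneg) (rule weight_LN_nonneg[OF Ls(2,1)])
    ultimately show "0 \<le> immanant n (irreducible_character (hook n k)) A" by simp
  qed
next
  fix F :: "('v, 'e) network" assume "nonneg_planar_network n F"
  then interpret hook_network F n k "n - k"
    by (intro hook_network_intro planar_path_network assms)
  show "immanant n (irreducible_character (hook n k)) (path_matrix n F) =
      (\<Sum>U \<in> standard_F_tableaux n F (hook n k). tableau_weight F U)"
    by (rule immanant_path_matrix)
qed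

end
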